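(* Let $0<s<1$ and $n\ge 2$. Let $\Omega\subset\mathbb R^n$ be bounded and open, and set $\Omega_e=\mathbb R^n\setminus\overline\Omega$. Let $W_1,W_2\Subset\Omega_e$ be nonempty open sets such that $W_1\cap W_2\neq\emptyset$. Let $a_1,a_2\in C^\infty(\mathbb S^{n-1})$ be smooth elliptic angular densities. If $$\Lambda_{a_1}^{W_1,W_2}f=\Lambda_{a_2}^{W_1,W_2}f\quad\text{for all } f\in\widetilde H^s(W_1),$$ then $a_1=a_2$ on $\mathbb S^{n-1}$.
   Context: Functions are complex-valued unless stated otherwise; $W\Subset\Omega_e$ means that $\overline W$ is compact and contained in $\Omega_e$. The Fourier transform is $\widehat u(\xi)=(2\pi)^{-n/2}\int_{\mathbb R^n}e^{-\mathrm i x\cdot\xi}u(x)\,dx$, and $H^t(\mathbb R^n)$ is the $L^2$-based Sobolev space with norm $\|(1+|\xi|^2)^{t/2}\widehat u\|_{L^2(\mathbb R^n)}$. For $U\subset\mathbb R^n$ open, $\widetilde H^t(U)$ is the closure of $C_c^\infty(U)$ in $H^t(\mathbb R^n)$ (elements are identified with their zero extensions), and for $t\ge0$, $H^{-t}(U)=(\widetilde H^t(U))^*$, with pairing $\langle F,v\rangle$ linear in $F\in H^{-t}(U)$ and conjugate-linear in $v\in\widetilde H^t(U)$. For a real-valued even function $a\in L^1(\mathbb S^{n-1})$, set $K_a(z)=a(z/|z|)\,|z|^{-n-2s}$ for $z\ne0$, $$\mathcal E_a(u,v)=\frac12\iint_{\mathbb R^n\times\mathbb R^n}(u(x)-u(y))\overline{(v(x)-v(y))}\,K_a(x-y)\,dx\,dy,$$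 and $$A_a(\xi)=c_{n,s}\int_{\mathbb S^{n-1}}|\xi\cdot\theta|^{2s}a(\theta)\,d\theta,\qquad c_{n,s}=\int_0^\infty\frac{1-\cos\rho}{\rho^{1+2s}}\,d\rho .$$ Ellipticity: there are constants $0<\lambda\le\Lambda<\infty$ with $\lambda|\xi|^{2s}\le A_a(\xi)\le\Lambda|\xi|^{2s}$ for all $\xi\in\mathbb R^n$. Under ellipticity $\mathcal E_a$ (defined on Schwartz functions) extends to a bounded sesquilinear form on $H^s(\mathbb R^n)\times H^s(\mathbb R^n)$, namely $\int A_a\,\widehat u\,\overline{\widehat v}\,d\xi$. A smooth elliptic angular density is a real-valued, even, nonnegative $a\in C^\infty(\mathbb S^{n-1})$ whose symbol $A_a$ satisfies ellipticity. For $f\in\widetilde H^s(W_1)$, $u_f\in H^s(\mathbb R^n)$ is the unique function with $u_f-f\in\widetilde H^s(\Omega)$ and $\mathcal E_a(u_f,\phi)=0$ for all $\phi\in\widetilde H^s(\Omega)$ (the weak solution of $L_au_f=0$ in $\Omega$, $u_f=f$ in $\Omega_e$, where $L_au(x)=\mathrm{P.V.}\int(u(x)-u(y))K_a(x-y)\,dy$). The restricted exterior Dirichlet-to-Neumann map $\Lambda_a^{W_1,W_2}:\widetilde H^s(W_1)\to H^{-s}(W_2)$ is defined by $\langle\Lambda_a^{W_1,W_2}f,g\rangle=\mathcal E_a(u_f,g)$ for $g\in\widetilde H^s(W_2)$. *)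

theory Defs
  imports "HOL-Analysis.Analysis"
begin

section \<open>Smooth functions\<close>

primrec Ck_on :: "nat \<Rightarrow> 'a::real_normed_vector set \<Rightarrow> ('a \<Rightarrow> 'b::real_normed_vector) \<Rightarrow> bool" where
  "Ck_on 0 U f \<longleftrightarrow> continuous_on U f"
| "Ck_on (Suc k) U f \<longleftrightarrow>
     (\<forall>x\<in>U. f differentiable (at x)) \<and> (\<forall>v. Ck_on k U (\<lambda>x. frechet_derivative f (at x) v))"

text \<open>Only meant for open \<open>U\<close>.\<close>
definition smooth_on :: "'a::real_normed_vector set \<Rightarrow> ('a \<Rightarrow> 'b::real_normed_vector) \<Rightarrow> bool" where
  "smooth_on U f \<longleftrightarrow> (\<forall>k. Ck_on k U f)"

text \<open>Smoothness on the sphere as an embedded submanifold: the restriction to the sphere is the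
  restriction of a smooth function on an open neighbourhood. A function on the sphere is represented
  by a function on the whole space of which only the values on the sphere are ever relevant.\<close>
definition smooth_on_unit_sphere :: "('a::euclidean_space \<Rightarrow> real) \<Rightarrow> bool" where
  "smooth_on_unit_sphere a \<longleftrightarrow>
     (\<exists>U b. open U \<and> sphere 0 1 \<subseteq> U \<and> smooth_on U b \<and> (\<forall>\<theta>\<in>sphere 0 1. a \<theta> = b \<theta>))"

definition test_functions :: "'a::euclidean_space set \<Rightarrow> ('a \<Rightarrow> complex) set" where
  "test_functions U = {\<phi>. smooth_on UNIV \<phi> \<and>
     compact (closure {x. \<phi> x \<noteq> 0}) \<and> closure {x. \<phi> x \<noteq> 0} \<subseteq> U}"

section \<open>Fourier transform and Sobolev spaces\<close>

text \<open>Elements of the function spaces are represented by Borel functions; functions that agree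
  almost everywhere represent the same element.\<close>

definition L2 :: "('a::euclidean_space \<Rightarrow> complex) set" where
  "L2 = {u. u \<in> borel_measurable lborel \<and> integrable lborel (\<lambda>x. (cmod (u x))\<^sup>2)}"

definition fourier_L1 :: "('a::euclidean_space \<Rightarrow> complex) \<Rightarrow> 'a \<Rightarrow> complex" where
  "fourier_L1 u \<xi> = of_real ((2 * pi) powr (- real DIM('a) / 2)) *
     (\<integral>x. exp (- \<i> * of_real (x \<bullet> \<xi>)) * u x \<partial>lborel)"

text \<open>The Plancherel transform: the limit in \<open>L2\<close> of the transforms of the truncations of \<open>u\<close> to
  balls. The limit is unique only up to a null set, so \<open>SOME\<close> picks a representative.\<close>
definition fourier :: "('a::euclidean_space \<Rightarrow> complex) \<Rightarrow> 'a \<Rightarrow> complex" where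
  "fourier u = (SOME U. U \<in> L2 \<and>
     (\<lambda>k::nat. \<integral>\<^sup>+\<xi>. ennreal ((cmod
        (fourier_L1 (\<lambda>x. if norm x \<le> real k then u x else 0) \<xi> - U \<xi>))\<^sup>2) \<partial>lborel)
       \<longlonglongrightarrow> 0)"

text \<open>The spaces \<open>H\<^sup>t\<close> of order \<open>t \<ge> 0\<close> only, so that all elements are functions in \<open>L2\<close>.\<close>
definition sobolev :: "real \<Rightarrow> ('a::euclidean_space \<Rightarrow> complex) set" where
  "sobolev t = {u. u \<in> L2 \<and>
     integrable lborel (\<lambda>\<xi>. (1 + (norm \<xi>)\<^sup>2) powr t * (cmod (fourier u \<xi>))\<^sup>2)}"

definition sobolev_norm :: "real \<Rightarrow> ('a::euclidean_space \<Rightarrow> complex) \<Rightarrow> real" where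
  "sobolev_norm t u =
     sqrt (\<integral>\<xi>. (1 + (norm \<xi>)\<^sup>2) powr t * (cmod (fourier u \<xi>))\<^sup>2 \<partial>lborel)"

text \<open>The closure of the test functions on \<open>U\<close> in \<open>H\<^sup>t\<close> of the whole space.\<close>
definition sobolev_tilde :: "real \<Rightarrow> 'a::euclidean_space set \<Rightarrow> ('a \<Rightarrow> complex) set" where
  "sobolev_tilde t U = {u \<in> sobolev t.
     \<forall>\<epsilon>>0. \<exists>\<phi>\<in>test_functions U. sobolev_norm t (\<lambda>x. u x - \<phi> x) < \<epsilon>}"

section \<open>Angular densities\<close>

text \<open>Surface measure on the unit sphere, as \<open>n\<close> times the Lebesgue measure of the cone over a
  set (polar coordinates). Its underlying space is the sphere, not the whole space.\<close>
definition surface_measure :: "'a::euclidean_space measure" where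
  "surface_measure = scale_measure (of_nat DIM('a))
     (distr (restrict_space lborel (ball 0 1 - {0})) (restrict_space borel (sphere 0 1))
        (\<lambda>x. x /\<^sub>R norm x))"

definition symbol_const :: "real \<Rightarrow> real" where
  "symbol_const s = (LBINT \<rho>:{0<..}. (1 - cos \<rho>) / \<rho> powr (1 + 2 * s))"

definition symbol :: "real \<Rightarrow> ('a::euclidean_space \<Rightarrow> real) \<Rightarrow> 'a \<Rightarrow> real" where
  "symbol s a \<xi> = symbol_const s * (\<integral>\<theta>. \<bar>\<xi> \<bullet> \<theta>\<bar> powr (2 * s) * a \<theta> \<partial>surface_measure)"

definition elliptic :: "real \<Rightarrow> ('a::euclidean_space \<Rightarrow> real) \<Rightarrow> bool" where
  "elliptic s a \<longleftrightarrow> (\<exists>l L. 0 < l \<and> l \<le> L \<and>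
     (\<forall>\<xi>. l * norm \<xi> powr (2 * s) \<le> symbol s a \<xi> \<and> symbol s a \<xi> \<le> L * norm \<xi> powr (2 * s)))"

definition smooth_elliptic_density :: "real \<Rightarrow> ('a::euclidean_space \<Rightarrow> real) \<Rightarrow> bool" where
  "smooth_elliptic_density s a \<longleftrightarrow>
     smooth_on_unit_sphere a \<and>
     (\<forall>\<theta>\<in>sphere 0 1. a (- \<theta>) = a \<theta>) \<and>
     (\<forall>\<theta>\<in>sphere 0 1. 0 \<le> a \<theta>) \<and>
     elliptic s a"

section \<open>The form and the exterior Dirichlet-to-Neumann map\<close>

text \<open>The value at \<open>z = 0\<close> is \<open>0\<close>, because \<open>0 powr r = 0\<close>.\<close>
definition kernel :: "real \<Rightarrow> ('a::euclidean_space \<Rightarrow> real) \<Rightarrow> 'a \<Rightarrow> real" where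
  "kernel s a z = a (z /\<^sub>R norm z) * norm z powr (- real DIM('a) - 2 * s)"

text \<open>If \<open>0 < s < 1\<close> and \<open>a\<close> is smooth on the sphere (hence bounded there), the double integral
  converges absolutely for all \<open>u\<close>, \<open>v\<close> in \<open>sobolev s\<close>, so on these it is the continuous extension of
  its restriction to Schwartz functions.\<close>
definition energy_form ::
    "real \<Rightarrow> ('a::euclidean_space \<Rightarrow> real) \<Rightarrow> ('a \<Rightarrow> complex) \<Rightarrow> ('a \<Rightarrow> complex) \<Rightarrow> complex" where
  "energy_form s a u v = 1 / 2 *
     (\<integral>(x, y). (u x - u y) * cnj (v x - v y) * of_real (kernel s a (x - y))
        \<partial>(lborel \<Otimes>\<^sub>M lborel))"

definition weak_solution ::
    "real \<Rightarrow> 'a::euclidean_space set \<Rightarrow> ('a \<Rightarrow> real) \<Rightarrow> ('a \<Rightarrow> complex) \<Rightarrow> ('a \<Rightarrow> complex) \<Rightarrow> bool" where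
  "weak_solution s \<Omega> a f u \<longleftrightarrow>
     u \<in> sobolev s \<and> (\<lambda>x. u x - f x) \<in> sobolev_tilde s \<Omega> \<and>
     (\<forall>\<phi>\<in>sobolev_tilde s \<Omega>. energy_form s a u \<phi> = 0)"

text \<open>The weak solution is unique only up to a null set, so \<open>SOME\<close> picks a representative.\<close>
definition exterior_solution ::
    "real \<Rightarrow> 'a::euclidean_space set \<Rightarrow> ('a \<Rightarrow> real) \<Rightarrow> ('a \<Rightarrow> complex) \<Rightarrow> 'a \<Rightarrow> complex" where
  "exterior_solution s \<Omega> a f = (SOME u. weak_solution s \<Omega> a f u)"

text \<open>The value at \<open>f\<close> is an element of the dual of \<open>sobolev_tilde s W2\<close>, represented as a functional
  with domain exactly \<open>sobolev_tilde s W2\<close>, so that equality of values is equality in the dual.\<close>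
definition DN_map ::
    "real \<Rightarrow> 'a::euclidean_space set \<Rightarrow> 'a set \<Rightarrow> 'a set \<Rightarrow> ('a \<Rightarrow> real)
      \<Rightarrow> ('a \<Rightarrow> complex) \<Rightarrow> ('a \<Rightarrow> complex) \<Rightarrow> complex" where
  "DN_map s \<Omega> W1 W2 a =
     (\<lambda>f\<in>sobolev_tilde s W1. \<lambda>g\<in>sobolev_tilde s W2.
        energy_form s a (exterior_solution s \<Omega> a f) g)"

definition compactly_contained :: "'a::topological_space set \<Rightarrow> 'a set \<Rightarrow> bool" where
  "compactly_contained W U \<longleftrightarrow> compact (closure W) \<and> closure W \<subseteq> U"

end

theory Submission
  imports Defs "HOL-Probability.Characteristic_Functions"
begin

text \<open>The Dirichlet-to-Neumann map sees the singularity of the kernel on the diagonal, and this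
  singularity is the density. Let \<open>f\<close> and \<open>g\<close> be test functions in a ball \<open>N\<close> inside
  \<open>W1 \<inter> W2\<close>, and write the solution with exterior datum \<open>f\<close> as \<open>u = f + w\<close>, where \<open>w\<close> lives in
  \<open>\<Omega>\<close>. Then the pairing of the Dirichlet-to-Neumann map is \<open>E(f, g) + E(w, g)\<close>. The second term
  is harmless: \<open>\<Omega>\<close> and \<open>N\<close> have positive distance, so \<open>w\<close> interacts with \<open>f\<close> and with \<open>g\<close>
  only through values of the kernel away from its singularity. Testing the equation with \<open>w\<close> and
  using a Poincare inequality gives \<open>\<parallel>w\<parallel> \<le> C \<parallel>f\<parallel>\<^sub>1\<close>, hence \<open>|E(w, g)| \<le> C \<parallel>f\<parallel>\<^sub>1 \<parallel>g\<parallel>\<^sub>1\<close>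
  (\<open>exterior_remainder_bound\<close>). So if two densities have the same map, their energies satisfy
  \<open>|E1(f, g) - E2(f, g)| \<le> C \<parallel>f\<parallel>\<^sub>1 \<parallel>g\<parallel>\<^sub>1\<close> with \<open>C\<close> independent of \<open>f\<close> and \<open>g\<close>. Now let \<open>f\<close>
  and \<open>g\<close> be bumps concentrated near \<open>x0 + t \<theta>\<close> and \<open>x0\<close>. For disjoint supports the energy is
  minus the integral of \<open>f(x) g(y) K(x - y)\<close>, so the left side is about
  \<open>|a1 \<theta> - a2 \<theta>| t powr (- n - 2 s) \<parallel>f\<parallel>\<^sub>1 \<parallel>g\<parallel>\<^sub>1\<close>, and small \<open>t\<close> forces \<open>a1 \<theta> = a2 \<theta>\<close>
  (\<open>density_le_of_DN_map_eq\<close>).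

  This argument presupposes that weak solutions exist (\<open>weak_solution_exists\<close>); they are found by
  minimising the energy. For that the Sobolev spaces, given through the Fourier transform, have to
  be described by the energy itself (\<open>sobolev_iff_finite_energy\<close>). Plancherel's theorem, applied to
  the increments \<open>u(\<cdot> + z) - u\<close> for every \<open>z\<close> and integrated against the kernel, turns the energy
  into a weighted \<open>L\<^sup>2\<close> norm of the transform (\<open>gagliardo_fourier\<close>). Its weight is homogeneous of
  degree \<open>2 s\<close>, continuous and positive on the sphere, and hence comparable to the \<open>2 s\<close>-th power of
  the norm (\<open>multiplier_bounds\<close>). Plancherel's theorem is obtained from the Gaussian in the
  classical way (\<open>gauss_damped_energy\<close>, \<open>plancherel_L1\<close>).\<close>

section \<open>Square-integrable functions\<close>

lemma borel_measurable_cnj [measurable (raw)]: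
  "f \<in> borel_measurable M \<Longrightarrow> (\<lambda>x. cnj (f x)) \<in> borel_measurable M"
  by (rule borel_measurable_continuous_on[OF continuous_on_cnj[OF continuous_on_id]])

text \<open>The underlying measure is a parameter because two measures occur: Lebesgue measure, and the
  measure on pairs of points in which the energy is an inner product of increments.\<close>
definition l2 :: "'b measure \<Rightarrow> ('b \<Rightarrow> complex) set" where
  "l2 M = {u. u \<in> borel_measurable M \<and> integrable M (\<lambda>x. (cmod (u x))\<^sup>2)}"

definition l2_norm :: "'b measure \<Rightarrow> ('b \<Rightarrow> complex) \<Rightarrow> real" where
  "l2_norm M u = sqrt (\<integral>x. (cmod (u x))\<^sup>2 \<partial>M)"

definition l2_inner :: "'b measure \<Rightarrow> ('b \<Rightarrow> complex) \<Rightarrow> ('b \<Rightarrow> complex) \<Rightarrow> complex" where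
  "l2_inner M u v = (\<integral>x. u x * cnj (v x) \<partial>M)"

abbreviation L1_norm :: "('a::euclidean_space \<Rightarrow> complex) \<Rightarrow> real" where
  "L1_norm u \<equiv> \<integral>x. cmod (u x) \<partial>lborel"

lemma L2_eq_l2: "L2 = l2 lborel"
  by (simp add: L2_def l2_def)

lemma l2_measurable [measurable_dest]: "u \<in> l2 M \<Longrightarrow> u \<in> borel_measurable M"
  and l2_integrable_sq: "u \<in> l2 M \<Longrightarrow> integrable M (\<lambda>x. (cmod (u x))\<^sup>2)"
  by (auto simp: l2_def)

lemma l2_zero [simp]: "(\<lambda>x. 0) \<in> l2 M"
  by (simp add: l2_def)

lemma l2_norm_nonneg [simp]: "0 \<le> l2_norm M u"
  by (simp add: l2_norm_def)

lemma l2_norm_sq: "(l2_norm M u)\<^sup>2 = (\<integral>x. (cmod (u x))\<^sup>2 \<partial>M)"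
  by (simp add: l2_norm_def)

lemma l2_norm_zero [simp]: "l2_norm M (\<lambda>x. 0) = 0"
  by (simp add: l2_norm_def)

lemma nn_integral_l2:
  "u \<in> l2 M \<Longrightarrow> (\<integral>\<^sup>+x. ennreal ((cmod (u x))\<^sup>2) \<partial>M) = ennreal ((l2_norm M u)\<^sup>2)"
  by (simp add: l2_norm_sq l2_integrable_sq nn_integral_eq_integral)

text \<open>The form in which Fatou's lemma delivers membership and norm bounds.\<close>
lemma l2_bounded:
  assumes "u \<in> borel_measurable M" "(\<integral>\<^sup>+x. ennreal ((cmod (u x))\<^sup>2) \<partial>M) \<le> ennreal (B\<^sup>2)" "0 \<le> B"
  shows "u \<in> l2 M" "l2_norm M u \<le> B"
proof -
  have "integrable M (\<lambda>x. (cmod (u x))\<^sup>2)"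
    using assms by (intro integrableI_bounded) (auto simp: le_less_trans)
  then show "u \<in> l2 M" using assms by (simp add: l2_def)
  then have "ennreal ((l2_norm M u)\<^sup>2) \<le> ennreal (B\<^sup>2)"
    using assms nn_integral_l2 by metis
  then have "(l2_norm M u)\<^sup>2 \<le> B\<^sup>2" by simp
  then show "l2_norm M u \<le> B" using assms(3) by (rule power2_le_imp_le)
qed

lemma l2_finite:
  assumes "u \<in> borel_measurable M" "(\<integral>\<^sup>+x. ennreal ((cmod (u x))\<^sup>2) \<partial>M) < \<infinity>"
  shows "u \<in> l2 M"
  using assms by (auto simp: l2_def intro!: integrableI_bounded)

lemma cmod_add_sq_le: "(cmod (a + b))\<^sup>2 \<le> 2 * (cmod a)\<^sup>2 + 2 * (cmod b)\<^sup>2"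
proof -
  have "(cmod (a + b))\<^sup>2 \<le> (cmod a + cmod b)\<^sup>2"
    by (intro power_mono norm_triangle_ineq) auto
  also have "\<dots> \<le> 2 * (cmod a)\<^sup>2 + 2 * (cmod b)\<^sup>2"
    using sum_squares_bound[of "cmod a" "cmod b"] by (simp add: power2_sum)
  finally show ?thesis .
qed

lemma l2_add: assumes "u \<in> l2 M" "v \<in> l2 M" shows "(\<lambda>x. u x + v x) \<in> l2 M"
proof -
  note [measurable] = l2_measurable[OF assms(1)] l2_measurable[OF assms(2)]
  have "integrable M (\<lambda>x. (cmod (u x + v x))\<^sup>2)"
    by (rule Bochner_Integration.integrable_bound[of _ "\<lambda>x. 2 * (cmod (u x))\<^sup>2 + 2 * (cmod (v x))\<^sup>2"])
       (use assms cmod_add_sq_le in \<open>auto simp: l2_integrable_sq\<close>)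
  then show ?thesis by (simp add: l2_def)
qed

lemma l2_scale: "u \<in> l2 M \<Longrightarrow> (\<lambda>x. c * u x) \<in> l2 M"
  by (auto simp: l2_def norm_mult power_mult_distrib)

lemma l2_diff: "u \<in> l2 M \<Longrightarrow> v \<in> l2 M \<Longrightarrow> (\<lambda>x. u x - v x) \<in> l2 M"
  using l2_add[of u M "\<lambda>x. (-1) * v x"] l2_scale[of v M "-1"] by simp

lemma l2_norm_scale: "l2_norm M (\<lambda>x. c * u x) = cmod c * l2_norm M u"
  by (simp add: l2_norm_def norm_mult power_mult_distrib real_sqrt_mult)

lemma l2_norm_minus_commute: "l2_norm M (\<lambda>x. u x - v x) = l2_norm M (\<lambda>x. v x - u x)"
  by (simp add: l2_norm_def norm_minus_commute)

lemma l2_norm_eq_0: "u \<in> l2 M \<Longrightarrow> l2_norm M u = 0 \<longleftrightarrow> (AE x in M. u x = 0)"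
  unfolding l2_norm_def using integral_nonneg_eq_0_iff_AE[OF l2_integrable_sq, of u M] by simp

lemma integrable_l2_prod:
  assumes "u \<in> l2 M" "v \<in> l2 M"
  shows "integrable M (\<lambda>x. cmod (u x) * cmod (v x))" "integrable M (\<lambda>x. u x * cnj (v x))"
proof -
  note [measurable] = l2_measurable[OF assms(1)] l2_measurable[OF assms(2)]
  have *: "cmod (u x) * cmod (v x) \<le> (cmod (u x))\<^sup>2 + (cmod (v x))\<^sup>2" for x
  proof -
    have "0 \<le> cmod (u x) * cmod (v x)" by simp
    then show ?thesis
      using sum_squares_bound[of "cmod (u x)" "cmod (v x)", unfolded mult.assoc] by linarith
  qed
  have i: "integrable M (\<lambda>x. (cmod (u x))\<^sup>2 + (cmod (v x))\<^sup>2)"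
    using assms by (auto simp: l2_integrable_sq)
  show "integrable M (\<lambda>x. cmod (u x) * cmod (v x))"
    by (rule Bochner_Integration.integrable_bound[OF i]) (use * in \<open>auto simp: norm_mult\<close>)
  show "integrable M (\<lambda>x. u x * cnj (v x))"
    by (rule Bochner_Integration.integrable_bound[OF i]) (use * in \<open>auto simp: norm_mult\<close>)
qed

text \<open>The inequality between arithmetic and geometric mean, applied pointwise after scaling both
  functions to norm one.\<close>
lemma l2_Cauchy_Schwarz_abs:
  assumes "u \<in> l2 M" "v \<in> l2 M"
  shows "(\<integral>x. cmod (u x) * cmod (v x) \<partial>M) \<le> l2_norm M u * l2_norm M v"
proof (cases "l2_norm M u = 0 \<or> l2_norm M v = 0")
  case True
  note [measurable] = l2_measurable[OF assms(1)] l2_measurable[OF assms(2)]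
  have "AE x in M. cmod (u x) * cmod (v x) = 0"
    using True assms by (auto simp: l2_norm_eq_0)
  then have "(\<integral>x. cmod (u x) * cmod (v x) \<partial>M) = (\<integral>x. 0 \<partial>M)"
    by (intro integral_cong_AE) auto
  then show ?thesis by simp
next
  case False
  define a b where "a = l2_norm M u" and "b = l2_norm M v"
  have ab: "a > 0" "b > 0" using False l2_norm_nonneg[of M u] l2_norm_nonneg[of M v]
    by (auto simp: a_def b_def order_less_le)
  have p: "cmod (u x) * cmod (v x) \<le> (b / (2 * a)) * (cmod (u x))\<^sup>2 + (a / (2 * b)) * (cmod (v x))\<^sup>2" for x
  proof -
    have "0 \<le> (b * cmod (u x) - a * cmod (v x))\<^sup>2" by simp
    then have "2 * (a * b) * (cmod (u x) * cmod (v x)) \<le> b\<^sup>2 * (cmod (u x))\<^sup>2 + a\<^sup>2 * (cmod (v x))\<^sup>2"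
      by (simp add: power2_diff power_mult_distrib algebra_simps)
    then show ?thesis using ab by (simp add: field_simps power2_eq_square)
  qed
  have "(\<integral>x. cmod (u x) * cmod (v x) \<partial>M) \<le>
      (\<integral>x. (b / (2 * a)) * (cmod (u x))\<^sup>2 + (a / (2 * b)) * (cmod (v x))\<^sup>2 \<partial>M)"
    by (rule integral_mono) (use p assms in \<open>auto simp: integrable_l2_prod l2_integrable_sq\<close>)
  also have "\<dots> = (b / (2 * a)) * a\<^sup>2 + (a / (2 * b)) * b\<^sup>2"
    using assms by (simp add: l2_integrable_sq a_def b_def l2_norm_sq)
  also have "\<dots> = a * b" using ab by (simp add: power2_eq_square)
  finally show ?thesis by (simp add: a_def b_def)
qed

lemma l2_Cauchy_Schwarz:
  assumes "u \<in> l2 M" "v \<in> l2 M"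
  shows "cmod (l2_inner M u v) \<le> l2_norm M u * l2_norm M v"
proof -
  have "cmod (l2_inner M u v) \<le> (\<integral>x. cmod (u x) * cmod (v x) \<partial>M)"
    unfolding l2_inner_def using integral_norm_bound[of M "\<lambda>x. u x * cnj (v x)"]
    by (simp add: norm_mult)
  then show ?thesis using l2_Cauchy_Schwarz_abs[OF assms] by linarith
qed

lemma l2_norm_add_sq:
  assumes "u \<in> l2 M" "v \<in> l2 M"
  shows "(l2_norm M (\<lambda>x. u x + v x))\<^sup>2 =
    (l2_norm M u)\<^sup>2 + 2 * Re (l2_inner M u v) + (l2_norm M v)\<^sup>2"
proof -
  have e: "(cmod (a + b))\<^sup>2 = (cmod a)\<^sup>2 + 2 * Re (a * cnj b) + (cmod b)\<^sup>2" for a b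
    unfolding cmod_power2 by (simp add: power2_eq_square algebra_simps)
  have "integrable M (\<lambda>x. Re (u x * cnj (v x)))"
    using integrable_l2_prod(2)[OF assms] by (rule integrable_Re)
  then have "(\<integral>x. (cmod (u x + v x))\<^sup>2 \<partial>M) =
     (\<integral>x. (cmod (u x))\<^sup>2 \<partial>M) + 2 * (\<integral>x. Re (u x * cnj (v x)) \<partial>M) + (\<integral>x. (cmod (v x))\<^sup>2 \<partial>M)"
    unfolding e using assms by (simp add: l2_integrable_sq del: times_complex.simps)
  also have "(\<integral>x. Re (u x * cnj (v x)) \<partial>M) = Re (l2_inner M u v)"
    unfolding l2_inner_def by (rule integral_Re) (rule integrable_l2_prod(2)[OF assms])
  finally show ?thesis by (simp add: l2_norm_sq)
qed

lemma l2_norm_triangle: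
  assumes "u \<in> l2 M" "v \<in> l2 M"
  shows "l2_norm M (\<lambda>x. u x + v x) \<le> l2_norm M u + l2_norm M v"
proof (rule power2_le_imp_le)
  have "Re (l2_inner M u v) \<le> l2_norm M u * l2_norm M v"
    using l2_Cauchy_Schwarz[OF assms] complex_Re_le_cmod order_trans by blast
  then show "(l2_norm M (\<lambda>x. u x + v x))\<^sup>2 \<le> (l2_norm M u + l2_norm M v)\<^sup>2"
    by (simp add: l2_norm_add_sq[OF assms] power2_sum)
qed simp

lemma l2_norm_triangle_diff:
  assumes "u \<in> l2 M" "v \<in> l2 M" "w \<in> l2 M"
  shows "l2_norm M (\<lambda>x. u x - w x) \<le> l2_norm M (\<lambda>x. u x - v x) + l2_norm M (\<lambda>x. v x - w x)"
  using l2_norm_triangle[OF l2_diff[OF assms(1,2)] l2_diff[OF assms(2,3)]] by simp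

lemma l2_norm_triangle_sub:
  assumes "u \<in> l2 M" "v \<in> l2 M"
  shows "l2_norm M (\<lambda>x. u x - v x) \<le> l2_norm M u + l2_norm M v"
  using l2_norm_triangle_diff[of u M "\<lambda>x. 0" v] assms l2_norm_scale[of M "-1" v] by simp

lemma l2_norm_reverse_triangle:
  assumes "u \<in> l2 M" "v \<in> l2 M"
  shows "\<bar>l2_norm M u - l2_norm M v\<bar> \<le> l2_norm M (\<lambda>x. u x - v x)"
  using l2_norm_triangle[OF l2_diff[OF assms] assms(2)]
    l2_norm_triangle[OF l2_diff[OF assms(2,1)] assms(1)]
  by (simp add: l2_norm_minus_commute[of M v u] abs_le_iff)

lemma l2_norm_tendsto:
  assumes "\<And>n. u n \<in> l2 M" "v \<in> l2 M" "(\<lambda>n. l2_norm M (\<lambda>x. u n x - v x)) \<longlonglongrightarrow> 0"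
  shows "(\<lambda>n. l2_norm M (u n)) \<longlonglongrightarrow> l2_norm M v"
proof -
  have "(\<lambda>n. l2_norm M (u n) - l2_norm M v) \<longlonglongrightarrow> 0"
    by (rule Lim_null_comparison[OF _ assms(3)])
       (simp add: l2_norm_reverse_triangle assms(1,2))
  then show ?thesis by (simp add: LIM_zero_iff)
qed

text \<open>This is the Riesz-Fischer theorem: along a subsequence with \<open>\<parallel>u\<^sub>k\<^sub>+\<^sub>1 - u\<^sub>k\<parallel> \<le> 2\<^sup>-\<^sup>k\<close> the sum of
  \<open>2\<^sup>k |u\<^sub>k\<^sub>+\<^sub>1 - u\<^sub>k|\<^sup>2\<close> has finite integral, which forces pointwise absolute convergence of the
  telescoping series almost everywhere; Fatou's lemma gives the norm convergence.\<close>
lemma l2_complete: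
  assumes u: "\<And>n. u n \<in> l2 M"
    and cauchy: "\<And>e. e > 0 \<Longrightarrow> \<exists>N. \<forall>m\<ge>N. \<forall>n\<ge>N. l2_norm M (\<lambda>x. u m x - u n x) < e"
  obtains v where "v \<in> l2 M" "(\<lambda>n. l2_norm M (\<lambda>x. u n x - v x)) \<longlonglongrightarrow> 0"
proof -
  note [measurable] = l2_measurable[OF u]
  have "\<exists>N. \<forall>m\<ge>N. \<forall>n\<ge>N. l2_norm M (\<lambda>x. u m x - u n x) < (1/2)^k" for k :: nat
    by (rule cauchy) simp
  then obtain N where N: "\<And>k m n. m \<ge> N k \<Longrightarrow> n \<ge> N k \<Longrightarrow> l2_norm M (\<lambda>x. u m x - u n x) < (1/2)^k"
    by metis
  define r where "r = rec_nat (N 0) (\<lambda>k p. Suc (max p (N (Suc k))))"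
  have r_Suc: "r (Suc k) = Suc (max (r k) (N (Suc k)))" for k by (simp add: r_def)
  have r_mono: "strict_mono r" by (rule strict_monoI_Suc) (simp add: r_Suc)
  have r_N: "r k \<ge> N k" for k by (cases k) (simp_all add: r_Suc, simp add: r_def)
  define d where "d k x = cmod (u (r (Suc k)) x - u (r k) x)" for k x
  have [measurable]: "d k \<in> borel_measurable M" for k unfolding d_def by measurable
  have d_int: "(\<integral>\<^sup>+x. ennreal ((d k x)\<^sup>2) \<partial>M) \<le> ennreal ((1/4)^k)" for k
  proof -
    have "l2_norm M (\<lambda>x. u (r (Suc k)) x - u (r k) x) < (1/2)^k"
      using r_N[of k] strict_monoD[OF r_mono, of k "Suc k"] by (intro N) auto
    then have "(l2_norm M (\<lambda>x. u (r (Suc k)) x - u (r k) x))\<^sup>2 \<le> ((1/2)^k)\<^sup>2"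
      by (intro power_mono) auto
    also have "((1/2)^k)\<^sup>2 = ((1/4)^k :: real)" by (simp add: power2_eq_square flip: power_mult_distrib)
    finally show ?thesis unfolding d_def
      by (subst nn_integral_l2) (auto intro!: l2_diff u ennreal_leI)
  qed
  have "(\<integral>\<^sup>+x. (\<Sum>k. ennreal (2^k * (d k x)\<^sup>2)) \<partial>M) = (\<Sum>k. \<integral>\<^sup>+x. ennreal (2^k * (d k x)\<^sup>2) \<partial>M)"
    by (rule nn_integral_suminf) simp
  also have "\<dots> \<le> (\<Sum>k. ennreal ((1/2)^k))"
  proof (intro suminf_le)
    fix k
    have "(\<integral>\<^sup>+x. ennreal (2^k * (d k x)\<^sup>2) \<partial>M) = ennreal (2^k) * (\<integral>\<^sup>+x. ennreal ((d k x)\<^sup>2) \<partial>M)"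
      by (simp add: ennreal_mult nn_integral_cmult)
    also have "\<dots> \<le> ennreal (2^k) * ennreal ((1/4)^k)"
      by (intro mult_left_mono d_int) simp
    also have "\<dots> = ennreal ((1/2)^k)"
      by (simp flip: ennreal_mult' power_mult_distrib)
    finally show "(\<integral>\<^sup>+x. ennreal (2^k * (d k x)\<^sup>2) \<partial>M) \<le> ennreal ((1/2)^k)" .
  qed auto
  also have "\<dots> = ennreal (\<Sum>k. (1/2)^k)"
    by (rule suminf_ennreal2) (auto intro: summable_geometric)
  finally have "(\<integral>\<^sup>+x. (\<Sum>k. ennreal (2^k * (d k x)\<^sup>2)) \<partial>M) \<noteq> \<infinity>"
    by (auto simp: top_unique)
  then have "AE x in M. (\<Sum>k. ennreal (2^k * (d k x)\<^sup>2)) \<noteq> \<infinity>"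
    by (intro nn_integral_PInf_AE) auto
  then have conv: "AE x in M. convergent (\<lambda>k. u (r k) x)"
  proof eventually_elim
    case (elim x)
    then have s: "summable (\<lambda>k. 2^k * (d k x)\<^sup>2)"
      by (intro summable_suminf_not_top) auto
    have "summable (\<lambda>k. d k x)"
    proof (rule summable_comparison_test')
      show "summable (\<lambda>k. 2^k * (d k x)\<^sup>2 + (1/2)^k)"
        by (intro summable_add s summable_geometric) simp
      fix k :: nat assume "k \<ge> 0"
      define p where "p = sqrt (2^k)"
      have p: "p > 0" "p\<^sup>2 = 2^k" by (simp_all add: p_def)
      have "2 * (p * d k x) * (1/p) \<le> (p * d k x)\<^sup>2 + (1/p)\<^sup>2" by (rule sum_squares_bound)
      then have "2 * d k x \<le> 2^k * (d k x)\<^sup>2 + (1/2)^k"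
        using p by (simp add: power_mult_distrib power_divide power_one_over)
      moreover have "d k x \<ge> 0" by (simp add: d_def)
      ultimately show "norm (d k x) \<le> 2^k * (d k x)\<^sup>2 + (1/2)^k" by simp
    qed
    then have "summable (\<lambda>k. u (r (Suc k)) x - u (r k) x)"
      unfolding d_def by (rule summable_norm_cancel)
    then have "convergent (\<lambda>n. \<Sum>k<n. u (r (Suc k)) x - u (r k) x)"
      by (simp add: summable_iff_convergent)
    then have "convergent (\<lambda>n. u (r n) x - u (r 0) x)" 
      using sum_lessThan_telescope[of "\<lambda>k. u (r k) x"] by simp
    then show ?case using convergent_add_const_right_iff[of "\<lambda>n. u (r n) x" "- u (r 0) x"] by simp
  qed
  define v where "v x = lim (\<lambda>k. u (r k) x)" for x
  have [measurable]: "v \<in> borel_measurable M" unfolding v_def by measurable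
  have lim: "AE x in M. (\<lambda>k. u (r k) x) \<longlonglongrightarrow> v x"
    using conv by eventually_elim (simp add: v_def convergent_LIMSEQ_iff)
  have fatou: "(\<lambda>x. u m x - v x) \<in> l2 M \<and> l2_norm M (\<lambda>x. u m x - v x) \<le> e"
    if "e > 0" "\<And>n. n \<ge> K \<Longrightarrow> l2_norm M (\<lambda>x. u m x - u n x) \<le> e" for m K e
  proof -
    have "(\<integral>\<^sup>+x. ennreal ((cmod (u m x - v x))\<^sup>2) \<partial>M) =
        (\<integral>\<^sup>+x. liminf (\<lambda>k. ennreal ((cmod (u m x - u (r k) x))\<^sup>2)) \<partial>M)"
    proof (rule nn_integral_cong_AE, use lim in eventually_elim)
      case (elim x)
      have "(\<lambda>k. ennreal ((cmod (u m x - u (r k) x))\<^sup>2)) \<longlonglongrightarrow> ennreal ((cmod (u m x - v x))\<^sup>2)"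
        by (intro tendsto_ennrealI tendsto_intros elim)
      then show ?case by (intro lim_imp_Liminf[symmetric]) auto
    qed
    also have "\<dots> \<le> liminf (\<lambda>k. \<integral>\<^sup>+x. ennreal ((cmod (u m x - u (r k) x))\<^sup>2) \<partial>M)"
      by (rule nn_integral_liminf) simp
    also have "\<dots> \<le> limsup (\<lambda>k. \<integral>\<^sup>+x. ennreal ((cmod (u m x - u (r k) x))\<^sup>2) \<partial>M)"
      by (rule Liminf_le_Limsup) simp
    also have "\<dots> \<le> ennreal (e\<^sup>2)"
    proof (rule Limsup_bounded, rule eventually_sequentiallyI[of K])
      fix k assume "K \<le> k"
      then have "r k \<ge> K" using seq_suble[OF r_mono, of k] by simp
      then have "(l2_norm M (\<lambda>x. u m x - u (r k) x))\<^sup>2 \<le> e\<^sup>2"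
        by (intro power_mono that) auto
      then show "(\<integral>\<^sup>+x. ennreal ((cmod (u m x - u (r k) x))\<^sup>2) \<partial>M) \<le> ennreal (e\<^sup>2)"
        by (subst nn_integral_l2) (auto intro!: l2_diff u ennreal_leI)
    qed
    finally show ?thesis using that(1) by (intro conjI l2_bounded) auto
  qed
  have v: "v \<in> l2 M"
  proof -
    have "(\<lambda>x. u (N 0) x - v x) \<in> l2 M"
      using fatou[of 1 "N 0" "N 0"] N[of 0 "N 0"] by (auto intro: less_imp_le)
    then show ?thesis using l2_diff[OF u[of "N 0"]] by fastforce
  qed
  have "(\<lambda>n. l2_norm M (\<lambda>x. u n x - v x)) \<longlonglongrightarrow> 0"
  proof (rule LIMSEQ_I)
    fix e :: real assume "e > 0"
    then obtain K where K: "\<And>m n. m \<ge> K \<Longrightarrow> n \<ge> K \<Longrightarrow> l2_norm M (\<lambda>x. u m x - u n x) < e / 2"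
      using cauchy[of "e/2"] by auto
    have "l2_norm M (\<lambda>x. u m x - v x) \<le> e / 2" if "m \<ge> K" for m
      using fatou[of "e/2" K m] K[OF that] \<open>e > 0\<close> by (auto intro: less_imp_le)
    then show "\<exists>K. \<forall>n\<ge>K. norm (l2_norm M (\<lambda>x. u n x - v x) - 0) < e"
      using \<open>e > 0\<close> by (intro exI[of _ K]) fastforce
  qed
  then show ?thesis using that v by blast
qed

lemma l2_convergent_Cauchy:
  assumes u: "\<And>n. u n \<in> l2 M" and v: "v \<in> l2 M"
    and lim: "(\<lambda>n. l2_norm M (\<lambda>x. u n x - v x)) \<longlonglongrightarrow> 0" and e: "e > (0::real)"
  shows "\<exists>N. \<forall>m\<ge>N. \<forall>n\<ge>N. l2_norm M (\<lambda>x. u m x - u n x) < e"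
proof -
  obtain N where N: "\<And>n. n \<ge> N \<Longrightarrow> l2_norm M (\<lambda>x. u n x - v x) < e / 2"
    using LIMSEQ_D[OF lim, of "e/2"] e by auto
  have "l2_norm M (\<lambda>x. u m x - u n x) < e" if "m \<ge> N" "n \<ge> N" for m n
    using l2_norm_triangle_diff[OF u[of m] v u[of n]] N[OF that(1)] N[OF that(2)]
    by (simp add: l2_norm_minus_commute[of M v])
  then show ?thesis by blast
qed

section \<open>The Gaussian\<close>

lemma nn_integral_lborel_affine:
  fixes t :: "'a::euclidean_space"
  assumes [measurable]: "f \<in> borel_measurable borel" and c: "c \<noteq> 0"
  shows "(\<integral>\<^sup>+x. f x \<partial>lborel) = ennreal (\<bar>c\<bar> ^ DIM('a)) * (\<integral>\<^sup>+x. f (t + c *\<^sub>R x) \<partial>lborel)"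
  by (subst lborel_affine[OF c, of t])
     (simp add: nn_integral_density nn_integral_distr nn_integral_cmult)

lemma integral_lborel_affine:
  fixes t :: "'a::euclidean_space" and f :: "'a \<Rightarrow> 'b::{banach, second_countable_topology}"
  assumes [measurable]: "f \<in> borel_measurable borel" and c: "c \<noteq> 0"
  shows "(\<integral>x. f x \<partial>lborel) = (\<bar>c\<bar> ^ DIM('a)) *\<^sub>R (\<integral>x. f (t + c *\<^sub>R x) \<partial>lborel)"
  by (subst lborel_affine[OF c, of t]) (simp add: integral_density integral_distr)

lemma integrable_lborel_affine:
  fixes t :: "'a::euclidean_space" and f :: "'a \<Rightarrow> 'b::{banach, second_countable_topology}"
  assumes f: "integrable lborel f" and c: "c \<noteq> 0"
  shows "integrable lborel (\<lambda>x. f (t + c *\<^sub>R x))"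
proof -
  have [measurable]: "f \<in> borel_measurable borel" using f by (auto dest: borel_measurable_integrable)
  have "(\<integral>\<^sup>+x. ennreal (norm (f x)) \<partial>lborel) < \<infinity>" using f by (simp add: integrable_iff_bounded)
  then have "(\<integral>\<^sup>+x. ennreal (norm (f (t + c *\<^sub>R x))) \<partial>lborel) < \<infinity>"
    using c by (subst (asm) nn_integral_lborel_affine[of _ c t]) (auto simp: ennreal_mult_less_top)
  then show ?thesis by (simp add: integrable_iff_bounded)
qed

lemma l2_translate:
  fixes u :: "'a::euclidean_space \<Rightarrow> complex"
  assumes "u \<in> l2 lborel"
  shows "(\<lambda>x. u (x + z)) \<in> l2 lborel" "l2_norm lborel (\<lambda>x. u (x + z)) = l2_norm lborel u"
proof -
  have [measurable]: "u \<in> borel_measurable borel" using assms by (auto simp: l2_def)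
  have "integrable lborel (\<lambda>x. (cmod (u (z + 1 *\<^sub>R x)))\<^sup>2)"
    by (rule integrable_lborel_affine[OF l2_integrable_sq[OF assms]]) simp
  then show "(\<lambda>x. u (x + z)) \<in> l2 lborel" by (simp add: l2_def add.commute)
  show "l2_norm lborel (\<lambda>x. u (x + z)) = l2_norm lborel u"
    unfolding l2_norm_def
    by (subst integral_lborel_affine[of "\<lambda>x. (cmod (u x))\<^sup>2" 1 z]) (simp_all add: add.commute)
qed

definition gauss :: "'a::euclidean_space \<Rightarrow> real" where
  "gauss x = exp (- (norm x)\<^sup>2 / 2)"

definition fourier_const :: "'a::euclidean_space itself \<Rightarrow> real" where
  "fourier_const _ = (2 * pi) powr (- real DIM('a) / 2)"

lemma fourier_const_pos: "0 < fourier_const TYPE('a::euclidean_space)"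
  by (simp add: fourier_const_def)

lemma gauss_prod: "gauss x = (\<Prod>b\<in>Basis. exp (- (x \<bullet> b)\<^sup>2 / 2))"
proof -
  have "(norm x)\<^sup>2 = (\<Sum>b\<in>Basis. (x \<bullet> b)\<^sup>2)"
    unfolding power2_norm_eq_inner euclidean_inner[of x x] by (simp add: power2_eq_square)
  then have "- (norm x)\<^sup>2 / 2 = (\<Sum>b\<in>Basis. - (x \<bullet> b)\<^sup>2 / 2)"
    by (simp add: sum_negf flip: sum_divide_distrib)
  then show ?thesis unfolding gauss_def by (simp only: exp_sum[OF finite_Basis])
qed

lemma gauss_props [simp]: "0 < gauss x" "gauss x \<le> 1" "gauss (- x) = gauss x" "gauss 0 = 1"
  by (simp_all add: gauss_def)

lemma borel_measurable_gauss [measurable]: "gauss \<in> borel_measurable borel"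
  unfolding gauss_def by measurable

lemma gauss_eq_prod:
  fixes x :: "'a::euclidean_space"
  shows "fourier_const TYPE('a) * gauss x = (\<Prod>b\<in>Basis. std_normal_density (x \<bullet> b))"
proof -
  have "fourier_const TYPE('a) = (1 / sqrt (2 * pi)) ^ DIM('a)"
    unfolding fourier_const_def
    by (simp add: powr_minus powr_half_sqrt[symmetric] powr_powr powr_realpow[symmetric] power_one_over
        inverse_eq_divide)
  then show ?thesis
    unfolding std_normal_density_def prod.distrib by (simp add: gauss_prod)
qed

lemma std_normal_fourier_real:
  fixes s :: real
  shows "integrable lborel (\<lambda>t. complex_of_real (std_normal_density t) * exp (\<i> * of_real (s * t)))"
    "(\<integral>t. complex_of_real (std_normal_density t) * exp (\<i> * of_real (s * t)) \<partial>lborel) = of_real (exp (- s\<^sup>2 / 2))"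
proof -
  have "integrable lborel (\<lambda>t. std_normal_density t)"
    using integrable_std_normal_moment[of 0] by simp
  then show "integrable lborel (\<lambda>t. complex_of_real (std_normal_density t) * exp (\<i> * of_real (s * t)))"
    by (rule Bochner_Integration.integrable_bound) (auto simp: norm_mult)
  have "char std_normal_distribution s = of_real (exp (- s\<^sup>2 / 2))"
    by (simp add: char_std_normal_distribution)
  then show "(\<integral>t. complex_of_real (std_normal_density t) * exp (\<i> * of_real (s * t)) \<partial>lborel) = of_real (exp (- s\<^sup>2 / 2))"
    unfolding char_def by (subst (asm) integral_density) (auto simp: scaleR_conv_of_real normal_density_nonneg)
qed

text \<open>The Gaussian factorises over the coordinates, so this is Fubini and the known characteristic
  function of the normal distribution.\<close>
lemma gauss_fourier:
  fixes x :: "'a::euclidean_space"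
  shows "integrable lborel (gauss :: 'a \<Rightarrow> real)"
    "(\<integral>\<xi>. of_real (gauss \<xi>) * exp (\<i> * of_real (x \<bullet> \<xi>)) \<partial>lborel) =
      complex_of_real (gauss x / fourier_const TYPE('a))"
proof -
  interpret product_sigma_finite "\<lambda>_::'a. lborel :: real measure" by standard
  let ?c = "fourier_const TYPE('a)"
  have c: "?c > 0" by (rule fourier_const_pos)
  define h where "h x b t = complex_of_real (std_normal_density t) * exp (\<i> * of_real ((x \<bullet> b) * t))"
    for x b :: 'a and t :: real
  have h: "integrable lborel (h x b)" "integral\<^sup>L lborel (h x b) = of_real (exp (- (x \<bullet> b)\<^sup>2 / 2))" for x b
    unfolding h_def by (rule std_normal_fourier_real)+
  have [measurable]: "h x b \<in> borel_measurable borel" for x b unfolding h_def by measurable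
  have prod_h: "(\<Prod>b\<in>Basis. h x b (\<xi> \<bullet> b)) = of_real (?c * gauss \<xi>) * exp (\<i> * of_real (x \<bullet> \<xi>))" for x \<xi> :: 'a
    unfolding h_def gauss_eq_prod of_real_prod
    by (simp add: prod.distrib euclidean_inner[of x \<xi>] sum_distrib_left flip: exp_sum[OF finite_Basis])
  have red: "(\<Prod>b\<in>Basis. h x b ((\<Sum>b\<in>Basis. f b *\<^sub>R b) \<bullet> b)) = (\<Prod>b\<in>Basis. h x b (f b))" for x :: 'a and f
    by (intro prod.cong) simp_all
  have int: "integrable lborel (\<lambda>\<xi>. \<Prod>b\<in>Basis. h x b (\<xi> \<bullet> b))" for x :: 'a
    by (subst lborel_eq, subst integrable_distr_eq, simp, simp)
       (unfold red, intro product_integrable_prod h finite_Basis)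
  have eq: "(\<integral>\<xi>. (\<Prod>b\<in>Basis. h x b (\<xi> \<bullet> b)) \<partial>lborel) = (\<Prod>b\<in>Basis. of_real (exp (- (x \<bullet> b)\<^sup>2 / 2)))"
    by (subst lborel_eq, subst integral_distr, simp, simp)
       (unfold red, subst product_integral_prod, simp_all add: h)
  have g: "(\<Prod>b\<in>Basis. complex_of_real (exp (- (x \<bullet> b)\<^sup>2 / 2))) = of_real (gauss x)"
    unfolding gauss_prod by simp
  have "integrable lborel (\<lambda>\<xi>::'a. norm (of_real (?c * gauss \<xi>) * exp (\<i> * of_real (0 \<bullet> \<xi>))))"
    using int[of 0] unfolding prod_h by (rule integrable_norm)
  then have "integrable lborel (\<lambda>\<xi>::'a. ?c * gauss \<xi>)" 
    using c by (simp add: norm_mult less_imp_le)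
  then show "integrable lborel (gauss :: 'a \<Rightarrow> real)"
    using c by (simp add: integrable_mult_right_iff)
  have "?c * (\<integral>\<xi>. of_real (gauss \<xi>) * exp (\<i> * of_real (x \<bullet> \<xi>)) \<partial>lborel) = complex_of_real (gauss x)"
    using eq unfolding prod_h g by (simp add: mult.assoc)
  then show "(\<integral>\<xi>. of_real (gauss \<xi>) * exp (\<i> * of_real (x \<bullet> \<xi>)) \<partial>lborel) =
      complex_of_real (gauss x / ?c)"
    using c by (simp add: field_simps)
qed

lemma gauss_integral:
  "(\<integral>\<xi>. gauss (\<xi>::'a::euclidean_space) \<partial>lborel) = 1 / fourier_const TYPE('a)"
proof -
  have "complex_of_real (\<integral>\<xi>. gauss (\<xi>::'a) \<partial>lborel) = of_real (1 / fourier_const TYPE('a))"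
    using gauss_fourier(2)[of "0::'a"] by simp
  then show ?thesis by (simp only: of_real_eq_iff)
qed

lemma gauss_fourier_scaled:
  fixes x :: "'a::euclidean_space"
  assumes t: "t > 0"
  shows "integrable lborel (\<lambda>\<xi>::'a. gauss (t *\<^sub>R \<xi>))"
    "(\<integral>\<xi>. of_real (gauss (t *\<^sub>R \<xi>)) * exp (\<i> * of_real (x \<bullet> \<xi>)) \<partial>lborel) =
      complex_of_real (gauss (x /\<^sub>R t) / (t ^ DIM('a) * fourier_const TYPE('a)))"
proof -
  show "integrable lborel (\<lambda>\<xi>::'a. gauss (t *\<^sub>R \<xi>))"
    using integrable_lborel_affine[OF gauss_fourier(1), of t 0] t by simp
  have "(\<integral>\<xi>. of_real (gauss \<xi>) * exp (\<i> * of_real ((x /\<^sub>R t) \<bullet> \<xi>)) \<partial>lborel) =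
    t ^ DIM('a) * (\<integral>\<xi>. of_real (gauss (t *\<^sub>R \<xi>)) * exp (\<i> * of_real (x \<bullet> \<xi>)) \<partial>lborel)"
    using t by (subst integral_lborel_affine[of _ t 0]) (use t in \<open>simp_all add: scaleR_conv_of_real mult.assoc[symmetric]\<close>)
  then show "(\<integral>\<xi>. of_real (gauss (t *\<^sub>R \<xi>)) * exp (\<i> * of_real (x \<bullet> \<xi>)) \<partial>lborel) =
      complex_of_real (gauss (x /\<^sub>R t) / (t ^ DIM('a) * fourier_const TYPE('a)))"
    unfolding gauss_fourier(2) using t fourier_const_pos[where 'a='a] by (simp add: field_simps)
qed

section \<open>Continuity of translations\<close>

definition truncate :: "('a::real_normed_vector \<Rightarrow> complex) \<Rightarrow> nat \<Rightarrow> 'a \<Rightarrow> complex" where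
  "truncate u k x = (if norm x \<le> real k then u x else 0)"

lemma l2_dominated_convergence:
  assumes [measurable]: "\<And>k. v k \<in> borel_measurable M" "u \<in> borel_measurable M"
    and w: "integrable M w" and lim: "AE x in M. (\<lambda>k. v k x) \<longlonglongrightarrow> u x"
    and bound: "\<And>k. AE x in M. (cmod (v k x - u x))\<^sup>2 \<le> w x"
  shows "(\<lambda>k. l2_norm M (\<lambda>x. v k x - u x)) \<longlonglongrightarrow> 0"
proof -
  have "(\<lambda>k. \<integral>x. (cmod (v k x - u x))\<^sup>2 \<partial>M) \<longlonglongrightarrow> (\<integral>x. 0 \<partial>M)"
  proof (rule integral_dominated_convergence[OF _ _ w])
    show "AE x in M. (\<lambda>k. (cmod (v k x - u x))\<^sup>2) \<longlonglongrightarrow> 0"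
      using lim
    proof eventually_elim
      case (elim x)
      have "(\<lambda>k. (cmod (v k x - u x))\<^sup>2) \<longlonglongrightarrow> (cmod (u x - u x))\<^sup>2"
        by (intro tendsto_intros elim)
      then show ?case by simp
    qed
  qed (use bound in auto)
  then have "(\<lambda>k. sqrt (\<integral>x. (cmod (v k x - u x))\<^sup>2 \<partial>M)) \<longlonglongrightarrow> sqrt (\<integral>x. 0 \<partial>M)"
    by (rule tendsto_real_sqrt)
  then show ?thesis by (simp add: l2_norm_def)
qed

lemma truncate_l2:
  fixes u :: "'a::euclidean_space \<Rightarrow> complex"
  assumes u: "u \<in> l2 lborel"
  shows "truncate u k \<in> l2 lborel" "integrable lborel (truncate u k)"
    "(\<lambda>k. l2_norm lborel (\<lambda>x. truncate u k x - u x)) \<longlonglongrightarrow> 0"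
proof -
  have [measurable]: "u \<in> borel_measurable borel" using u by (auto simp: l2_def)
  have m[measurable]: "truncate u k \<in> borel_measurable borel" for k
    unfolding truncate_def by measurable
  show *: "truncate u k \<in> l2 lborel" for k
    using l2_integrable_sq[OF u]
    by (auto simp: l2_def truncate_def intro!: Bochner_Integration.integrable_bound[OF l2_integrable_sq[OF u]])
  have fin: "integrable lborel (indicator (cball 0 (real k)) :: 'a \<Rightarrow> real)"
    using emeasure_lborel_cball_finite[of "0::'a" "real k"] by (intro integrable_real_indicator) (auto simp: less_top)
  show "integrable lborel (truncate u k)"
  proof (rule Bochner_Integration.integrable_bound)
    show "integrable lborel (\<lambda>x. (cmod (u x))\<^sup>2 + indicator (cball 0 (real k)) x)"
      by (intro Bochner_Integration.integrable_add l2_integrable_sq u fin)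
    have "r \<le> r\<^sup>2 + 1" for r :: real using sum_squares_bound[of r 1] by (simp) (smt (verit) zero_le_power2)
    then show "AE x in lborel. norm (truncate u k x) \<le> norm ((cmod (u x))\<^sup>2 + indicator (cball 0 (real k)) x :: real)"
      by (auto simp: truncate_def)
  qed simp
  show "(\<lambda>k. l2_norm lborel (\<lambda>x. truncate u k x - u x)) \<longlonglongrightarrow> 0"
  proof (rule l2_dominated_convergence[OF _ _ l2_integrable_sq[OF u]])
    show "AE x in lborel. (\<lambda>k. truncate u k x) \<longlonglongrightarrow> u x"
    proof (rule AE_I2, rule tendsto_eventually)
      fix x :: 'a
      obtain K where "norm x \<le> real K" using real_arch_simple by blast
      then show "\<forall>\<^sub>F k in sequentially. truncate u k x = u x"
        by (intro eventually_sequentiallyI[of K]) (auto simp: truncate_def)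
    qed
  qed (auto simp: truncate_def)
qed

text \<open>A measurable function is an almost everywhere limit of continuous functions; cutting these
  off in range and domain makes dominated convergence applicable.\<close>
lemma l2_approx_continuous_compact:
  fixes u :: "'a::euclidean_space \<Rightarrow> complex"
  assumes u: "u \<in> l2 lborel" and e: "e > 0"
  obtains v R B where "continuous_on UNIV v" "\<And>x. norm x > R \<Longrightarrow> v x = 0" "\<And>x. cmod (v x) \<le> B"
    "v \<in> l2 lborel" "l2_norm lborel (\<lambda>x. v x - u x) < e"
proof -
  have [measurable]: "u \<in> borel_measurable borel" using u by (auto simp: l2_def)
  define w where "w k x = (if norm x \<le> real k \<and> cmod (u x) \<le> real k then u x else 0)" for k x
  have [measurable]: "w k \<in> borel_measurable borel" for k unfolding w_def by measurable
  have "(\<lambda>k. l2_norm lborel (\<lambda>x. w k x - u x)) \<longlonglongrightarrow> 0"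
  proof (rule l2_dominated_convergence[OF _ _ l2_integrable_sq[OF u]])
    show "AE x in lborel. (\<lambda>k. w k x) \<longlonglongrightarrow> u x"
    proof (rule AE_I2, rule tendsto_eventually)
      fix x :: 'a
      obtain K where "max (norm x) (cmod (u x)) \<le> real K" using real_arch_simple by blast
      then show "\<forall>\<^sub>F k in sequentially. w k x = u x"
        by (intro eventually_sequentiallyI[of K]) (auto simp: w_def)
    qed
  qed (auto simp: w_def)
  then have "\<forall>\<^sub>F k in sequentially. l2_norm lborel (\<lambda>x. w k x - u x) < e / 2"
    using e by (intro order_tendstoD(2)[where a="e/2"]) auto
  then obtain k where k: "l2_norm lborel (\<lambda>x. w k x - u x) < e / 2" by (auto simp: eventually_sequentially)
  define c where "c = real k + 1"
  have c: "c > 0" by (simp add: c_def)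
  have w_l2: "w k \<in> l2 lborel"
    by (auto simp: l2_def w_def intro!: Bochner_Integration.integrable_bound[OF l2_integrable_sq[OF u]])
  have "w k \<in> borel_measurable lebesgue" by (rule measurable_completion) simp
  then have "w k measurable_on UNIV" by (intro lebesgue_measurable_imp_measurable_on) auto
  then obtain N g where N: "negligible N" and g: "\<And>n. continuous_on UNIV (g n)"
    and lim: "\<And>x. x \<notin> N \<Longrightarrow> (\<lambda>n. g n x) \<longlonglongrightarrow> w k x"
    unfolding measurable_on_def by auto
  define cut where "cut x = max 0 (min 1 (c - norm x))" for x :: 'a
  define clamp :: "complex \<Rightarrow> complex" where "clamp = closest_point (cball 0 c)"
  define v where "v n x = of_real (cut x) * clamp (g n x)" for n x
  have clamp: "cmod (clamp z) \<le> c" for z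
    using closest_point_in_set[of "cball 0 c" z] c by (auto simp: clamp_def)
  have clamp_cont: "continuous_on A clamp" for A
    unfolding clamp_def using c by (intro continuous_on_closest_point) auto
  have cut: "0 \<le> cut x" "cut x \<le> 1" "norm x > c \<Longrightarrow> cut x = 0" "norm x \<le> real k \<Longrightarrow> cut x = 1" for x
    by (auto simp: cut_def c_def)
  have v_cont: "continuous_on UNIV (v n)" for n
    unfolding v_def cut_def
    by (intro continuous_intros continuous_on_compose2[OF clamp_cont[of UNIV] g]) auto
  then have [measurable]: "v n \<in> borel_measurable borel" for n
    by (rule borel_measurable_continuous_onI)
  have v_bound: "cmod (v n x) \<le> c * indicator (cball 0 c) x" for n x
    using mult_mono[OF cut(2)[of x] clamp[of "g n x"]] cut[of x] c
    by (auto simp: v_def norm_mult indicator_def)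
  have w_clamp: "w k x = of_real (cut x) * clamp (w k x)" for x
  proof -
    have "w k x \<in> cball 0 c" by (auto simp: w_def c_def)
    then have "clamp (w k x) = w k x" by (simp add: clamp_def closest_point_self)
    moreover have "norm x \<le> real k \<or> w k x = 0" by (auto simp: w_def)
    ultimately show ?thesis using cut(4)[of x] by auto
  qed
  have w_bound: "cmod (w k x) \<le> c * indicator (cball 0 c) x" for x
    by (auto simp: w_def c_def indicator_def)
  have ind: "integrable lborel (\<lambda>x::'a. r * indicator (cball 0 c) x :: real)" for r and c :: real
    using emeasure_lborel_cball_finite[of "0::'a" c] 
    by (intro integrable_mult_right integrable_real_indicator) (auto simp: less_top)
  have v_l2: "v n \<in> l2 lborel" for n
  proof -
    have "(cmod (v n x))\<^sup>2 \<le> c\<^sup>2 * indicator (cball 0 c) x" for x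
      using power_mono[OF v_bound[of n x], of 2] by (auto simp: indicator_def)
    then have "integrable lborel (\<lambda>x. (cmod (v n x))\<^sup>2)"
      by (intro Bochner_Integration.integrable_bound[OF ind[of "c\<^sup>2" c]]) auto
    then show ?thesis by (simp add: l2_def)
  qed
  obtain N' where N': "N' \<in> null_sets lborel" "N \<subseteq> N'"
    using N by (auto simp: negligible_iff_null_sets null_sets_completion_iff2)
  have "(\<lambda>n. l2_norm lborel (\<lambda>x. v n x - w k x)) \<longlonglongrightarrow> 0"
  proof (rule l2_dominated_convergence)
    show "integrable lborel (\<lambda>x::'a. (2 * c)\<^sup>2 * indicator (cball 0 c) x :: real)" by (rule ind)
    show "AE x in lborel. (\<lambda>n. v n x) \<longlonglongrightarrow> w k x"
    proof (rule AE_I'[OF N'(1)], rule subset_trans[OF _ N'(2)], rule subsetI, rule ccontr)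
      fix x assume x: "x \<in> {x \<in> space lborel. \<not> (\<lambda>n. v n x) \<longlonglongrightarrow> w k x}" "x \<notin> N"
      have "(\<lambda>n. clamp (g n x)) \<longlonglongrightarrow> clamp (w k x)"
        by (rule continuous_on_tendsto_compose[OF clamp_cont[of UNIV] lim[OF x(2)]]) auto
      then have "(\<lambda>n. v n x) \<longlonglongrightarrow> of_real (cut x) * clamp (w k x)"
        unfolding v_def by (intro tendsto_intros)
      then show False using x(1) w_clamp[of x] by simp
    qed
    show "AE x in lborel. (cmod (v n x - w k x))\<^sup>2 \<le> (2 * c)\<^sup>2 * indicator (cball 0 c) x" for n
    proof (rule AE_I2)
      fix x
      have "cmod (v n x - w k x) \<le> cmod (v n x) + cmod (w k x)" by (rule norm_triangle_ineq4)
      also have "\<dots> \<le> 2 * c * indicator (cball 0 c) x" using v_bound[of n x] w_bound[of x] by simp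
      finally have "(cmod (v n x - w k x))\<^sup>2 \<le> (2 * c * indicator (cball 0 c) x)\<^sup>2"
        by (intro power_mono) auto
      then show "(cmod (v n x - w k x))\<^sup>2 \<le> (2 * c)\<^sup>2 * indicator (cball 0 c) x"
        by (auto simp: indicator_def)
    qed
  qed simp_all
  then have "\<forall>\<^sub>F n in sequentially. l2_norm lborel (\<lambda>x. v n x - w k x) < e / 2"
    using e by (intro order_tendstoD(2)[where a="e/2"]) auto
  then obtain n where n: "l2_norm lborel (\<lambda>x. v n x - w k x) < e / 2" by (auto simp: eventually_sequentially)
  have "l2_norm lborel (\<lambda>x. v n x - u x) < e"
    using l2_norm_triangle_diff[OF v_l2[of n] w_l2 u] n k by simp
  moreover have "v n x = 0" if "norm x > c" for x using v_bound[of n x] that by simp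
  moreover have "cmod (v n x) \<le> c" for x using v_bound[of n x] c
    by (cases "norm x \<le> c") auto
  ultimately show ?thesis using that v_cont v_l2 by blast
qed

text \<open>Clear for continuous functions of compact support; the general case follows by approximation,
  since translations are isometries.\<close>
lemma l2_translation_continuous:
  fixes u :: "'a::euclidean_space \<Rightarrow> complex"
  assumes u: "u \<in> l2 lborel" and h: "h \<longlonglongrightarrow> 0"
  shows "(\<lambda>k. l2_norm lborel (\<lambda>x. u (x + h k) - u x)) \<longlonglongrightarrow> 0"
proof (rule LIMSEQ_I)
  fix e :: real assume e: "e > 0"
  obtain v R B where v: "continuous_on UNIV v" "\<And>x. norm x > R \<Longrightarrow> v x = 0" "\<And>x. cmod (v x) \<le> B"
    "v \<in> l2 lborel" "l2_norm lborel (\<lambda>x. v x - u x) < e / 3"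
    using l2_approx_continuous_compact[OF u, of "e/3"] e by auto
  have [measurable]: "v \<in> borel_measurable borel" by (rule borel_measurable_continuous_onI) (rule v)
  obtain H where H: "\<And>k. norm (h k) \<le> H"
    using convergent_imp_Bseq[of h] h by (auto simp: convergent_def Bseq_def)
  have "(\<lambda>k. l2_norm lborel (\<lambda>x. v (x + h k) - v x)) \<longlonglongrightarrow> 0"
  proof (rule l2_dominated_convergence)
    show "integrable lborel (\<lambda>x::'a. (2 * B)\<^sup>2 * indicator (cball 0 (R + H)) x :: real)"
      using emeasure_lborel_cball_finite[of "0::'a" "R + H"] 
      by (intro integrable_mult_right integrable_real_indicator) (auto simp: less_top)
    show "AE x in lborel. (\<lambda>k. v (x + h k)) \<longlonglongrightarrow> v x"
    proof (rule AE_I2)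
      fix x
      have "(\<lambda>k. x + h k) \<longlonglongrightarrow> x + 0" by (intro tendsto_intros h)
      then show "(\<lambda>k. v (x + h k)) \<longlonglongrightarrow> v x"
        using continuous_on_tendsto_compose[OF v(1), of "\<lambda>k. x + h k" x sequentially] by simp
    qed
    show "AE x in lborel. (cmod (v (x + h k) - v x))\<^sup>2 \<le> (2 * B)\<^sup>2 * indicator (cball 0 (R + H)) x" for k
    proof (rule AE_I2)
      fix x
      show "(cmod (v (x + h k) - v x))\<^sup>2 \<le> (2 * B)\<^sup>2 * indicator (cball 0 (R + H)) x"
      proof (cases "norm x \<le> R + H")
        case True
        have "cmod (v (x + h k) - v x) \<le> cmod (v (x + h k)) + cmod (v x)" by (rule norm_triangle_ineq4)
        also have "\<dots> \<le> 2 * B" using v(3)[of x] v(3)[of "x + h k"] by simp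
        finally have "(cmod (v (x + h k) - v x))\<^sup>2 \<le> (2 * B)\<^sup>2" by (rule power_mono) simp
        then show ?thesis using True by simp
      next
        case False
        have "norm x \<le> norm (x + h k) + H"
          using norm_triangle_sub[of x "x + h k"] H[of k] by simp
        then have "norm (x + h k) > R" using False by simp
        moreover have "norm x > R" using False H[of k] norm_ge_zero[of "h k"] by linarith
        ultimately show ?thesis using v(2) by simp
      qed
    qed
  qed simp_all
  then obtain K where K: "\<And>k. k \<ge> K \<Longrightarrow> l2_norm lborel (\<lambda>x. v (x + h k) - v x) < e / 3"
    using LIMSEQ_D[of _ 0 "e/3"] e by fastforce
  have "l2_norm lborel (\<lambda>x. u (x + h k) - u x) < e" if "k \<ge> K" for k
  proof -
    note t = l2_translate(1)[of _ "h k"]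
    have "l2_norm lborel (\<lambda>x. u (x + h k) - v (x + h k)) = l2_norm lborel (\<lambda>x. u x - v x)"
      by (rule l2_translate(2)[OF l2_diff[OF u v(4)]])
    then show ?thesis
      using l2_norm_triangle_diff[OF t[OF u] t[OF v(4)] u] l2_norm_triangle_diff[OF t[OF v(4)] v(4) u]
        v(5) K[OF that] l2_norm_minus_commute[of lborel u v] by linarith
  qed
  then show "\<exists>K. \<forall>k\<ge>K. norm (l2_norm lborel (\<lambda>x. u (x + h k) - u x) - 0) < e" by auto
qed

section \<open>Plancherel's theorem\<close>

lemma integrable_lborel_prod:
  fixes f :: "'a::euclidean_space \<Rightarrow> 'c::{real_normed_field,banach,second_countable_topology}"
    and g :: "'b::euclidean_space \<Rightarrow> 'c"
  assumes f: "integrable lborel f" and g: "integrable lborel g"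
  shows "integrable (lborel \<Otimes>\<^sub>M lborel) (\<lambda>(x, y). f x * g y)"
proof -
  have [measurable]: "f \<in> borel_measurable borel" "g \<in> borel_measurable borel"
    using f g by (auto dest: borel_measurable_integrable)
  show ?thesis
    by (rule lborel_pair.Fubini_integrable) (use f g in \<open>auto simp: norm_mult\<close>)
qed

lemma l2_inner_diff_right:
  assumes "u \<in> l2 M" "v \<in> l2 M" "w \<in> l2 M"
  shows "l2_inner M u (\<lambda>x. v x - w x) = l2_inner M u v - l2_inner M u w"
  unfolding l2_inner_def using integrable_l2_prod(2)[OF assms(1,2)] integrable_l2_prod(2)[OF assms(1,3)]
  by (simp add: right_diff_distrib)

lemma l2_inner_self: "l2_inner M u u = of_real ((l2_norm M u)\<^sup>2)"
  unfolding l2_inner_def l2_norm_sq complex_norm_square[symmetric] of_real_power[symmetric]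
  by (rule integral_complex_of_real)

lemma fourier_L1_measurable [measurable]:
  assumes "integrable lborel (u :: 'a::euclidean_space \<Rightarrow> complex)"
  shows "fourier_L1 u \<in> borel_measurable borel"
proof -
  have [measurable]: "u \<in> borel_measurable borel" using assms by (auto dest: borel_measurable_integrable)
  show ?thesis unfolding fourier_L1_def by measurable
qed

lemma fourier_L1_altdef:
  fixes u :: "'a::euclidean_space \<Rightarrow> complex"
  shows "fourier_L1 u \<xi> = of_real (fourier_const TYPE('a)) *
     (\<integral>x. exp (- \<i> * of_real (x \<bullet> \<xi>)) * u x \<partial>lborel)"
  by (simp add: fourier_L1_def fourier_const_def)

lemma integrable_phase:
  fixes u :: "'a::euclidean_space \<Rightarrow> complex"
  assumes "integrable lborel u"
  shows "integrable lborel (\<lambda>x. exp (- \<i> * of_real (x \<bullet> \<xi>)) * u x)"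
proof -
  have [measurable]: "u \<in> borel_measurable borel" using assms by (auto dest: borel_measurable_integrable)
  show ?thesis
    by (rule Bochner_Integration.integrable_bound[OF assms]) (auto simp: norm_mult)
qed

lemma fourier_L1_bound:
  fixes u :: "'a::euclidean_space \<Rightarrow> complex"
  assumes "integrable lborel u"
  shows "cmod (fourier_L1 u \<xi>) \<le> fourier_const TYPE('a) * L1_norm u"
proof -
  have "cmod (\<integral>x. exp (- \<i> * of_real (x \<bullet> \<xi>)) * u x \<partial>lborel) \<le> L1_norm u"
    using integral_norm_bound[of lborel "\<lambda>x. exp (- \<i> * of_real (x \<bullet> \<xi>)) * u x"] by (simp add: norm_mult)
  then show ?thesis
    using fourier_const_pos[where 'a='a] by (simp add: fourier_L1_altdef norm_mult)
qed

text \<open>Fubini and the transform of the Gaussian turn the damped energy on the Fourier side into a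
  Gaussian average of the autocorrelation of \<open>u\<close>.\<close>
lemma gauss_damped_energy:
  fixes u :: "'a::euclidean_space \<Rightarrow> complex"
  assumes u1: "integrable lborel u" and u2: "u \<in> l2 lborel" and t: "t > 0"
  shows "(\<integral>\<xi>. of_real (gauss (t *\<^sub>R \<xi>)) * (fourier_L1 u \<xi> * cnj (fourier_L1 u \<xi>)) \<partial>lborel) =
    of_real (fourier_const TYPE('a)) *
      (\<integral>z. of_real (gauss z) * l2_inner lborel u (\<lambda>x. u (x + (- t) *\<^sub>R z)) \<partial>lborel)"
proof -
  let ?c = "fourier_const TYPE('a)"
  have c: "?c > 0" by (rule fourier_const_pos)
  have [measurable]: "u \<in> borel_measurable borel" using u1 by (auto dest: borel_measurable_integrable)
  define G where "G \<xi> = complex_of_real (gauss (t *\<^sub>R \<xi>))" for \<xi> :: 'a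
  have [measurable]: "G \<in> borel_measurable borel" unfolding G_def by measurable
  have G: "integrable lborel G"
    using gauss_fourier_scaled(1)[OF t, where 'a='a] unfolding G_def by (rule integrable_of_real)
  define e where "e x \<xi> = exp (- \<i> * of_real (x \<bullet> \<xi>)) * u x" for x \<xi> :: 'a
  have [measurable]: "(\<lambda>(x, \<xi>). e x \<xi>) \<in> borel_measurable (borel \<Otimes>\<^sub>M borel)"
    unfolding e_def by measurable
  have e_int: "integrable lborel (\<lambda>x. e x \<xi>)" for \<xi>
    unfolding e_def by (rule integrable_phase[OF u1])
  have e_norm: "cmod (e x \<xi>) = cmod (u x)" for x \<xi> by (simp add: e_def norm_mult)
  define I where "I \<xi> = (\<integral>x. e x \<xi> \<partial>lborel)" for \<xi>
  have [measurable]: "I \<in> borel_measurable borel" unfolding I_def by measurable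
  have I_bound: "cmod (I \<xi>) \<le> L1_norm u" for \<xi>
    unfolding I_def using integral_norm_bound[of lborel "\<lambda>x. e x \<xi>"] by (simp add: e_norm)
  have swap1: "(\<integral>\<xi>. \<integral>x. G \<xi> * e x \<xi> * cnj (I \<xi>) \<partial>lborel \<partial>lborel) =
      (\<integral>x. \<integral>\<xi>. G \<xi> * e x \<xi> * cnj (I \<xi>) \<partial>lborel \<partial>lborel)"
  proof (rule lborel_pair.Fubini_integral, rule Bochner_Integration.integrable_bound)
    show "integrable (lborel \<Otimes>\<^sub>M lborel) (\<lambda>(x, \<xi>). u x * (G \<xi> * of_real (L1_norm u)))"
      by (rule integrable_lborel_prod) (use u1 G in auto)
    have "norm (G \<xi> * e x \<xi> * cnj (I \<xi>)) \<le> norm (u x * (G \<xi> * of_real (L1_norm u)))" for x \<xi>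
    proof -
      have "norm (G \<xi> * e x \<xi> * cnj (I \<xi>)) = cmod (u x) * cmod (G \<xi>) * cmod (I \<xi>)"
        by (simp add: norm_mult e_norm)
      also have "\<dots> \<le> cmod (u x) * cmod (G \<xi>) * L1_norm u"
        by (intro mult_left_mono I_bound) auto
      finally show ?thesis by (simp add: norm_mult)
    qed
    then show "AE p in lborel \<Otimes>\<^sub>M lborel. norm (case p of (x, \<xi>) \<Rightarrow> G \<xi> * e x \<xi> * cnj (I \<xi>)) \<le>
       norm (case p of (x, \<xi>) \<Rightarrow> u x * (G \<xi> * of_real (L1_norm u)))"
      by (intro AE_I2) auto
  qed measurable
  have swap2: "(\<integral>\<xi>. \<integral>y. G \<xi> * e x \<xi> * cnj (e y \<xi>) \<partial>lborel \<partial>lborel) =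
      (\<integral>y. \<integral>\<xi>. G \<xi> * e x \<xi> * cnj (e y \<xi>) \<partial>lborel \<partial>lborel)" for x
  proof (rule lborel_pair.Fubini_integral, rule Bochner_Integration.integrable_bound)
    show "integrable (lborel \<Otimes>\<^sub>M lborel) (\<lambda>(y, \<xi>). u y * (G \<xi> * u x))"
      by (rule integrable_lborel_prod) (use u1 G in auto)
    show "AE p in lborel \<Otimes>\<^sub>M lborel. norm (case p of (y, \<xi>) \<Rightarrow> G \<xi> * e x \<xi> * cnj (e y \<xi>)) \<le>
       norm (case p of (y, \<xi>) \<Rightarrow> u y * (G \<xi> * u x))"
      by (auto simp: norm_mult e_norm intro!: AE_I2)
  qed measurable
  have inner: "(\<integral>\<xi>. G \<xi> * e x \<xi> * cnj (e y \<xi>) \<partial>lborel) =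
      u x * cnj (u y) * of_real (gauss ((y - x) /\<^sub>R t) / (t ^ DIM('a) * ?c))" for x y
  proof -
    have "exp (- \<i> * of_real (x \<bullet> \<xi>)) * cnj (exp (- \<i> * of_real (y \<bullet> \<xi>))) =
        exp (\<i> * of_real ((y - x) \<bullet> \<xi>))" for \<xi>
      by (simp add: exp_cnj inner_diff_left algebra_simps flip: exp_add)
    then have "G \<xi> * e x \<xi> * cnj (e y \<xi>) =
        (u x * cnj (u y)) * (of_real (gauss (t *\<^sub>R \<xi>)) * exp (\<i> * of_real ((y - x) \<bullet> \<xi>)))" for \<xi>
      by (simp add: G_def e_def mult_ac del: of_real_diff)
    then show ?thesis
      by (simp only: integral_mult_right_zero gauss_fourier_scaled(2)[OF t])
  qed
  have subst: "(\<integral>y. u x * cnj (u y) * of_real (gauss ((y - x) /\<^sub>R t) / (t ^ DIM('a) * ?c)) \<partial>lborel) =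
      (\<integral>z. of_real (gauss z) * (u x * cnj (u (x + (- t) *\<^sub>R z))) \<partial>lborel) / ?c" for x
    using t c
    by (subst integral_lborel_affine[of _ "- t" x])
       (simp_all add: scaleR_conv_of_real field_simps integral_mult_right_zero)
  have swap3: "(\<integral>x. \<integral>z. of_real (gauss z) * (u x * cnj (u (x + (- t) *\<^sub>R z))) \<partial>lborel \<partial>lborel) =
      (\<integral>z. \<integral>x. of_real (gauss z) * (u x * cnj (u (x + (- t) *\<^sub>R z))) \<partial>lborel \<partial>lborel)"
  proof (rule lborel_pair.Fubini_integral, rule lborel_pair.Fubini_integrable)
    have n: "norm (of_real (gauss z) * (u x * cnj (u (x + (- t) *\<^sub>R z)))) =
        gauss z * (cmod (u x) * cmod (u (x + (- t) *\<^sub>R z)))" for x z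
      by (simp add: norm_mult less_imp_le)
    show "integrable lborel (\<lambda>z. \<integral>x. norm (case (z, x) of (z, x) \<Rightarrow>
        of_real (gauss z) * (u x * cnj (u (x + (- t) *\<^sub>R z)))) \<partial>lborel)"
    proof (rule Bochner_Integration.integrable_bound)
      show "integrable lborel (\<lambda>z::'a. gauss z * (l2_norm lborel u)\<^sup>2)"
        by (intro integrable_mult_left gauss_fourier(1))
      have "gauss z * (\<integral>x. cmod (u x) * cmod (u (x + (- t) *\<^sub>R z)) \<partial>lborel) \<le> gauss z * (l2_norm lborel u)\<^sup>2" for z
        using l2_Cauchy_Schwarz_abs[OF u2 l2_translate(1)[OF u2, of "(- t) *\<^sub>R z"]]
          l2_translate(2)[OF u2, of "(- t) *\<^sub>R z"]
        by (intro mult_left_mono) (auto simp: power2_eq_square less_imp_le)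
      then show "AE z in lborel. norm (\<integral>x. norm (case (z, x) of (z, x) \<Rightarrow>
          of_real (gauss z) * (u x * cnj (u (x + (- t) *\<^sub>R z)))) \<partial>lborel) \<le> norm (gauss z * (l2_norm lborel u)\<^sup>2)"
        unfolding prod.case n by (intro AE_I2) (simp add: less_imp_le integral_nonneg_AE)
    qed measurable
    show "AE z in lborel. integrable lborel (\<lambda>x. case (z, x) of (z, x) \<Rightarrow>
        of_real (gauss z) * (u x * cnj (u (x + (- t) *\<^sub>R z))))"
      using integrable_l2_prod(2)[OF u2 l2_translate(1)[OF u2]] by (intro AE_I2) (simp del: scaleR_minus_left)
  qed measurable
  have "(\<integral>\<xi>. G \<xi> * (fourier_L1 u \<xi> * cnj (fourier_L1 u \<xi>)) \<partial>lborel) =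
      (\<integral>\<xi>. (of_real ?c)\<^sup>2 * (\<integral>x. G \<xi> * e x \<xi> * cnj (I \<xi>) \<partial>lborel) \<partial>lborel)"
  proof -
    have 1: "fourier_L1 u \<xi> = of_real ?c * I \<xi>" for \<xi>
      by (simp add: fourier_L1_altdef e_def I_def)
    have 2: "(\<integral>x. G \<xi> * e x \<xi> * cnj (I \<xi>) \<partial>lborel) = G \<xi> * I \<xi> * cnj (I \<xi>)" for \<xi>
      by (simp add: I_def)
    show ?thesis unfolding 1 2 by (simp add: power2_eq_square mult_ac)
  qed
  also have "\<dots> = (of_real ?c)\<^sup>2 * (\<integral>\<xi>. (\<integral>x. G \<xi> * e x \<xi> * cnj (I \<xi>) \<partial>lborel) \<partial>lborel)"
    by (rule integral_mult_right_zero)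
  also have "(\<integral>\<xi>. (\<integral>x. G \<xi> * e x \<xi> * cnj (I \<xi>) \<partial>lborel) \<partial>lborel) =
      (\<integral>x. \<integral>\<xi>. (\<integral>y. G \<xi> * e x \<xi> * cnj (e y \<xi>) \<partial>lborel) \<partial>lborel \<partial>lborel)"
    unfolding swap1 unfolding I_def by simp
  also have "\<dots> = (\<integral>x. (\<integral>z. of_real (gauss z) * (u x * cnj (u (x + (- t) *\<^sub>R z))) \<partial>lborel) / ?c \<partial>lborel)"
    unfolding swap2 inner subst ..
  also have "\<dots> = (\<integral>z. \<integral>x. of_real (gauss z) * (u x * cnj (u (x + (- t) *\<^sub>R z))) \<partial>lborel \<partial>lborel) / ?c"
    unfolding integral_divide_zero swap3 ..
  also have "\<dots> = (\<integral>z. of_real (gauss z) * l2_inner lborel u (\<lambda>x. u (x + (- t) *\<^sub>R z)) \<partial>lborel) / ?c"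
    by (simp add: l2_inner_def)
  finally show ?thesis using c unfolding G_def by (simp add: power2_eq_square)
qed

text \<open>Letting the damping tend to zero: monotone convergence on the Fourier side, continuity of
  translations on the other side.\<close>
lemma plancherel_L1:
  fixes u :: "'a::euclidean_space \<Rightarrow> complex"
  assumes u1: "integrable lborel u" and u2: "u \<in> l2 lborel"
  shows "fourier_L1 u \<in> l2 lborel" "l2_norm lborel (fourier_L1 u) = l2_norm lborel u"
proof -
  let ?c = "fourier_const TYPE('a)"
  have c: "?c > 0" by (rule fourier_const_pos)
  note [measurable] = fourier_L1_measurable[OF u1]
  have [measurable]: "u \<in> borel_measurable borel" using u1 by (auto dest: borel_measurable_integrable)
  define t where "t k = 1 / real (Suc k)" for k
  have t: "t k > 0" for k by (simp add: t_def)
  have t0: "t \<longlonglongrightarrow> 0" unfolding t_def by (rule LIMSEQ_Suc) (rule lim_1_over_n)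
  define R where "R k z = l2_inner lborel u (\<lambda>x. u (x + (- t k) *\<^sub>R z))" for k z
  have [measurable]: "R k \<in> borel_measurable borel" for k
    unfolding R_def l2_inner_def by measurable
  have R_lim: "(\<lambda>k. R k z) \<longlonglongrightarrow> of_real ((l2_norm lborel u)\<^sup>2)" for z
  proof -
    have "(\<lambda>k. R k z - of_real ((l2_norm lborel u)\<^sup>2)) \<longlonglongrightarrow> 0"
    proof (rule Lim_null_comparison)
      have "(\<lambda>k. (- t k) *\<^sub>R z) \<longlonglongrightarrow> (- 0) *\<^sub>R z" by (intro tendsto_intros t0)
      then have "(\<lambda>k. l2_norm lborel (\<lambda>x. u (x + (- t k) *\<^sub>R z) - u x)) \<longlonglongrightarrow> 0"
        by (intro l2_translation_continuous[OF u2]) simp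
      then show "(\<lambda>k. l2_norm lborel u * l2_norm lborel (\<lambda>x. u (x + (- t k) *\<^sub>R z) - u x)) \<longlonglongrightarrow> 0"
        using tendsto_mult_right_zero by blast
      show "\<forall>\<^sub>F k in sequentially. norm (R k z - of_real ((l2_norm lborel u)\<^sup>2)) \<le>
          l2_norm lborel u * l2_norm lborel (\<lambda>x. u (x + (- t k) *\<^sub>R z) - u x)"
        unfolding R_def l2_inner_self[symmetric]
          l2_inner_diff_right[OF u2 l2_translate(1)[OF u2] u2, symmetric]
        by (intro always_eventually allI l2_Cauchy_Schwarz l2_diff l2_translate u2)
    qed
    then show ?thesis by (simp add: LIM_zero_iff)
  qed
  have "(\<lambda>k. \<integral>z. of_real (gauss z) * R k z \<partial>lborel) \<longlonglongrightarrow>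
      (\<integral>z. of_real (gauss (z::'a)) * of_real ((l2_norm lborel u)\<^sup>2) \<partial>lborel)"
  proof (rule integral_dominated_convergence)
    show "integrable lborel (\<lambda>z::'a. gauss z * (l2_norm lborel u)\<^sup>2)"
      by (intro integrable_mult_left gauss_fourier(1))
    show "AE z in lborel. (\<lambda>k. of_real (gauss z) * R k z) \<longlonglongrightarrow> of_real (gauss z) * of_real ((l2_norm lborel u)\<^sup>2)"
      by (intro AE_I2 tendsto_intros R_lim)
    have "cmod (R k z) \<le> (l2_norm lborel u)\<^sup>2" for k z
      unfolding R_def using l2_Cauchy_Schwarz[OF u2 l2_translate(1)[OF u2]] 
      by (simp add: l2_translate(2)[OF u2] power2_eq_square del: scaleR_minus_left)
    then show "AE z in lborel. norm (of_real (gauss z) * R k z) \<le> gauss z * (l2_norm lborel u)\<^sup>2" for k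
      by (intro AE_I2) (simp add: norm_mult less_imp_le mult_left_mono)
  qed measurable
  then have "(\<lambda>k. of_real ?c * (\<integral>z. of_real (gauss z) * R k z \<partial>lborel)) \<longlonglongrightarrow>
      of_real ?c * (\<integral>z. complex_of_real (gauss (z::'a)) * of_real ((l2_norm lborel u)\<^sup>2) \<partial>lborel)"
    by (intro tendsto_intros)
  also have "of_real ?c * (\<integral>z. complex_of_real (gauss (z::'a)) * of_real ((l2_norm lborel u)\<^sup>2) \<partial>lborel) =
      of_real ((l2_norm lborel u)\<^sup>2)"
    using c by (simp add: gauss_integral)
  finally have lim: "(\<lambda>k. \<integral>\<xi>. complex_of_real (gauss (t k *\<^sub>R \<xi>)) * (fourier_L1 u \<xi> * cnj (fourier_L1 u \<xi>)) \<partial>lborel)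
      \<longlonglongrightarrow> of_real ((l2_norm lborel u)\<^sup>2)"
    unfolding gauss_damped_energy[OF u1 u2 t] R_def .
  have conv: "complex_of_real (gauss (t k *\<^sub>R \<xi>)) * (fourier_L1 u \<xi> * cnj (fourier_L1 u \<xi>)) =
      of_real (gauss (t k *\<^sub>R \<xi>) * (cmod (fourier_L1 u \<xi>))\<^sup>2)" for k \<xi>
    by (simp flip: complex_norm_square)
  have lim': "(\<lambda>k. \<integral>\<xi>. gauss (t k *\<^sub>R \<xi>) * (cmod (fourier_L1 u \<xi>))\<^sup>2 \<partial>lborel) \<longlonglongrightarrow> (l2_norm lborel u)\<^sup>2"
    using lim unfolding conv by (simp only: integral_complex_of_real tendsto_of_real_iff)
  have int: "integrable lborel (\<lambda>\<xi>. gauss (t k *\<^sub>R \<xi>) * (cmod (fourier_L1 u \<xi>))\<^sup>2)" for k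
  proof (rule Bochner_Integration.integrable_bound)
    show "integrable lborel (\<lambda>\<xi>::'a. gauss (t k *\<^sub>R \<xi>) * (?c * L1_norm u)\<^sup>2)"
      by (intro integrable_mult_left gauss_fourier_scaled(1) t)
    show "AE \<xi> in lborel. norm (gauss (t k *\<^sub>R \<xi>) * (cmod (fourier_L1 u \<xi>))\<^sup>2) \<le>
        norm (gauss (t k *\<^sub>R \<xi>) * (?c * L1_norm u)\<^sup>2)"
      using fourier_L1_bound[OF u1] c
      by (intro AE_I2) (auto simp: abs_mult less_imp_le intro!: mult_left_mono power_mono)
  qed measurable
  have "(\<lambda>k. \<integral>\<^sup>+\<xi>. ennreal (gauss (t k *\<^sub>R \<xi>) * (cmod (fourier_L1 u \<xi>))\<^sup>2) \<partial>lborel) \<longlonglongrightarrow>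
      (\<integral>\<^sup>+\<xi>. ennreal ((cmod (fourier_L1 u \<xi>))\<^sup>2) \<partial>lborel)"
  proof (rule nn_integral_LIMSEQ)
    have "gauss (t i *\<^sub>R \<xi>) \<le> gauss (t j *\<^sub>R \<xi>)" if "i \<le> j" for i j and \<xi> :: 'a
    proof -
      have "t j * norm \<xi> \<le> t i * norm \<xi>" using that by (intro mult_right_mono) (auto simp: t_def frac_le)
      then have "(t j * norm \<xi>)\<^sup>2 \<le> (t i * norm \<xi>)\<^sup>2" using t by (intro power_mono) (auto simp: less_imp_le)
      then show ?thesis using t by (simp add: gauss_def power_mult_distrib less_imp_le)
    qed
    then show "incseq (\<lambda>k \<xi>. ennreal (gauss (t k *\<^sub>R \<xi>) * (cmod (fourier_L1 u \<xi>))\<^sup>2))"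
      by (auto simp: incseq_def le_fun_def intro!: ennreal_leI mult_right_mono)
    fix \<xi> :: 'a
    have "isCont gauss (0::'a)" unfolding gauss_def by (intro continuous_intros) auto
    moreover have "(\<lambda>k. t k *\<^sub>R \<xi>) \<longlonglongrightarrow> 0 *\<^sub>R \<xi>" by (intro tendsto_intros t0)
    ultimately have "(\<lambda>k. gauss (t k *\<^sub>R \<xi>)) \<longlonglongrightarrow> 1"
      using isCont_tendsto_compose[of 0 gauss "\<lambda>k. t k *\<^sub>R \<xi>" sequentially] by simp
    then have "(\<lambda>k. gauss (t k *\<^sub>R \<xi>) * (cmod (fourier_L1 u \<xi>))\<^sup>2) \<longlonglongrightarrow> 1 * (cmod (fourier_L1 u \<xi>))\<^sup>2"
      by (intro tendsto_intros)
    then show "(\<lambda>k. ennreal (gauss (t k *\<^sub>R \<xi>) * (cmod (fourier_L1 u \<xi>))\<^sup>2)) \<longlonglongrightarrow> ennreal ((cmod (fourier_L1 u \<xi>))\<^sup>2)"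
      by (intro tendsto_ennrealI) simp
  qed measurable
  moreover have "(\<integral>\<^sup>+\<xi>. ennreal (gauss (t k *\<^sub>R \<xi>) * (cmod (fourier_L1 u \<xi>))\<^sup>2) \<partial>lborel) =
      ennreal (\<integral>\<xi>. gauss (t k *\<^sub>R \<xi>) * (cmod (fourier_L1 u \<xi>))\<^sup>2 \<partial>lborel)" for k
    by (rule nn_integral_eq_integral[OF int]) (simp add: less_imp_le)
  ultimately have eq: "(\<integral>\<^sup>+\<xi>. ennreal ((cmod (fourier_L1 u \<xi>))\<^sup>2) \<partial>lborel) = ennreal ((l2_norm lborel u)\<^sup>2)"
    using LIMSEQ_unique[OF _ tendsto_ennrealI[OF lim']] by simp
  show *: "fourier_L1 u \<in> l2 lborel"
    by (rule l2_finite) (auto simp: eq)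
  show "l2_norm lborel (fourier_L1 u) = l2_norm lborel u"
    using eq nn_integral_l2[OF *] by simp
qed

lemma fourier_L1_diff:
  fixes u v :: "'a::euclidean_space \<Rightarrow> complex"
  assumes "integrable lborel u" "integrable lborel v"
  shows "fourier_L1 (\<lambda>x. u x - v x) = (\<lambda>\<xi>. fourier_L1 u \<xi> - fourier_L1 v \<xi>)"
  using integrable_phase[OF assms(1)] integrable_phase[OF assms(2)]
  by (intro ext) (simp add: fourier_L1_altdef right_diff_distrib)

lemma fourier_L1_translate:
  fixes u :: "'a::euclidean_space \<Rightarrow> complex"
  assumes "integrable lborel u"
  shows "fourier_L1 (\<lambda>x. u (x + z)) \<xi> = exp (\<i> * of_real (z \<bullet> \<xi>)) * fourier_L1 u \<xi>"
proof -
  have [measurable]: "u \<in> borel_measurable borel" using assms by (auto dest: borel_measurable_integrable)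
  have "(\<integral>x. exp (- \<i> * of_real (x \<bullet> \<xi>)) * u x \<partial>lborel) =
      (\<integral>x. exp (- \<i> * of_real ((z + x) \<bullet> \<xi>)) * u (z + x) \<partial>lborel)"
    by (subst integral_lborel_affine[of _ 1 z]) simp_all
  also have "\<dots> = (\<integral>x. exp (- \<i> * of_real (z \<bullet> \<xi>)) * (exp (- \<i> * of_real (x \<bullet> \<xi>)) * u (x + z)) \<partial>lborel)"
    by (simp add: inner_add_left distrib_left exp_add[symmetric] mult.assoc[symmetric] add.commute
        minus_add_distrib ring_distribs flip: exp_add)
  also have "\<dots> = exp (- \<i> * of_real (z \<bullet> \<xi>)) * (\<integral>x. exp (- \<i> * of_real (x \<bullet> \<xi>)) * u (x + z) \<partial>lborel)"
    by (rule integral_mult_right_zero)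
  finally show ?thesis by (simp add: fourier_L1_altdef exp_minus field_simps)
qed

text \<open>Plancherel's theorem: the limit defining \<open>fourier\<close> exists for every \<open>L\<^sup>2\<close> function.\<close>
lemma fourier_l2:
  fixes u :: "'a::euclidean_space \<Rightarrow> complex"
  assumes u: "u \<in> l2 lborel"
  shows "fourier u \<in> l2 lborel"
    "(\<lambda>k. l2_norm lborel (\<lambda>\<xi>. fourier_L1 (truncate u k) \<xi> - fourier u \<xi>)) \<longlonglongrightarrow> 0"
proof -
  note T = truncate_l2[OF u]
  define F where "F k = fourier_L1 (truncate u k)" for k
  have F: "F k \<in> l2 lborel" for k unfolding F_def by (rule plancherel_L1(1)[OF T(2,1)])
  have dist: "l2_norm lborel (\<lambda>\<xi>. F m \<xi> - F n \<xi>) = l2_norm lborel (\<lambda>x. truncate u m x - truncate u n x)" for m n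
    unfolding F_def fourier_L1_diff[OF T(2) T(2), symmetric]
    by (rule plancherel_L1(2)) (intro Bochner_Integration.integrable_diff T l2_diff)+
  have nn: "(\<integral>\<^sup>+\<xi>. ennreal ((cmod (F k \<xi> - U \<xi>))\<^sup>2) \<partial>lborel) = ennreal ((l2_norm lborel (\<lambda>\<xi>. F k \<xi> - U \<xi>))\<^sup>2)"
    if "U \<in> l2 lborel" for U k
    by (rule nn_integral_l2[OF l2_diff[OF F that]])
  obtain U where U: "U \<in> l2 lborel" "(\<lambda>k. l2_norm lborel (\<lambda>\<xi>. F k \<xi> - U \<xi>)) \<longlonglongrightarrow> 0"
  proof (rule l2_complete[OF F])
    show "\<exists>N. \<forall>m\<ge>N. \<forall>n\<ge>N. l2_norm lborel (\<lambda>x. F m x - F n x) < e" if "e > 0" for e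
      unfolding dist by (rule l2_convergent_Cauchy[OF T(1) u T(3) that])
  qed blast
  let ?P = "\<lambda>U. U \<in> L2 \<and> (\<lambda>k::nat. \<integral>\<^sup>+\<xi>. ennreal ((cmod
        (fourier_L1 (\<lambda>x. if norm x \<le> real k then u x else 0) \<xi> - U \<xi>))\<^sup>2) \<partial>lborel) \<longlonglongrightarrow> 0"
  have tr: "fourier_L1 (\<lambda>x. if norm x \<le> real k then u x else 0) = F k" for k
    unfolding F_def truncate_def ..
  have "(\<lambda>k. ennreal ((l2_norm lborel (\<lambda>\<xi>. F k \<xi> - U \<xi>))\<^sup>2)) \<longlonglongrightarrow> ennreal (0\<^sup>2)"
    by (intro tendsto_ennrealI tendsto_intros U)
  then have "?P U" using U(1) unfolding tr nn[OF U(1)] L2_eq_l2 by simp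
  then have P: "?P (fourier u)" unfolding fourier_def by (rule someI[of ?P])
  then show V: "fourier u \<in> l2 lborel" by (simp add: L2_eq_l2)
  have "(\<lambda>k. ennreal ((l2_norm lborel (\<lambda>\<xi>. F k \<xi> - fourier u \<xi>))\<^sup>2)) \<longlonglongrightarrow> ennreal 0"
    using P unfolding tr nn[OF V] by simp
  then have "(\<lambda>k. (l2_norm lborel (\<lambda>\<xi>. F k \<xi> - fourier u \<xi>))\<^sup>2) \<longlonglongrightarrow> 0"
    by (subst (asm) tendsto_ennreal_iff) auto
  then have "(\<lambda>k. sqrt ((l2_norm lborel (\<lambda>\<xi>. F k \<xi> - fourier u \<xi>))\<^sup>2)) \<longlonglongrightarrow> sqrt 0"
    by (rule tendsto_real_sqrt)
  then show "(\<lambda>k. l2_norm lborel (\<lambda>\<xi>. fourier_L1 (truncate u k) \<xi> - fourier u \<xi>)) \<longlonglongrightarrow> 0"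
    by (simp add: F_def)
qed

lemma plancherel:
  fixes u :: "'a::euclidean_space \<Rightarrow> complex"
  assumes u: "u \<in> l2 lborel"
  shows "l2_norm lborel (fourier u) = l2_norm lborel u"
proof (rule LIMSEQ_unique)
  note T = truncate_l2[OF u]
  show "(\<lambda>k. l2_norm lborel (truncate u k)) \<longlonglongrightarrow> l2_norm lborel u"
    by (rule l2_norm_tendsto[OF T(1) u T(3)])
  show "(\<lambda>k. l2_norm lborel (truncate u k)) \<longlonglongrightarrow> l2_norm lborel (fourier u)"
    using l2_norm_tendsto[OF plancherel_L1(1)[OF T(2,1)] fourier_l2[OF u]]
    by (simp add: plancherel_L1(2)[OF T(2,1)])
qed

text \<open>A translation multiplies the transform by a phase. This is clear for truncations, which are
  integrable, and both sides pass to the limit.\<close>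
lemma plancherel_translate:
  fixes u :: "'a::euclidean_space \<Rightarrow> complex"
  assumes u: "u \<in> l2 lborel"
  shows "l2_norm lborel (\<lambda>x. u (x + z) - u x) =
    l2_norm lborel (\<lambda>\<xi>. (exp (\<i> * of_real (z \<bullet> \<xi>)) - 1) * fourier u \<xi>)"
proof (rule LIMSEQ_unique)
  note T = truncate_l2[OF u] and F = fourier_l2[OF u]
  define p where "p \<xi> = exp (\<i> * of_real (z \<bullet> \<xi>)) - 1" for \<xi> :: 'a
  have [measurable]: "p \<in> borel_measurable borel" unfolding p_def by measurable
  have p: "cmod (p \<xi>) \<le> 2" for \<xi>
    using norm_triangle_ineq4[of "exp (\<i> * of_real (z \<bullet> \<xi>))" 1] by (simp add: p_def)
  have pv: "(\<lambda>\<xi>. p \<xi> * v \<xi>) \<in> l2 lborel \<and> l2_norm lborel (\<lambda>\<xi>. p \<xi> * v \<xi>) \<le> 2 * l2_norm lborel v"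
    if v: "v \<in> l2 lborel" for v
  proof -
    have [measurable]: "v \<in> borel_measurable borel" using v by (auto simp: l2_def)
    have "(\<integral>\<^sup>+\<xi>. ennreal ((cmod (p \<xi> * v \<xi>))\<^sup>2) \<partial>lborel) \<le> (\<integral>\<^sup>+\<xi>. ennreal ((cmod (2 * v \<xi>))\<^sup>2) \<partial>lborel)"
      using p by (intro nn_integral_mono ennreal_leI power_mono) (auto simp: norm_mult intro!: mult_right_mono)
    also have "\<dots> = ennreal ((2 * l2_norm lborel v)\<^sup>2)"
      by (subst nn_integral_l2[OF l2_scale[OF v]]) (simp add: l2_norm_scale)
    finally show ?thesis by (intro conjI l2_bounded[where B = "2 * l2_norm lborel v"]) auto
  qed
  define w where "w k x = truncate u k (x + z) - truncate u k x" for k x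
  have Tz: "(\<lambda>x. truncate u k (x + z)) \<in> l2 lborel" "integrable lborel (\<lambda>x. truncate u k (x + z))" for k
    using l2_translate(1)[OF T(1)] integrable_lborel_affine[OF T(2)[of k], of 1 z]
    by (simp_all add: add.commute[of z])
  have w1: "integrable lborel (w k)" and w2: "w k \<in> l2 lborel" for k
    unfolding w_def by (intro Bochner_Integration.integrable_diff l2_diff Tz T)+
  have Fw: "fourier_L1 (w k) = (\<lambda>\<xi>. p \<xi> * fourier_L1 (truncate u k) \<xi>)" for k
    unfolding w_def fourier_L1_diff[OF Tz(2) T(2)] fourier_L1_translate[OF T(2)] p_def
    by (simp add: algebra_simps)
  have uz: "(\<lambda>x. u (x + z) - u x) \<in> l2 lborel" by (intro l2_diff l2_translate u)
  have "(\<lambda>k. l2_norm lborel (\<lambda>x. w k x - (u (x + z) - u x))) \<longlonglongrightarrow> 0"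
  proof (rule Lim_null_comparison)
    show "(\<lambda>k. 2 * l2_norm lborel (\<lambda>x. truncate u k x - u x)) \<longlonglongrightarrow> 0"
      using tendsto_mult_right_zero[OF T(3)] .
    have "l2_norm lborel (\<lambda>x. w k x - (u (x + z) - u x)) \<le> 2 * l2_norm lborel (\<lambda>x. truncate u k x - u x)" for k
    proof -
      let ?d = "\<lambda>x. truncate u k x - u x"
      have d: "?d \<in> l2 lborel" by (intro l2_diff T u)
      have "(\<lambda>x. w k x - (u (x + z) - u x)) = (\<lambda>x. ?d (x + z) - ?d x)"
        by (simp add: w_def algebra_simps)
      then show ?thesis
        using l2_norm_triangle_sub[OF l2_translate(1)[OF d] d] l2_translate(2)[OF d] by simp
    qed
    then show "\<forall>\<^sub>F k in sequentially. norm (l2_norm lborel (\<lambda>x. w k x - (u (x + z) - u x))) \<le>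
        2 * l2_norm lborel (\<lambda>x. truncate u k x - u x)" by simp
  qed
  then show "(\<lambda>k. l2_norm lborel (w k)) \<longlonglongrightarrow> l2_norm lborel (\<lambda>x. u (x + z) - u x)"
    by (rule l2_norm_tendsto[OF w2 uz])
  have "(\<lambda>k. l2_norm lborel (\<lambda>\<xi>. fourier_L1 (w k) \<xi> - p \<xi> * fourier u \<xi>)) \<longlonglongrightarrow> 0"
  proof (rule Lim_null_comparison)
    show "(\<lambda>k. 2 * l2_norm lborel (\<lambda>\<xi>. fourier_L1 (truncate u k) \<xi> - fourier u \<xi>)) \<longlonglongrightarrow> 0"
      using tendsto_mult_right_zero[OF F(2)] .
    show "\<forall>\<^sub>F k in sequentially. norm (l2_norm lborel (\<lambda>\<xi>. fourier_L1 (w k) \<xi> - p \<xi> * fourier u \<xi>)) \<le>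
        2 * l2_norm lborel (\<lambda>\<xi>. fourier_L1 (truncate u k) \<xi> - fourier u \<xi>)"
      using pv[OF l2_diff[OF plancherel_L1(1)[OF T(2,1)] F(1)]]
      by (intro always_eventually) (simp add: Fw right_diff_distrib)
  qed
  then have "(\<lambda>k. l2_norm lborel (fourier_L1 (w k))) \<longlonglongrightarrow> l2_norm lborel (\<lambda>\<xi>. p \<xi> * fourier u \<xi>)"
    by (rule l2_norm_tendsto[OF plancherel_L1(1)[OF w1 w2] conjunct1[OF pv[OF F(1)]]])
  then show "(\<lambda>k. l2_norm lborel (w k)) \<longlonglongrightarrow>
      l2_norm lborel (\<lambda>\<xi>. (exp (\<i> * of_real (z \<bullet> \<xi>)) - 1) * fourier u \<xi>)"
    by (simp add: plancherel_L1(2)[OF w1 w2] p_def)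
qed

section \<open>The kernel and its symbol\<close>

text \<open>For \<open>p = n + 2 s\<close> a multiple of this dominates the kernel times \<open>min 1 |z|\<^sup>2\<close>, which is what the cosine in the
  symbol and the increments of a test function leave of the singularity.\<close>
definition singular_weight :: "real \<Rightarrow> 'a::euclidean_space \<Rightarrow> real" where
  "singular_weight p z = min 1 ((norm z)\<^sup>2) * norm z powr (- p)"

text \<open>At the origin \<open>s < 1\<close> is used, at infinity \<open>0 < s\<close>.\<close>
lemma nn_integral_radial_weight_finite:
  fixes s :: real
  assumes "0 < s" "s < 1"
  shows "(\<integral>\<^sup>+r. ennreal (indicator {0<..} r * (min 1 (r\<^sup>2) * r powr (- 1 - 2 * s))) \<partial>lborel) < \<infinity>"
proof -
  have 1: "(\<integral>\<^sup>+r. ennreal (indicator {0..1} r * r powr (1 - 2 * s)) \<partial>lborel) < \<infinity>"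
    using nn_integral_has_integral_lebesgue[OF _ has_integral_powr_from_0[of "1 - 2 * s" 1]] assms
    by (simp add: ennreal_mult' mult.commute ennreal_indicator less_top)
  have 2: "(\<integral>\<^sup>+r. ennreal (indicator {1..} r * r powr (- 1 - 2 * s)) \<partial>lborel) < \<infinity>"
    using nn_integral_has_integral_lebesgue[OF _ has_integral_powr_to_inf[of "- 1 - 2 * s" 1]] assms
    by (simp add: ennreal_mult' mult.commute ennreal_indicator less_top)
  have "(\<integral>\<^sup>+r. ennreal (indicator {0<..} r * (min 1 (r\<^sup>2) * r powr (- 1 - 2 * s))) \<partial>lborel) \<le>
    (\<integral>\<^sup>+r. ennreal (indicator {0..1} r * r powr (1 - 2 * s)) + ennreal (indicator {1..} r * r powr (- 1 - 2 * s)) \<partial>lborel)"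
  proof (rule nn_integral_mono)
    fix r :: real
    have "r\<^sup>2 * r powr (- 1 - 2 * s) = r powr (1 - 2 * s)" if "r > 0"
    proof -
      have "r\<^sup>2 * r powr (- 1 - 2 * s) = r powr (2 + (- 1 - 2 * s))"
        using that by (subst powr_add) simp
      then show ?thesis by simp
    qed
    moreover have "min 1 (r\<^sup>2) * r powr (- 1 - 2 * s) \<le> r\<^sup>2 * r powr (- 1 - 2 * s)"
      "min 1 (r\<^sup>2) * r powr (- 1 - 2 * s) \<le> 1 * r powr (- 1 - 2 * s)"
      by (intro mult_right_mono; simp)+
    ultimately have "indicator {0<..} r * (min 1 (r\<^sup>2) * r powr (- 1 - 2 * s)) \<le>
       indicator {0..1} r * r powr (1 - 2 * s) + indicator {1..} r * r powr (- 1 - 2 * s)"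
      by (auto simp: indicator_def not_le intro: add_increasing add_increasing2)
    then show "ennreal (indicator {0<..} r * (min 1 (r\<^sup>2) * r powr (- 1 - 2 * s))) \<le>
      ennreal (indicator {0..1} r * r powr (1 - 2 * s)) + ennreal (indicator {1..} r * r powr (- 1 - 2 * s))"
      by (simp only: ennreal_leI flip: ennreal_plus[OF mult_nonneg_nonneg[OF indicator_pos_le powr_ge_zero]
          mult_nonneg_nonneg[OF indicator_pos_le powr_ge_zero]])
  qed
  also have "\<dots> < \<infinity>" using 1 2 by (subst nn_integral_add) auto
  finally show ?thesis .
qed

text \<open>The weight at \<open>z\<close> is dominated by its one-dimensional counterpart averaged over radii
  between \<open>|z|\<close> and \<open>2 |z|\<close>; exchanging the integrals leaves volumes of balls.\<close>
lemma integrable_singular_weight: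
  fixes s :: real
  assumes s: "0 < s" "s < 1"
  shows "integrable lborel (singular_weight (real DIM('a) + 2 * s) :: 'a::euclidean_space \<Rightarrow> real)"
proof -
  define p where "p = real DIM('a) + 2 * s"
  have p: "p > 0" using s by (simp add: p_def)
  define q where "q r = indicator {0<..} r * (min 1 (r\<^sup>2) * r powr (- p - 1))" for r :: real
  have [measurable]: "q \<in> borel_measurable borel" unfolding q_def by measurable
  have [measurable]: "(singular_weight p :: 'a \<Rightarrow> real) \<in> borel_measurable borel"
    unfolding singular_weight_def by measurable
  have q0: "q r \<ge> 0" for r by (simp add: q_def)
  have lower: "ennreal (singular_weight p z) \<le>
      ennreal (2 powr (p + 1)) * (\<integral>\<^sup>+r. ennreal (q r) * indicator {r. norm z < r} r \<partial>lborel)" for z :: 'a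
  proof (cases "z = 0")
    case True then show ?thesis by (simp add: singular_weight_def)
  next
    case False
    define m where "m = min 1 ((norm z)\<^sup>2) * (2 * norm z) powr (- p - 1)"
    have m0: "m \<ge> 0" by (simp add: m_def)
    have "2 powr (p + 1) * (m * norm z) = singular_weight p z"
    proof -
      have "2 powr (p + 1) * ((2 * norm z) powr (- p - 1) * norm z) = norm z powr (- p)"
        using False by (simp add: powr_mult powr_diff powr_minus powr_add field_simps)
      then show ?thesis by (simp add: m_def singular_weight_def mult_ac)
    qed
    then have "ennreal (singular_weight p z) = ennreal (2 powr (p + 1)) * ennreal (m * norm z)"
      using m0 by (simp flip: ennreal_mult')
    also have "ennreal (m * norm z) = (\<integral>\<^sup>+r. ennreal m * indicator {norm z<..<2 * norm z} r \<partial>lborel)"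
      using m0 by (simp add: nn_integral_cmult_indicator ennreal_mult)
    also have "\<dots> \<le> (\<integral>\<^sup>+r. ennreal (q r) * indicator {r. norm z < r} r \<partial>lborel)"
    proof (rule nn_integral_mono)
      fix r :: real
      show "ennreal m * indicator {norm z<..<2 * norm z} r \<le> ennreal (q r) * indicator {r. norm z < r} r"
      proof (cases "norm z < r \<and> r < 2 * norm z")
        case True
        then have r: "r > 0" using norm_ge_zero[of z] by linarith
        have "m \<le> min 1 (r\<^sup>2) * r powr (- p - 1)"
          unfolding m_def
        proof (intro mult_mono)
          have "(norm z)\<^sup>2 \<le> r\<^sup>2" using True by (intro power_mono) auto
          then show "min 1 ((norm z)\<^sup>2) \<le> min 1 (r\<^sup>2)" by auto
          show "(2 * norm z) powr (- p - 1) \<le> r powr (- p - 1)"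
            using True r p by (intro powr_mono2') auto
        qed auto
        then show ?thesis using True r by (simp add: q_def ennreal_leI)
      qed (auto simp: indicator_def)
    qed
    finally show ?thesis by (simp add: mult_left_mono)
  qed
  have "(\<integral>\<^sup>+z. ennreal (singular_weight p (z::'a)) \<partial>lborel) \<le>
      (\<integral>\<^sup>+z. ennreal (2 powr (p + 1)) * (\<integral>\<^sup>+r. ennreal (q r) * indicator {r. norm (z::'a) < r} r \<partial>lborel) \<partial>lborel)"
    by (intro nn_integral_mono lower)
  also have "\<dots> = ennreal (2 powr (p + 1)) *
      (\<integral>\<^sup>+z. (\<integral>\<^sup>+r. ennreal (q r) * indicator {r. norm (z::'a) < r} r \<partial>lborel) \<partial>lborel)"
    by (rule nn_integral_cmult) measurable
  also have "(\<integral>\<^sup>+z. (\<integral>\<^sup>+r. ennreal (q r) * indicator {r. norm (z::'a) < r} r \<partial>lborel) \<partial>lborel) =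
      (\<integral>\<^sup>+r. (\<integral>\<^sup>+z. ennreal (q r) * indicator {r. norm (z::'a) < r} r \<partial>lborel) \<partial>lborel)"
    by (rule lborel_pair.Fubini'[symmetric]) measurable
  also have "\<dots> = (\<integral>\<^sup>+r. ennreal (unit_ball_vol (real DIM('a))) *
        ennreal (indicator {0<..} r * (min 1 (r\<^sup>2) * r powr (- 1 - 2 * s))) \<partial>lborel)"
  proof (rule nn_integral_cong)
    fix r :: real
    have "(\<integral>\<^sup>+z. ennreal (q r) * indicator {r. norm (z::'a) < r} r \<partial>lborel) =
        (\<integral>\<^sup>+z. ennreal (q r) * indicator (ball (0::'a) r) z \<partial>lborel)"
      by (intro nn_integral_cong) (auto simp: indicator_def)
    also have "\<dots> = ennreal (q r) * emeasure lborel (ball (0::'a) r)"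
      by (rule nn_integral_cmult_indicator) simp
    also have "\<dots> = ennreal (unit_ball_vol (real DIM('a))) *
        ennreal (indicator {0<..} r * (min 1 (r\<^sup>2) * r powr (- 1 - 2 * s)))"
    proof (cases "r > 0")
      case True
      have "r powr (- p - 1) * r ^ DIM('a) = r powr (- 1 - 2 * s)"
      proof -
        have "- 1 - 2 * s = (- p - 1) + real DIM('a)" by (simp add: p_def)
        then show ?thesis using powr_realpow[OF True] powr_add[of r "- p - 1" "real DIM('a)"] by metis
      qed
      then show ?thesis using True q0[of r]
        by (subst emeasure_ball) (auto simp: q_def mult_ac simp flip: ennreal_mult')
    qed (simp add: q_def)
    finally show "(\<integral>\<^sup>+z. ennreal (q r) * indicator {r. norm (z::'a) < r} r \<partial>lborel) =
      ennreal (unit_ball_vol (real DIM('a))) * ennreal (indicator {0<..} r * (min 1 (r\<^sup>2) * r powr (- 1 - 2 * s)))" .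
  qed
  also have "ennreal (2 powr (p + 1)) * \<dots> < \<infinity>"
    using nn_integral_radial_weight_finite[OF s]
    by (subst nn_integral_cmult) (auto simp: ennreal_mult_less_top)
  finally show ?thesis
    unfolding p_def[symmetric] by (intro integrableI_bounded) (auto simp: singular_weight_def)
qed

text \<open>Ellipticity enters as nontriviality of the density: the two-sided bounds on the symbol follow
  from it by homogeneity and compactness (\<open>multiplier_bounds\<close>).\<close>
locale angular_density =
  fixes s :: real and a :: "'a::euclidean_space \<Rightarrow> real"
  assumes s_pos: "0 < s" and s_less_1: "s < 1"
    and density_continuous: "continuous_on (sphere 0 1) a"
    and density_even: "\<And>\<theta>. \<theta> \<in> sphere 0 1 \<Longrightarrow> a (- \<theta>) = a \<theta>"
    and density_nonneg: "\<And>\<theta>. \<theta> \<in> sphere 0 1 \<Longrightarrow> 0 \<le> a \<theta>"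
    and nontrivial: "\<exists>\<theta>\<in>sphere 0 1. a \<theta> \<noteq> 0"
begin

abbreviation K :: "'a \<Rightarrow> real" where "K \<equiv> kernel s a"

lemma K_zero [simp]: "K 0 = 0"
  by (simp add: kernel_def)

lemma normalize_in_sphere: "z \<noteq> 0 \<Longrightarrow> z /\<^sub>R norm z \<in> sphere 0 1"
  by simp

lemma K_nonneg [simp]: "0 \<le> K z"
  using density_nonneg[OF normalize_in_sphere[of z]] by (cases "z = 0") (auto simp: kernel_def)

lemma K_even: "K (- z) = K z"
  using density_even[OF normalize_in_sphere[of z]] by (cases "z = 0") (auto simp: kernel_def)

lemma K_scale:
  assumes "t > 0" shows "K (t *\<^sub>R z) = t powr (- real DIM('a) - 2 * s) * K z"
proof -
  have "(t *\<^sub>R z) /\<^sub>R norm (t *\<^sub>R z) = z /\<^sub>R norm z" using assms by simp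
  then show ?thesis unfolding kernel_def using assms by (simp only:) (simp add: powr_mult)
qed

lemma K_continuous: "continuous_on (- {0}) K"
proof -
  have "continuous_on (- {0}) (\<lambda>z. a (z /\<^sub>R norm z))"
  proof (rule continuous_on_compose2[OF density_continuous])
    show "continuous_on (- {0}) (\<lambda>z::'a. z /\<^sub>R norm z)" by (intro continuous_intros) auto
  qed (use normalize_in_sphere in blast)
  then show ?thesis unfolding kernel_def by (intro continuous_intros) auto
qed

lemma K_measurable [measurable]: "K \<in> borel_measurable borel"
proof -
  have "(\<lambda>z. indicator (- {0}) z *\<^sub>R K z) \<in> borel_measurable borel"
    by (rule borel_measurable_continuous_on_indicator[OF _ K_continuous]) auto
  also have "(\<lambda>z. indicator (- {0}) z *\<^sub>R K z) = K" by (auto simp: indicator_def fun_eq_iff)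
  finally show ?thesis .
qed

lemma K_bound: obtains A where "A > 0" "\<And>z. K z \<le> A * norm z powr (- (real DIM('a) + 2 * s))"
proof -
  have "compact (a ` sphere 0 1)" by (intro compact_continuous_image density_continuous) simp
  then obtain B where B': "\<forall>y\<in>a ` sphere 0 1. norm y \<le> B"
    by (blast dest: compact_imp_bounded bounded_iff[THEN iffD1])
  have B: "\<bar>a \<theta>\<bar> \<le> B" if "\<theta> \<in> sphere 0 1" for \<theta>
    using bspec[OF B' imageI[OF that]] unfolding real_norm_def .
  have "K z \<le> max B 1 * norm z powr (- (real DIM('a) + 2 * s))" for z
  proof (cases "z = 0")
    case False
    have "a (z /\<^sub>R norm z) \<le> max B 1" using B[OF normalize_in_sphere[OF False]] by linarith
    moreover have "- (real DIM('a) + 2 * s) = - real DIM('a) - 2 * s" by simp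
    ultimately show ?thesis unfolding kernel_def by (simp only: mult_right_mono powr_ge_zero)
  qed simp
  then show ?thesis by (intro that[of "max B 1"]) auto
qed

lemma K_integrable:
  shows "integrable lborel (\<lambda>z. min 1 ((norm z)\<^sup>2) * K z)"
proof -
  obtain A where A: "A > 0" "\<And>z. K z \<le> A * norm z powr (- (real DIM('a) + 2 * s))"
    by (rule K_bound) blast
  show ?thesis
  proof (rule Bochner_Integration.integrable_bound)
    show "integrable lborel (\<lambda>z::'a. A * singular_weight (real DIM('a) + 2 * s) z)"
      using integrable_singular_weight[OF s_pos s_less_1] by (rule integrable_mult_right)
    have "min 1 ((norm z)\<^sup>2) * K z \<le> A * singular_weight (real DIM('a) + 2 * s) z" for z
      using mult_left_mono[OF A(2)[of z], of "min 1 ((norm z)\<^sup>2)"]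
      by (simp add: singular_weight_def mult_ac)
    then show "AE z in lborel. norm (min 1 ((norm z)\<^sup>2) * K z) \<le> norm (A * singular_weight (real DIM('a) + 2 * s) z)"
      by (intro AE_I2) (rule order_trans[OF _ abs_ge_self[of "A * _", folded real_norm_def]], simp)
  qed measurable
qed

text \<open>In polar coordinates this is twice the symbol.\<close>
definition multiplier :: "'a \<Rightarrow> real" where
  "multiplier \<xi> = (\<integral>z. (2 - 2 * cos (z \<bullet> \<xi>)) * K z \<partial>lborel)"

lemma versine_bound: "0 \<le> 2 - 2 * cos r" "2 - 2 * cos r \<le> 4" "2 - 2 * cos r \<le> r\<^sup>2" for r :: real
proof -
  show "0 \<le> 2 - 2 * cos r" "2 - 2 * cos r \<le> 4" using cos_le_one[of r] cos_ge_minus_one[of r] by linarith+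
  have "2 - 2 * cos r = 4 * (sin (r / 2))\<^sup>2"
    using cos_double_sin[of "r / 2"] by simp
  also have "\<dots> \<le> 4 * (r / 2)\<^sup>2"
  proof (rule mult_left_mono)
    show "(sin (r / 2))\<^sup>2 \<le> (r / 2)\<^sup>2"
      using abs_sin_x_le_abs_x[of "r / 2"] unfolding abs_le_square_iff .
  qed simp
  finally show "2 - 2 * cos r \<le> r\<^sup>2" by (simp add: power_divide)
qed

lemma versine_inner_bound:
  fixes z \<xi> :: 'a
  shows "2 - 2 * cos (z \<bullet> \<xi>) \<le> max 4 ((norm \<xi>)\<^sup>2) * min 1 ((norm z)\<^sup>2)"
proof -
  have "2 - 2 * cos (z \<bullet> \<xi>) \<le> (z \<bullet> \<xi>)\<^sup>2" by (rule versine_bound)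
  also have "\<dots> \<le> (norm z * norm \<xi>)\<^sup>2"
    using Cauchy_Schwarz_ineq2[of z \<xi>] by (simp add: abs_le_square_iff[symmetric])
  also have "\<dots> = (norm \<xi>)\<^sup>2 * (norm z)\<^sup>2" by (simp add: power_mult_distrib)
  also have "\<dots> \<le> max 4 ((norm \<xi>)\<^sup>2) * (norm z)\<^sup>2" by (intro mult_right_mono) auto
  finally show ?thesis using versine_bound(2)[of "z \<bullet> \<xi>"]
    by (cases "(norm z)\<^sup>2 \<le> 1") (auto simp: min_def)
qed

lemma versine_K_le: "(2 - 2 * cos (z \<bullet> \<xi>)) * K z \<le> max 4 ((norm \<xi>)\<^sup>2) * (min 1 ((norm z)\<^sup>2) * K z)"
  using mult_right_mono[OF versine_inner_bound[of z \<xi>] K_nonneg[of z]] by (simp add: mult_ac)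

lemma multiplier_integrable: "integrable lborel (\<lambda>z. (2 - 2 * cos (z \<bullet> \<xi>)) * K z)"
proof (rule Bochner_Integration.integrable_bound)
  show "integrable lborel (\<lambda>z. max 4 ((norm \<xi>)\<^sup>2) * (min 1 ((norm z)\<^sup>2) * K z))"
    using K_integrable by (rule integrable_mult_right)
  show "AE z in lborel. norm ((2 - 2 * cos (z \<bullet> \<xi>)) * K z) \<le> norm (max 4 ((norm \<xi>)\<^sup>2) * (min 1 ((norm z)\<^sup>2) * K z))"
    using versine_K_le[of _ \<xi>] versine_bound(1)
    by (intro AE_I2) (smt (verit) K_nonneg mult_nonneg_nonneg real_norm_def)
qed measurable

lemma multiplier_nonneg: "0 \<le> multiplier \<xi>"
  unfolding multiplier_def by (intro integral_nonneg_AE AE_I2 mult_nonneg_nonneg versine_bound K_nonneg)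

lemma nn_integral_multiplier:
  "(\<integral>\<^sup>+z. ennreal ((2 - 2 * cos (z \<bullet> \<xi>)) * K z) \<partial>lborel) = ennreal (multiplier \<xi>)"
  unfolding multiplier_def
  by (intro nn_integral_eq_integral multiplier_integrable AE_I2 mult_nonneg_nonneg versine_bound K_nonneg)

lemma multiplier_measurable [measurable]: "multiplier \<in> borel_measurable borel"
  unfolding multiplier_def by measurable

lemma multiplier_scale:
  assumes t: "t > 0" shows "multiplier (t *\<^sub>R \<xi>) = t powr (2 * s) * multiplier \<xi>"
proof -
  have "multiplier (t *\<^sub>R \<xi>) = ((1 / t) ^ DIM('a)) *
      (\<integral>z. (2 - 2 * cos (z \<bullet> \<xi>)) * K ((1 / t) *\<^sub>R z) \<partial>lborel)"
    unfolding multiplier_def using t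
    by (subst integral_lborel_affine[of _ "1 / t" 0]) simp_all
  also have "\<dots> = ((1 / t) ^ DIM('a)) * ((1 / t) powr (- real DIM('a) - 2 * s) * multiplier \<xi>)"
    using t unfolding multiplier_def
    by (subst K_scale) (simp_all add: mult.left_commute flip: integral_mult_right_zero)
  also have "(1 / t) ^ DIM('a) * ((1 / t) powr (- real DIM('a) - 2 * s) * multiplier \<xi>) = 
      (1 / t) powr (- (2 * s)) * multiplier \<xi>"
    using t by (simp add: powr_realpow[symmetric] flip: powr_add mult.assoc)
  also have "(1 / t) powr (- (2 * s)) = t powr (2 * s)"
    using t by (simp add: powr_divide powr_minus)
  finally show ?thesis .
qed

text \<open>If the integral vanished, so would the integrand at almost every point of the open cone on
  which the kernel is positive; but on a suitable ray in that cone the cosine takes the value \<open>-1\<close>.\<close>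
lemma multiplier_pos:
  assumes "\<xi> \<noteq> 0" shows "0 < multiplier \<xi>"
proof (rule ccontr)
  assume "\<not> 0 < multiplier \<xi>"
  then have "multiplier \<xi> = 0" using multiplier_nonneg[of \<xi>] by simp
  then have ae: "AE z in lborel. (2 - 2 * cos (z \<bullet> \<xi>)) * K z = 0"
    unfolding multiplier_def
    by (subst (asm) integral_nonneg_eq_0_iff_AE)
       (auto intro!: multiplier_integrable mult_nonneg_nonneg versine_bound)
  obtain \<theta> where \<theta>: "norm \<theta> = 1" "a \<theta> > 0"
    using nontrivial density_nonneg by (force simp: less_le)
  define V where "V = (- {0}) \<inter> K -` {0<..}"
  have V: "open V" unfolding V_def
    by (rule continuous_open_preimage[OF K_continuous]) auto
  have "\<theta> \<in> V" using \<theta> by (auto simp: V_def kernel_def)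
  have "\<exists>z\<in>V. z \<bullet> \<xi> \<noteq> 0"
  proof (cases "\<theta> \<bullet> \<xi> = 0")
    case True
    have "(\<lambda>k. \<theta> + (1 / real (Suc k)) *\<^sub>R \<xi>) \<longlonglongrightarrow> \<theta> + 0 *\<^sub>R \<xi>"
      by (intro tendsto_intros LIMSEQ_Suc[OF lim_1_over_n])
    then have "\<forall>\<^sub>F k in sequentially. \<theta> + (1 / real (Suc k)) *\<^sub>R \<xi> \<in> V"
      by (rule topological_tendstoD[OF _ V]) (simp add: \<open>\<theta> \<in> V\<close>)
    then obtain k where "\<theta> + (1 / real (Suc k)) *\<^sub>R \<xi> \<in> V" by (auto simp: eventually_sequentially)
    moreover have "(\<theta> + (1 / real (Suc k)) *\<^sub>R \<xi>) \<bullet> \<xi> \<noteq> 0"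
      using True assms by (simp add: inner_add_left)
    ultimately show ?thesis by blast
  next
    case False then show ?thesis using \<open>\<theta> \<in> V\<close> by blast
  qed
  then obtain z where z: "z \<in> V" "z \<bullet> \<xi> \<noteq> 0" by blast
  \<comment> \<open>On the ray through \<open>z\<close>, this is where the inner product with \<open>\<xi>\<close> reaches \<open>\<plusminus>\<pi>\<close>.\<close>
  define t where "t = pi / \<bar>z \<bullet> \<xi>\<bar>"
  have t: "t > 0" using z by (simp add: t_def)
  have tz: "t *\<^sub>R z \<in> V" using z t by (auto simp: V_def K_scale)
  have "cos ((t *\<^sub>R z) \<bullet> \<xi>) = -1" using z by (auto simp: t_def abs_if)
  define U where "U = V \<inter> {z. cos (z \<bullet> \<xi>) < 1}"
  have "open U" unfolding U_def
    by (intro open_Int V open_Collect_less continuous_intros)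
  moreover have "t *\<^sub>R z \<in> U" using tz \<open>cos ((t *\<^sub>R z) \<bullet> \<xi>) = -1\<close> by (simp add: U_def)
  moreover have "AE z in lborel. z \<notin> U"
    using ae by eventually_elim (auto simp: U_def V_def)
  then have "U \<in> null_sets lborel"
    using \<open>open U\<close> AE_iff_null_sets[of U lborel] by auto
  ultimately show False
    using open_not_negligible[of U] by (auto simp: negligible_iff_null_sets intro: null_sets_completionI)
qed

lemma multiplier_continuous_on_sphere: "continuous_on (sphere 0 1) multiplier"
proof (rule continuous_on_sequentiallyI)
  fix u :: "nat \<Rightarrow> 'a" and x
  assume u: "\<forall>n. u n \<in> sphere 0 1" "x \<in> sphere 0 1" "u \<longlonglongrightarrow> x"
  show "(\<lambda>n. multiplier (u n)) \<longlonglongrightarrow> multiplier x"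
    unfolding multiplier_def
  proof (rule integral_dominated_convergence)
    show "integrable lborel (\<lambda>z. 4 * (min 1 ((norm z)\<^sup>2) * K z))"
      using K_integrable by (rule integrable_mult_right)
    show "AE z in lborel. (\<lambda>n. (2 - 2 * cos (z \<bullet> u n)) * K z) \<longlonglongrightarrow> (2 - 2 * cos (z \<bullet> x)) * K z"
      by (intro AE_I2 tendsto_intros u)
    show "AE z in lborel. norm ((2 - 2 * cos (z \<bullet> u n)) * K z) \<le> 4 * (min 1 ((norm z)\<^sup>2) * K z)" for n
      using versine_K_le[of _ "u n"] versine_bound(1) u(1)
      by (intro AE_I2) (simp add: abs_mult)
  qed measurable
qed

text \<open>Homogeneity reduces both bounds to the compact unit sphere.\<close>
lemma multiplier_bounds:
  obtains c C where "c > 0" "\<And>\<xi>. c * norm \<xi> powr (2 * s) \<le> multiplier \<xi>"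
    "C > 0" "\<And>\<xi>. multiplier \<xi> \<le> C * norm \<xi> powr (2 * s)"
proof -
  have ne: "sphere (0::'a) 1 \<noteq> {}" by simp
  obtain x where x: "x \<in> sphere 0 1" "\<And>y. y \<in> sphere 0 1 \<Longrightarrow> multiplier x \<le> multiplier y"
    using continuous_attains_inf[OF compact_sphere ne multiplier_continuous_on_sphere] by blast
  obtain y where y: "y \<in> sphere 0 1" "\<And>x. x \<in> sphere 0 1 \<Longrightarrow> multiplier x \<le> multiplier y"
    using continuous_attains_sup[OF compact_sphere ne multiplier_continuous_on_sphere] by blast
  have pos: "multiplier x > 0" "multiplier y > 0" using x y by (auto intro!: multiplier_pos)
  have "multiplier x * norm \<xi> powr (2 * s) \<le> multiplier \<xi> \<and> multiplier \<xi> \<le> multiplier y * norm \<xi> powr (2 * s)" for \<xi>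
  proof (cases "\<xi> = 0")
    case True then show ?thesis by (simp add: multiplier_def)
  next
    case False
    have "multiplier \<xi> = norm \<xi> powr (2 * s) * multiplier (\<xi> /\<^sub>R norm \<xi>)"
      using multiplier_scale[of "norm \<xi>" "\<xi> /\<^sub>R norm \<xi>"] False by simp
    then show ?thesis
      using mult_right_mono[OF x(2)[OF normalize_in_sphere[OF False]], of "norm \<xi> powr (2 * s)"]
        mult_right_mono[OF y(2)[OF normalize_in_sphere[OF False]], of "norm \<xi> powr (2 * s)"]
      by (simp only: mult.commute[of "norm \<xi> powr (2 * s)"] powr_ge_zero simp_thms)
  qed
  then show ?thesis using that[of "multiplier x" "multiplier y"] pos by blast
qed

end

section \<open>The energy as an inner product of increments\<close>

definition increment :: "('a \<Rightarrow> complex) \<Rightarrow> 'a \<times> 'a \<Rightarrow> complex" where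
  "increment u = (\<lambda>(x, y). u x - u y)"

lemma increment_measurable [measurable]:
  fixes u :: "'a::euclidean_space \<Rightarrow> complex"
  assumes [measurable]: "u \<in> borel_measurable borel"
  shows "increment u \<in> borel_measurable (borel \<Otimes>\<^sub>M borel)"
  unfolding increment_def by measurable

lemma increment_linear:
  "increment (\<lambda>x. u x + v x) = (\<lambda>p. increment u p + increment v p)"
  "increment (\<lambda>x. u x - v x) = (\<lambda>p. increment u p - increment v p)"
  "increment (\<lambda>x. c * u x) = (\<lambda>p. c * increment u p)"
  by (auto simp: increment_def algebra_simps)

lemma sq_cmod_exp_minus_1: "(cmod (exp (\<i> * of_real r) - 1))\<^sup>2 = 2 - 2 * cos r"
proof -
  have "(cmod (exp (\<i> * of_real r) - 1))\<^sup>2 = (cos r - 1)\<^sup>2 + (sin r)\<^sup>2"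
    by (simp add: cmod_power2 exp_Euler cos_of_real sin_of_real)
  also have "\<dots> = 2 - 2 * cos r"
    using sin_cos_squared_add[of r] by (simp add: power2_diff)
  finally show ?thesis .
qed

context angular_density
begin

abbreviation E :: "('a \<Rightarrow> complex) \<Rightarrow> ('a \<Rightarrow> complex) \<Rightarrow> complex" where
  "E \<equiv> energy_form s a"

text \<open>The energy is half the inner product of increments in \<open>L\<^sup>2\<close> of this measure
  (\<open>energy_form_eq_inner\<close>), so that the Cauchy-Schwarz inequality and the parallelogram law apply.\<close>
definition pair_measure_K :: "('a \<times> 'a) measure" where
  "pair_measure_K = density (lborel \<Otimes>\<^sub>M lborel) (\<lambda>(x, y). ennreal (K (x - y)))"

abbreviation "G \<equiv> pair_measure_K"

lemma sets_G [measurable_cong, simp]: "sets G = sets (borel \<Otimes>\<^sub>M borel)"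
  by (simp add: pair_measure_K_def cong: sets_pair_measure_cong)

text \<open>The second form integrates over the shift \<open>z\<close> and over a base point.\<close>
lemma nn_integral_G:
  assumes [measurable]: "f \<in> borel_measurable (borel \<Otimes>\<^sub>M borel)"
  shows "(\<integral>\<^sup>+p. f p \<partial>G) = (\<integral>\<^sup>+y. \<integral>\<^sup>+x. ennreal (K (x - y)) * f (x, y) \<partial>lborel \<partial>lborel)"
    "(\<integral>\<^sup>+p. f p \<partial>G) = (\<integral>\<^sup>+z. ennreal (K z) * (\<integral>\<^sup>+y. f (y + z, y) \<partial>lborel) \<partial>lborel)"
proof -
  have m: "f \<in> borel_measurable (lborel \<Otimes>\<^sub>M lborel)" by measurable
  have "(\<integral>\<^sup>+p. f p \<partial>G) = (\<integral>\<^sup>+p. (case p of (x, y) \<Rightarrow> ennreal (K (x - y))) * f p \<partial>(lborel \<Otimes>\<^sub>M lborel))"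
    unfolding pair_measure_K_def by (rule nn_integral_density) (use m in measurable)
  also have "\<dots> = (\<integral>\<^sup>+y. \<integral>\<^sup>+x. ennreal (K (x - y)) * f (x, y) \<partial>lborel \<partial>lborel)"
    by (subst lborel_pair.nn_integral_snd[symmetric]) simp_all
  finally show 1: "(\<integral>\<^sup>+p. f p \<partial>G) = (\<integral>\<^sup>+y. \<integral>\<^sup>+x. ennreal (K (x - y)) * f (x, y) \<partial>lborel \<partial>lborel)" .
  also have "\<dots> = (\<integral>\<^sup>+y. \<integral>\<^sup>+z. ennreal (K z) * f (y + z, y) \<partial>lborel \<partial>lborel)"
  proof (rule nn_integral_cong)
    fix y :: 'a
    show "(\<integral>\<^sup>+x. ennreal (K (x - y)) * f (x, y) \<partial>lborel) = (\<integral>\<^sup>+z. ennreal (K z) * f (y + z, y) \<partial>lborel)"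
      by (subst nn_integral_lborel_affine[of _ 1 y]) simp_all
  qed
  also have "\<dots> = (\<integral>\<^sup>+z. \<integral>\<^sup>+y. ennreal (K z) * f (y + z, y) \<partial>lborel \<partial>lborel)"
    by (rule lborel_pair.Fubini') measurable
  also have "\<dots> = (\<integral>\<^sup>+z. ennreal (K z) * (\<integral>\<^sup>+y. f (y + z, y) \<partial>lborel) \<partial>lborel)"
    by (intro nn_integral_cong nn_integral_cmult) measurable
  finally show "(\<integral>\<^sup>+p. f p \<partial>G) = (\<integral>\<^sup>+z. ennreal (K z) * (\<integral>\<^sup>+y. f (y + z, y) \<partial>lborel) \<partial>lborel)" .
qed

lemma energy_form_eq_inner:
  assumes [measurable]: "u \<in> borel_measurable borel" "v \<in> borel_measurable borel"
  shows "E u v = l2_inner G (increment u) (increment v) / 2"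
proof -
  have "(\<lambda>p. increment u p * cnj (increment v p)) \<in> borel_measurable (lborel \<Otimes>\<^sub>M lborel)"
    by measurable
  then have "l2_inner G (increment u) (increment v) =
      (\<integral>p. (case p of (x, y) \<Rightarrow> K (x - y)) *\<^sub>R (increment u p * cnj (increment v p)) \<partial>(lborel \<Otimes>\<^sub>M lborel))"
    unfolding l2_inner_def pair_measure_K_def case_prod_beta
    by (intro integral_density) (auto simp: case_prod_beta)
  also have "\<dots> = (\<integral>(x, y). (u x - u y) * cnj (v x - v y) * of_real (K (x - y)) \<partial>(lborel \<Otimes>\<^sub>M lborel))"
    by (intro Bochner_Integration.integral_cong)
       (auto simp: increment_def scaleR_conv_of_real mult.commute split: prod.splits)
  finally show ?thesis by (simp add: energy_form_def)
qed

text \<open>By Plancherel applied to every increment \<open>u(\<cdot> + z) - u\<close>.\<close>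
lemma gagliardo_fourier:
  assumes u: "u \<in> l2 lborel"
  shows "(\<integral>\<^sup>+p. ennreal ((cmod (increment u p))\<^sup>2) \<partial>G) =
    (\<integral>\<^sup>+\<xi>. ennreal (multiplier \<xi> * (cmod (fourier u \<xi>))\<^sup>2) \<partial>lborel)"
proof -
  have [measurable]: "u \<in> borel_measurable borel" "fourier u \<in> borel_measurable borel"
    using u fourier_l2(1)[OF u] by (auto simp: l2_def)
  let ?e = "\<lambda>z \<xi>. exp (\<i> * of_real (z \<bullet> \<xi>)) - 1"
  have inner: "(\<integral>\<^sup>+y. ennreal ((cmod (u (y + z) - u y))\<^sup>2) \<partial>lborel) =
      (\<integral>\<^sup>+\<xi>. ennreal ((2 - 2 * cos (z \<bullet> \<xi>)) * (cmod (fourier u \<xi>))\<^sup>2) \<partial>lborel)" for z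
  proof -
    have "(\<lambda>\<xi>. ?e z \<xi> * fourier u \<xi>) \<in> l2 lborel"
    proof -
      have "(\<integral>\<^sup>+\<xi>. ennreal ((cmod (?e z \<xi> * fourier u \<xi>))\<^sup>2) \<partial>lborel) \<le>
          (\<integral>\<^sup>+\<xi>. ennreal ((cmod (2 * fourier u \<xi>))\<^sup>2) \<partial>lborel)"
        by (intro nn_integral_mono ennreal_leI)
           (simp add: norm_mult power_mult_distrib sq_cmod_exp_minus_1 mult_right_mono versine_bound)
      also have "\<dots> < \<infinity>"
        unfolding nn_integral_l2[OF l2_scale[OF fourier_l2(1)[OF u]]] by simp
      finally show ?thesis by (intro l2_finite) simp_all
    qed
    from nn_integral_l2[OF this]
    have "(\<integral>\<^sup>+\<xi>. ennreal ((cmod (?e z \<xi> * fourier u \<xi>))\<^sup>2) \<partial>lborel) = ennreal ((l2_norm lborel (\<lambda>x. u (x + z) - u x))\<^sup>2)"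
      unfolding plancherel_translate[OF u] .
    also have "\<dots> = (\<integral>\<^sup>+y. ennreal ((cmod (u (y + z) - u y))\<^sup>2) \<partial>lborel)"
      by (rule nn_integral_l2[symmetric]) (intro l2_diff l2_translate u)
    finally show ?thesis by (simp add: norm_mult power_mult_distrib sq_cmod_exp_minus_1)
  qed
  have "(\<integral>\<^sup>+p. ennreal ((cmod (increment u p))\<^sup>2) \<partial>G) =
      (\<integral>\<^sup>+z. ennreal (K z) * (\<integral>\<^sup>+y. ennreal ((cmod (u (y + z) - u y))\<^sup>2) \<partial>lborel) \<partial>lborel)"
    by (subst nn_integral_G(2)) (simp_all add: increment_def)
  also have "\<dots> = (\<integral>\<^sup>+z. \<integral>\<^sup>+\<xi>. ennreal (K z) * ennreal ((2 - 2 * cos (z \<bullet> \<xi>)) * (cmod (fourier u \<xi>))\<^sup>2) \<partial>lborel \<partial>lborel)"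
    unfolding inner by (intro nn_integral_cong nn_integral_cmult[symmetric]) simp
  also have "\<dots> = (\<integral>\<^sup>+\<xi>. \<integral>\<^sup>+z. ennreal (K z) * ennreal ((2 - 2 * cos (z \<bullet> \<xi>)) * (cmod (fourier u \<xi>))\<^sup>2) \<partial>lborel \<partial>lborel)"
    by (rule lborel_pair.Fubini'[symmetric]) measurable
  also have "\<dots> = (\<integral>\<^sup>+\<xi>. ennreal (multiplier \<xi> * (cmod (fourier u \<xi>))\<^sup>2) \<partial>lborel)"
  proof (rule nn_integral_cong)
    fix \<xi> :: 'a
    have "(\<integral>\<^sup>+z. ennreal (K z) * ennreal ((2 - 2 * cos (z \<bullet> \<xi>)) * (cmod (fourier u \<xi>))\<^sup>2) \<partial>lborel) =
        (\<integral>\<^sup>+z. ennreal ((cmod (fourier u \<xi>))\<^sup>2) * ennreal ((2 - 2 * cos (z \<bullet> \<xi>)) * K z) \<partial>lborel)"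
      by (intro nn_integral_cong) (simp add: versine_bound mult_ac flip: ennreal_mult)
    also have "\<dots> = ennreal ((cmod (fourier u \<xi>))\<^sup>2) * ennreal (multiplier \<xi>)"
      by (subst nn_integral_cmult) (simp_all add: nn_integral_multiplier)
    finally show "(\<integral>\<^sup>+z. ennreal (K z) * ennreal ((2 - 2 * cos (z \<bullet> \<xi>)) * (cmod (fourier u \<xi>))\<^sup>2) \<partial>lborel) =
      ennreal (multiplier \<xi> * (cmod (fourier u \<xi>))\<^sup>2)"
      by (simp add: multiplier_nonneg mult.commute flip: ennreal_mult)
  qed
  finally show ?thesis .
qed

text \<open>This is the Sobolev space of order \<open>s\<close>, see \<open>sobolev_iff_finite_energy\<close>.\<close>
definition finite_energy :: "('a \<Rightarrow> complex) set" where
  "finite_energy = {u \<in> l2 lborel. increment u \<in> l2 G}"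

text \<open>The square of this seminorm is twice the energy.\<close>
definition energy_norm :: "('a \<Rightarrow> complex) \<Rightarrow> real" where
  "energy_norm u = l2_norm G (increment u)"

lemma finite_energyD: "u \<in> finite_energy \<Longrightarrow> u \<in> l2 lborel" "u \<in> finite_energy \<Longrightarrow> increment u \<in> l2 G"
  "u \<in> finite_energy \<Longrightarrow> u \<in> borel_measurable borel"
  by (auto simp: finite_energy_def l2_def)

lemma energy_norm_nonneg [simp]: "0 \<le> energy_norm u"
  by (simp add: energy_norm_def)

lemma nn_energy:
  assumes "u \<in> finite_energy"
  shows "(\<integral>\<^sup>+\<xi>. ennreal (multiplier \<xi> * (cmod (fourier u \<xi>))\<^sup>2) \<partial>lborel) = ennreal ((energy_norm u)\<^sup>2)"
  using gagliardo_fourier[of u] nn_integral_l2[of "increment u" G] assms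
  by (simp add: finite_energy_def energy_norm_def)

text \<open>The Bessel weight is comparable to \<open>1 + |\<xi>|\<^sup>2\<^sup>s\<close>.\<close>
lemma bessel_weight_bounds:
  fixes \<xi> :: 'a
  shows "1 \<le> (1 + (norm \<xi>)\<^sup>2) powr s" "norm \<xi> powr (2 * s) \<le> (1 + (norm \<xi>)\<^sup>2) powr s"
    "(1 + (norm \<xi>)\<^sup>2) powr s \<le> 2 * (1 + norm \<xi> powr (2 * s))"
proof -
  have sq: "norm \<xi> powr (2 * s) = ((norm \<xi>)\<^sup>2) powr s"
    by (cases "\<xi> = 0") (simp_all add: powr_powr flip: powr_numeral)
  show "1 \<le> (1 + (norm \<xi>)\<^sup>2) powr s" using s_pos by (intro ge_one_powr_ge_zero) auto
  show "norm \<xi> powr (2 * s) \<le> (1 + (norm \<xi>)\<^sup>2) powr s"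
    unfolding sq using s_pos by (intro powr_mono2) auto
  define m where "m = max 1 ((norm \<xi>)\<^sup>2)"
  have "(1 + (norm \<xi>)\<^sup>2) powr s \<le> (2 * m) powr s"
    using s_pos by (intro powr_mono2) (auto simp: m_def)
  also have "\<dots> = 2 powr s * m powr s" by (simp add: powr_mult m_def)
  also have "\<dots> \<le> 2 * m powr s"
    using s_less_1 powr_mono[of s 1 2] by (intro mult_right_mono) auto
  also have "m powr s \<le> 1 + norm \<xi> powr (2 * s)"
    unfolding m_def sq max_def by auto
  finally show "(1 + (norm \<xi>)\<^sup>2) powr s \<le> 2 * (1 + norm \<xi> powr (2 * s))" by simp
qed

lemma nn_integral_sobolev:
  assumes "u \<in> sobolev s"
  shows "(\<integral>\<^sup>+\<xi>. ennreal ((1 + (norm \<xi>)\<^sup>2) powr s * (cmod (fourier u \<xi>))\<^sup>2) \<partial>lborel) = ennreal ((sobolev_norm s u)\<^sup>2)"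
proof -
  have "integrable lborel (\<lambda>\<xi>. (1 + (norm \<xi>)\<^sup>2) powr s * (cmod (fourier u \<xi>))\<^sup>2)"
    using assms by (simp add: sobolev_def)
  moreover have "(sobolev_norm s u)\<^sup>2 = (\<integral>\<xi>. (1 + (norm \<xi>)\<^sup>2) powr s * (cmod (fourier u \<xi>))\<^sup>2 \<partial>lborel)"
    unfolding sobolev_norm_def by (intro real_sqrt_pow2 integral_nonneg_AE) auto
  ultimately show ?thesis by (simp add: nn_integral_eq_integral)
qed

lemma sobolev_norm_nonneg [simp]: "0 \<le> sobolev_norm s u"
  unfolding sobolev_norm_def by (intro real_sqrt_ge_zero integral_nonneg_AE) auto

text \<open>This and the next lemma state that the Sobolev norm is equivalent to the sum of the \<open>L\<^sup>2\<close> norm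
  and the energy seminorm.\<close>
lemma sobolev_imp_finite_energy:
  obtains C where "C > 0" "\<And>u. u \<in> sobolev s \<Longrightarrow>
    u \<in> finite_energy \<and> l2_norm lborel u \<le> sobolev_norm s u \<and> energy_norm u \<le> C * sobolev_norm s u"
proof -
  obtain c C where C: "C > 0" "\<And>\<xi>. multiplier \<xi> \<le> C * norm \<xi> powr (2 * s)"
    using multiplier_bounds by metis
  have "u \<in> finite_energy \<and> l2_norm lborel u \<le> sobolev_norm s u \<and> energy_norm u \<le> sqrt C * sobolev_norm s u"
    if us: "u \<in> sobolev s" for u
  proof -
    have u: "u \<in> l2 lborel" using us by (simp add: sobolev_def L2_eq_l2)
    have [measurable]: "u \<in> borel_measurable borel" "fourier u \<in> borel_measurable borel"
      using u fourier_l2(1)[OF u] by (auto simp: l2_def)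
    have "(\<integral>\<^sup>+p. ennreal ((cmod (increment u p))\<^sup>2) \<partial>G) \<le>
      (\<integral>\<^sup>+\<xi>. ennreal C * ennreal ((1 + (norm \<xi>)\<^sup>2) powr s * (cmod (fourier u \<xi>))\<^sup>2) \<partial>lborel)"
      unfolding gagliardo_fourier[OF u]
    proof (rule nn_integral_mono)
      fix \<xi> :: 'a
      have "multiplier \<xi> * (cmod (fourier u \<xi>))\<^sup>2 \<le> (C * (1 + (norm \<xi>)\<^sup>2) powr s) * (cmod (fourier u \<xi>))\<^sup>2"
        using C bessel_weight_bounds(2)[of \<xi>] by (intro mult_right_mono order_trans[OF C(2)] mult_left_mono) auto
      then show "ennreal (multiplier \<xi> * (cmod (fourier u \<xi>))\<^sup>2) \<le>
          ennreal C * ennreal ((1 + (norm \<xi>)\<^sup>2) powr s * (cmod (fourier u \<xi>))\<^sup>2)"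
        using C by (simp add: ennreal_leI mult.assoc flip: ennreal_mult)
    qed
    also have "\<dots> = ennreal C * ennreal ((sobolev_norm s u)\<^sup>2)"
      by (subst nn_integral_cmult) (simp_all add: nn_integral_sobolev[OF us])
    also have "\<dots> = ennreal ((sqrt C * sobolev_norm s u)\<^sup>2)"
      using C by (simp add: power_mult_distrib flip: ennreal_mult)
    finally have E: "increment u \<in> l2 G" "energy_norm u \<le> sqrt C * sobolev_norm s u"
      using C unfolding energy_norm_def by (auto intro!: l2_bounded)
    have "(\<integral>\<^sup>+\<xi>. ennreal ((cmod (fourier u \<xi>))\<^sup>2) \<partial>lborel) \<le>
      (\<integral>\<^sup>+\<xi>. ennreal ((1 + (norm \<xi>)\<^sup>2) powr s * (cmod (fourier u \<xi>))\<^sup>2) \<partial>lborel)"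
    proof (intro nn_integral_mono ennreal_leI)
      fix \<xi> :: 'a
      show "(cmod (fourier u \<xi>))\<^sup>2 \<le> (1 + (norm \<xi>)\<^sup>2) powr s * (cmod (fourier u \<xi>))\<^sup>2"
        using mult_right_mono[OF bessel_weight_bounds(1)[of \<xi>], of "(cmod (fourier u \<xi>))\<^sup>2"] by simp
    qed
    also have "\<dots> = ennreal ((sobolev_norm s u)\<^sup>2)" by (rule nn_integral_sobolev[OF us])
    finally have "l2_norm lborel (fourier u) \<le> sobolev_norm s u"
      by (intro l2_bounded) auto
    then show ?thesis using u E by (simp add: plancherel finite_energy_def)
  qed
  then show ?thesis using that[of "sqrt C"] C by auto
qed

lemma finite_energy_imp_sobolev:
  obtains C where "C > 0" "\<And>u. u \<in> finite_energy \<Longrightarrow>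
    u \<in> sobolev s \<and> sobolev_norm s u \<le> C * (l2_norm lborel u + energy_norm u)"
proof -
  obtain c C where c: "c > 0" "\<And>\<xi>. c * norm \<xi> powr (2 * s) \<le> multiplier \<xi>"
    using multiplier_bounds by metis
  define D where "D = 2 + 2 / c"
  have D: "D > 0" using c by (simp add: D_def add_pos_pos)
  have "u \<in> sobolev s \<and> sobolev_norm s u \<le> sqrt D * (l2_norm lborel u + energy_norm u)"
    if us: "u \<in> finite_energy" for u
  proof -
    have u: "u \<in> l2 lborel" using us by (simp add: finite_energy_def)
    have [measurable]: "u \<in> borel_measurable borel" "fourier u \<in> borel_measurable borel"
      using u fourier_l2(1)[OF u] by (auto simp: l2_def)
    have le: "(1 + (norm \<xi>)\<^sup>2) powr s * (cmod (fourier u \<xi>))\<^sup>2 \<le>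
        D * (cmod (fourier u \<xi>))\<^sup>2 + D * (multiplier \<xi> * (cmod (fourier u \<xi>))\<^sup>2)" for \<xi>
    proof -
      have "norm \<xi> powr (2 * s) \<le> multiplier \<xi> / c" using c(2)[of \<xi>] c(1) by (simp add: field_simps)
      then have "(1 + (norm \<xi>)\<^sup>2) powr s \<le> 2 + (2 / c) * multiplier \<xi>"
        using bessel_weight_bounds(3)[of \<xi>] by simp
      also have "\<dots> \<le> D + D * multiplier \<xi>"
        using c(1) multiplier_nonneg[of \<xi>] by (intro add_mono mult_right_mono) (auto simp: D_def)
      finally have "(1 + (norm \<xi>)\<^sup>2) powr s * (cmod (fourier u \<xi>))\<^sup>2 \<le> (D + D * multiplier \<xi>) * (cmod (fourier u \<xi>))\<^sup>2"
        by (rule mult_right_mono) simp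
      then show ?thesis by (simp add: algebra_simps)
    qed
    have "(\<integral>\<^sup>+\<xi>. ennreal ((1 + (norm \<xi>)\<^sup>2) powr s * (cmod (fourier u \<xi>))\<^sup>2) \<partial>lborel) \<le>
      (\<integral>\<^sup>+\<xi>. ennreal D * ennreal ((cmod (fourier u \<xi>))\<^sup>2) +
         ennreal D * ennreal (multiplier \<xi> * (cmod (fourier u \<xi>))\<^sup>2) \<partial>lborel)"
      using D multiplier_nonneg
      by (intro nn_integral_mono) (simp add: ennreal_leI[OF le] flip: ennreal_mult ennreal_plus)
    also have "\<dots> = ennreal D * ennreal ((l2_norm lborel u)\<^sup>2) + ennreal D * ennreal ((energy_norm u)\<^sup>2)"
      using nn_integral_l2[OF fourier_l2(1)[OF u]] nn_energy[OF us]
      by (subst nn_integral_add) (simp_all add: nn_integral_cmult plancherel[OF u])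
    also have "\<dots> = ennreal (D * ((l2_norm lborel u)\<^sup>2 + (energy_norm u)\<^sup>2))"
      using D by (simp add: distrib_left flip: ennreal_mult ennreal_plus)
    finally have nn: "(\<integral>\<^sup>+\<xi>. ennreal ((1 + (norm \<xi>)\<^sup>2) powr s * (cmod (fourier u \<xi>))\<^sup>2) \<partial>lborel) \<le>
      ennreal (D * ((l2_norm lborel u)\<^sup>2 + (energy_norm u)\<^sup>2))" .
    have "integrable lborel (\<lambda>\<xi>. (1 + (norm \<xi>)\<^sup>2) powr s * (cmod (fourier u \<xi>))\<^sup>2)"
      by (intro integrableI_bounded) (use le_less_trans[OF nn] in auto)
    then have S: "u \<in> sobolev s" using u by (simp add: sobolev_def L2_eq_l2)
    have "(sobolev_norm s u)\<^sup>2 \<le> D * ((l2_norm lborel u)\<^sup>2 + (energy_norm u)\<^sup>2)"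
      using nn D unfolding nn_integral_sobolev[OF S] by (subst (asm) ennreal_le_iff) auto
    also have "\<dots> \<le> (sqrt D * (l2_norm lborel u + energy_norm u))\<^sup>2"
      using D by (simp add: power_mult_distrib power2_sum)
    finally have "sobolev_norm s u \<le> sqrt D * (l2_norm lborel u + energy_norm u)"
      by (rule power2_le_imp_le) (use D in auto)
    then show ?thesis using S by simp
  qed
  then show ?thesis using that[of "sqrt D"] D by auto
qed

end

section \<open>Test functions\<close>

lemma Ck_on_UNIV_SucI:
  assumes "\<And>x. (f has_derivative f' x) (at x)" "\<And>v. Ck_on k UNIV (\<lambda>x. f' x v)"
  shows "Ck_on (Suc k) UNIV f"
proof -
  have "frechet_derivative f (at x) = f' x" for x
    using frechet_derivative_at[OF assms(1)[of x]] by simp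
  then show ?thesis using assms by (auto simp: differentiable_def)
qed

lemma Ck_on_UNIV_SucD:
  assumes "Ck_on (Suc k) UNIV f"
  shows "(f has_derivative frechet_derivative f (at x)) (at x)"
    "Ck_on k UNIV (\<lambda>x. frechet_derivative f (at x) v)"
  using assms frechet_derivative_works by auto

lemma Ck_on_UNIV_decr: "Ck_on (Suc k) UNIV f \<Longrightarrow> Ck_on k UNIV f"
proof (induction k arbitrary: f)
  case 0
  then show ?case by (auto intro!: differentiable_imp_continuous_on simp: differentiable_on_def)
next
  case (Suc k)
  show ?case
    using Ck_on_UNIV_SucD[OF Suc.prems] Suc.IH by (intro Ck_on_UNIV_SucI) auto
qed

lemma Ck_on_UNIV_const: "Ck_on k UNIV (\<lambda>x. c)"
proof (induction k arbitrary: c)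
  case (Suc k)
  show ?case by (rule Ck_on_UNIV_SucI[OF has_derivative_const]) (rule Suc)
qed simp

lemma Ck_on_UNIV_add:
  "Ck_on k UNIV f \<Longrightarrow> Ck_on k UNIV g \<Longrightarrow> Ck_on k UNIV (\<lambda>x. f x + g x)"
proof (induction k arbitrary: f g)
  case (Suc k)
  note f = Ck_on_UNIV_SucD[OF Suc.prems(1)] and g = Ck_on_UNIV_SucD[OF Suc.prems(2)]
  show ?case
    by (rule Ck_on_UNIV_SucI[OF has_derivative_add[OF f(1) g(1)]]) (rule Suc.IH[OF f(2) g(2)])
qed (auto intro: continuous_intros)

lemma Ck_on_UNIV_mult:
  fixes f g :: "'a::real_normed_vector \<Rightarrow> 'b::real_normed_algebra"
  shows "Ck_on k UNIV f \<Longrightarrow> Ck_on k UNIV g \<Longrightarrow> Ck_on k UNIV (\<lambda>x. f x * g x)"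
proof (induction k arbitrary: f g)
  case (Suc k)
  note f = Ck_on_UNIV_SucD[OF Suc.prems(1)] and g = Ck_on_UNIV_SucD[OF Suc.prems(2)]
  show ?case
    by (rule Ck_on_UNIV_SucI[OF has_derivative_mult[OF f(1) g(1)]])
       (intro Ck_on_UNIV_add Suc.IH f g Ck_on_UNIV_decr[OF Suc.prems(1)] Ck_on_UNIV_decr[OF Suc.prems(2)])
qed (auto intro: continuous_intros)

lemma test_functions_add:
  assumes "\<phi> \<in> test_functions U" "\<psi> \<in> test_functions U"
  shows "(\<lambda>x. \<phi> x + \<psi> x) \<in> test_functions U"
proof -
  let ?A = "closure {x. \<phi> x \<noteq> 0}" and ?B = "closure {x. \<psi> x \<noteq> 0}"
  have sub: "closure {x. \<phi> x + \<psi> x \<noteq> 0} \<subseteq> ?A \<union> ?B"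
    unfolding closure_Un[symmetric] by (rule closure_mono) auto
  moreover have "compact (?A \<union> ?B)" using assms by (auto simp: test_functions_def intro: compact_Un)
  ultimately have "compact (closure {x. \<phi> x + \<psi> x \<noteq> 0})"
    using compact_Int_closed[of "?A \<union> ?B" "closure {x. \<phi> x + \<psi> x \<noteq> 0}"] by (simp add: Int_absorb1)
  then show ?thesis
    using assms sub by (auto simp: test_functions_def smooth_on_def intro: Ck_on_UNIV_add)
qed

lemma test_functions_scale:
  assumes "\<phi> \<in> test_functions U"
  shows "(\<lambda>x. c * \<phi> x) \<in> test_functions U"
proof -
  have sub: "closure {x. c * \<phi> x \<noteq> 0} \<subseteq> closure {x. \<phi> x \<noteq> 0}"
    by (rule closure_mono) auto
  then have "compact (closure {x. c * \<phi> x \<noteq> 0})"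
    using compact_Int_closed[of "closure {x. \<phi> x \<noteq> 0}" "closure {x. c * \<phi> x \<noteq> 0}"] assms
    by (simp add: Int_absorb1 test_functions_def)
  then show ?thesis
    using assms sub by (auto simp: test_functions_def smooth_on_def intro: Ck_on_UNIV_mult Ck_on_UNIV_const)
qed

lemma test_functions_diff:
  "\<phi> \<in> test_functions U \<Longrightarrow> \<psi> \<in> test_functions U \<Longrightarrow> (\<lambda>x. \<phi> x - \<psi> x) \<in> test_functions U"
  using test_functions_add[of \<phi> U "\<lambda>x. (-1) * \<psi> x"] test_functions_scale[of \<psi> U "-1"] by simp

lemma test_functions_zero: "(\<lambda>x. 0) \<in> test_functions U"
  by (simp add: test_functions_def smooth_on_def Ck_on_UNIV_const)

lemma test_functions_mono: "U \<subseteq> V \<Longrightarrow> test_functions U \<subseteq> test_functions V"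
  by (auto simp: test_functions_def)

lemma test_function_outside: "\<phi> \<in> test_functions U \<Longrightarrow> x \<notin> U \<Longrightarrow> \<phi> x = 0"
  using closure_subset[of "{x. \<phi> x \<noteq> 0}"] by (auto simp: test_functions_def)

text \<open>If \<open>|z| \<le> 1\<close> and one of the points \<open>x\<close>, \<open>x + z\<close> lies in the ball of radius \<open>R\<close>, then both
  lie in the ball of radius \<open>R + 1\<close>, on which the derivative is bounded.\<close>
lemma test_function_bounds:
  fixes \<phi> :: "'a::euclidean_space \<Rightarrow> complex"
  assumes "\<phi> \<in> test_functions U"
  obtains B R where "B \<ge> 0" "R \<ge> 0" "continuous_on UNIV \<phi>" "\<forall>x. cmod (\<phi> x) \<le> B"
    "\<forall>x. norm x > R \<longrightarrow> \<phi> x = 0"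
    "\<forall>x z. norm z \<le> 1 \<longrightarrow> norm x \<le> R \<or> norm (x + z) \<le> R \<longrightarrow> cmod (\<phi> (x + z) - \<phi> x) \<le> B * norm z"
proof -
  let ?S = "closure {x. \<phi> x \<noteq> 0}"
  have C1: "Ck_on 1 UNIV \<phi>" and cS: "compact ?S" using assms by (auto simp: test_functions_def smooth_on_def)
  then have cont: "continuous_on UNIV \<phi>" using Ck_on_UNIV_decr[of 0 \<phi>] by simp
  obtain R where R: "\<And>x. x \<in> ?S \<Longrightarrow> norm x \<le> R"
    using compact_imp_bounded[OF cS] unfolding bounded_iff by blast
  define R' where "R' = max R 0"
  have out: "\<phi> x = 0" if "norm x > R'" for x
    using R[of x] closure_subset[of "{x. \<phi> x \<noteq> 0}"] that by (auto simp: R'_def)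
  have bounded_on: "\<exists>B. \<forall>x\<in>cball 0 (R' + 1). norm (f x) \<le> B"
    if "continuous_on UNIV f" for f :: "'a \<Rightarrow> complex"
  proof -
    have "compact (f ` cball 0 (R' + 1))"
      using that by (intro compact_continuous_image continuous_on_subset[OF that]) auto
    from compact_imp_bounded[OF this] show ?thesis by (simp only: bounded_iff ball_simps)
  qed
  obtain B0 where B0: "\<And>x. x \<in> cball 0 (R' + 1) \<Longrightarrow> norm (\<phi> x) \<le> B0"
    using bounded_on[OF cont] by (elim exE bexE) blast
  have "\<exists>B. \<forall>b. \<forall>x\<in>cball 0 (R' + 1). norm (frechet_derivative \<phi> (at x) b) \<le> B b"
  proof (intro choice allI bounded_on)
    show "continuous_on UNIV (\<lambda>x. frechet_derivative \<phi> (at x) b)" for b using C1 by simp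
  qed
  then obtain B1 where B1: "\<And>b x. x \<in> cball 0 (R' + 1) \<Longrightarrow> norm (frechet_derivative \<phi> (at x) b) \<le> B1 b"
    by blast
  define L where "L = (\<Sum>b\<in>Basis. B1 b)"
  have der: "(\<phi> has_derivative frechet_derivative \<phi> (at x)) (at x)" for x
    using Ck_on_UNIV_SucD[of 0 \<phi>] C1 by simp
  have on: "onorm (frechet_derivative \<phi> (at x)) \<le> L" if "x \<in> cball 0 (R' + 1)" for x
  proof (rule onorm_bound)
    interpret D: bounded_linear "frechet_derivative \<phi> (at x)" using der has_derivative_bounded_linear by blast
    show "0 \<le> L" unfolding L_def by (rule sum_nonneg) (rule order_trans[OF norm_ge_zero B1[OF that]])
    fix v
    have "norm (frechet_derivative \<phi> (at x) v) = norm (\<Sum>b\<in>Basis. (v \<bullet> b) *\<^sub>R frechet_derivative \<phi> (at x) b)"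
      by (subst (1) euclidean_representation[of v, symmetric]) (simp only: D.sum D.scaleR)
    also have "\<dots> \<le> (\<Sum>b\<in>Basis. norm v * B1 b)"
      by (intro order_trans[OF norm_sum] sum_mono) (auto intro!: mult_mono B1 that Basis_le_norm)
    finally show "norm (frechet_derivative \<phi> (at x) v) \<le> L * norm v"
      by (simp add: L_def sum_distrib_left mult.commute[of _ "norm v"])
  qed
  define B where "B = max (max B0 L) 0"
  show ?thesis
  proof (intro that allI impI)
    show "B \<ge> 0" "R' \<ge> 0" by (auto simp: B_def R'_def)
    show "continuous_on UNIV \<phi>" by (rule cont)
    show "cmod (\<phi> x) \<le> B" for x
      using B0[of x] out[of x] by (cases "norm x > R'") (auto simp: B_def)
    show "\<phi> x = 0" if "norm x > R'" for x by (rule out[OF that])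
    show "cmod (\<phi> (x + z) - \<phi> x) \<le> B * norm z" if "norm z \<le> 1" "norm x \<le> R' \<or> norm (x + z) \<le> R'" for x z
    proof -
      have xz: "x \<in> cball 0 (R' + 1)" "x + z \<in> cball 0 (R' + 1)"
        using that norm_triangle_ineq[of x z] norm_triangle_ineq4[of "x + z" z] by auto
      have "norm (\<phi> (x + z) - \<phi> x) \<le> L * norm (x + z - x)"
        by (rule differentiable_bound[OF convex_cball has_derivative_at_withinI[OF der] on xz(2,1)])
      also have "\<dots> \<le> B * norm z" by (auto simp: B_def intro!: mult_right_mono)
      finally show ?thesis .
    qed
  qed
qed

text \<open>The derivatives of \<open>exp (- 1 / t)\<close>, extended by zero to \<open>t \<le> 0\<close>, are linear combinations of
  these functions.\<close>
definition flat :: "nat \<Rightarrow> real \<Rightarrow> real" where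
  "flat m t = (if t > 0 then exp (- (1 / t)) / t ^ m else 0)"

lemma power_le_fact_exp: "x \<ge> 0 \<Longrightarrow> x ^ n \<le> fact n * exp (x::real)"
proof -
  assume x: "x \<ge> 0"
  have "(\<Sum>k\<in>{n}. x ^ k /\<^sub>R fact k) \<le> (\<Sum>k. x ^ k /\<^sub>R fact k)"
    using x by (intro sum_le_suminf summable_exp_generic) auto
  then show ?thesis by (simp add: exp_def field_simps)
qed

text \<open>Two extra powers of \<open>t\<close> are kept in order to obtain derivative zero at the origin.\<close>
lemma flat_bound: "\<bar>flat m t\<bar> \<le> fact (m + 2) * t\<^sup>2"
proof (cases "t > 0")
  case True
  have "(1 / t) ^ (m + 2) \<le> fact (m + 2) * exp (1 / t)"
    by (rule power_le_fact_exp) (use True in simp)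
  then have "exp (- (1 / t)) * (1 / t) ^ (m + 2) \<le> exp (- (1 / t)) * (fact (m + 2) * exp (1 / t))"
    by (intro mult_left_mono) auto
  also have "\<dots> = fact (m + 2)" by (simp add: exp_minus)
  finally have "exp (- (1 / t)) * (1 / t) ^ (m + 2) * t\<^sup>2 \<le> fact (m + 2) * t\<^sup>2"
    by (rule mult_right_mono) simp
  moreover have "exp (- (1 / t)) * (1 / t) ^ (m + 2) * t\<^sup>2 = flat m t"
    using True by (simp add: flat_def power_add power_one_over power2_eq_square field_simps)
  ultimately show ?thesis using True by (simp add: flat_def)
qed (simp add: flat_def)

lemma flat_derivative:
  "(flat m has_real_derivative (flat (m + 2) t - real m * flat (m + 1) t)) (at t)"
proof -
  consider "t > 0" | "t = 0" | "t < 0" by linarith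
  then show ?thesis
  proof cases
    case 1
    have flat: "flat k t = exp (- (1 / t)) * t powr (- real k)" if "t > 0" for k t
      using that by (simp add: flat_def powr_minus powr_realpow divide_inverse)
    have "((\<lambda>t. exp (- (1 / t))) has_real_derivative exp (- (1 / t)) * (1 / t\<^sup>2)) (at t)"
      using 1 by (auto intro!: derivative_eq_intros simp: power2_eq_square)
    from DERIV_mult[OF this has_real_derivative_powr[OF 1, of "- real m"]]
    have "((\<lambda>t. exp (- (1 / t)) * t powr (- real m)) has_real_derivative
        (exp (- (1 / t)) * (1 / t\<^sup>2) * t powr (- real m) + - real m * t powr (- real m - 1) * exp (- (1 / t)))) (at t)" .
    also have "exp (- (1 / t)) * (1 / t\<^sup>2) * t powr (- real m) + - real m * t powr (- real m - 1) * exp (- (1 / t)) =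
        flat (m + 2) t - real m * flat (m + 1) t"
    proof -
      have e: "- real (m + 2) = - real m - 2" "- real (m + 1) = - real m - 1" by simp_all
      have "t powr (- real m - 2) = 1 / t\<^sup>2 * t powr (- real m)"
        using 1 powr_diff[of t "- real m" 2] by simp
      then show ?thesis unfolding flat[OF 1] e by (simp only: algebra_simps)
    qed
    finally have "((\<lambda>t. exp (- (1 / t)) * t powr (- real m)) has_real_derivative
        (flat (m + 2) t - real m * flat (m + 1) t)) (at t)" .
    then show ?thesis
    proof (rule has_field_derivative_transform_within_open)
      show "open {0::real<..}" by simp
      show "t \<in> {0<..}" using 1 by simp
      show "exp (- (1 / x)) * x powr (- real m) = flat m x" if "x \<in> {0<..}" for x
        using flat[of x m] that by simp
    qed
  next
    case 2
    have "((\<lambda>h. (flat m (0 + h) - flat m 0) / h) \<longlongrightarrow> 0) (at 0)"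
    proof (rule Lim_null_comparison)
      have "norm (flat m h / h) \<le> fact (m + 2) * \<bar>h\<bar>" if "h \<noteq> 0" for h
      proof -
        have "norm (flat m h / h) = \<bar>flat m h\<bar> / \<bar>h\<bar>" by simp
        also have "\<dots> \<le> (fact (m + 2) * h\<^sup>2) / \<bar>h\<bar>" by (intro divide_right_mono flat_bound) simp
        also have "\<dots> = fact (m + 2) * \<bar>h\<bar>"
          using that by (auto simp: power2_eq_square abs_if)
        finally show ?thesis .
      qed
      then show "\<forall>\<^sub>F h in at 0. norm ((flat m (0 + h) - flat m 0) / h) \<le> fact (m + 2) * \<bar>h\<bar>"
        by (auto simp: eventually_at_filter flat_def[of _ 0])
      have "((\<lambda>h::real. fact (m + 2) * \<bar>h\<bar>) \<longlongrightarrow> fact (m + 2) * \<bar>0\<bar>) (at 0)"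
        by (intro tendsto_intros)
      then show "((\<lambda>h::real. fact (m + 2) * \<bar>h\<bar>) \<longlongrightarrow> 0) (at 0)" by simp
    qed
    then show ?thesis unfolding 2 DERIV_def by (simp add: flat_def)
  next
    case 3
    have "((\<lambda>t. 0) has_real_derivative (flat (m + 2) t - real m * flat (m + 1) t)) (at t)"
      using 3 by (simp add: flat_def)
    then show ?thesis
    proof (rule has_field_derivative_transform_within_open)
      show "open {..<0::real}" by simp
    qed (use 3 in \<open>auto simp: flat_def\<close>)
  qed
qed

definition bump :: "'a::euclidean_space \<Rightarrow> real \<Rightarrow> nat \<Rightarrow> 'a \<Rightarrow> real" where
  "bump c r m x = flat m (r\<^sup>2 - (x - c) \<bullet> (x - c))"

lemma Ck_on_bump: "Ck_on k UNIV (\<lambda>x. complex_of_real (bump c r m x))"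
proof (induction k arbitrary: m)
  have der: "((\<lambda>x. complex_of_real (bump c r m x)) has_derivative
     (\<lambda>v. (of_real (bump c r (m + 2) x) + of_real (- real m) * of_real (bump c r (m + 1) x)) *
       of_real (- 2 * ((x - c) \<bullet> v)))) (at x)" for m x
  proof -
    have "((\<lambda>x. r\<^sup>2 - (x - c) \<bullet> (x - c)) has_derivative (\<lambda>v. - 2 * ((x - c) \<bullet> v))) (at x)"
      by (auto intro!: derivative_eq_intros simp: inner_commute)
    from DERIV_compose_FDERIV[OF flat_derivative this]
    have "(bump c r m has_derivative (\<lambda>v. - 2 * ((x - c) \<bullet> v) * (bump c r (m + 2) x - real m * bump c r (m + 1) x))) (at x)"
      by (simp only: bump_def[abs_def])
    from has_derivative_of_real[OF this] show ?thesis
      by (rule has_derivative_eq_rhs) (simp add: mult.commute)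
  qed
  have aff: "Ck_on k UNIV (\<lambda>x. complex_of_real (- 2 * ((x - c) \<bullet> v)))" for k v
  proof (cases k)
    case 0 then show ?thesis by (auto intro!: continuous_intros)
  next
    case (Suc j)
    have "((\<lambda>x. complex_of_real (- 2 * ((x - c) \<bullet> v))) has_derivative (\<lambda>w. of_real (- 2 * (w \<bullet> v)))) (at x)" for x
      by (intro has_derivative_of_real) (auto intro!: derivative_eq_intros)
    then show ?thesis unfolding Suc by (rule Ck_on_UNIV_SucI) (rule Ck_on_UNIV_const)
  qed
  {
    case 0
    show ?case unfolding Ck_on.simps
      by (rule continuous_at_imp_continuous_on) (intro ballI has_derivative_continuous[OF der])
  next
    case (Suc k)
    show ?case
      by (rule Ck_on_UNIV_SucI[OF der]) (intro Ck_on_UNIV_mult Ck_on_UNIV_add Ck_on_UNIV_const Suc aff)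
  }
qed

lemma bump_nonneg: "0 \<le> bump c r m x"
  by (simp add: bump_def flat_def)

lemma bump_pos_iff: "r > 0 \<Longrightarrow> bump c r m x > 0 \<longleftrightarrow> x \<in> ball c r"
proof -
  assume "r > 0"
  have "(x - c) \<bullet> (x - c) < r\<^sup>2 \<longleftrightarrow> norm (x - c) < r"
    unfolding power2_norm_eq_inner[symmetric] using \<open>r > 0\<close>
    by (auto intro: power2_less_imp_less power_strict_mono)
  then show ?thesis by (auto simp: bump_def flat_def dist_norm norm_minus_commute)
qed

lemma bump_test_function:
  assumes "r > 0" "cball c r \<subseteq> U"
  shows "(\<lambda>x. complex_of_real (bump c r m x)) \<in> test_functions U"
proof -
  have "{x. complex_of_real (bump c r m x) \<noteq> 0} = ball c r"
    using bump_pos_iff[OF assms(1), of c m] bump_nonneg[of c r m] by (auto simp: less_le)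
  then show ?thesis using assms Ck_on_bump[of _ c r m] by (simp add: test_functions_def smooth_on_def)
qed

context angular_density
begin

text \<open>For a shift \<open>z\<close> the increment is at most a multiple of \<open>min 1 |z|\<close> and vanishes unless one of
  the two points lies in the support, so its squared norm is at most a multiple of
  \<open>min 1 |z|\<^sup>2\<close>, which the kernel integrates.\<close>
lemma test_function_finite_energy:
  assumes "\<phi> \<in> test_functions U"
  shows "\<phi> \<in> finite_energy"
proof -
  obtain B R where B: "B \<ge> 0" "R \<ge> 0" "continuous_on UNIV \<phi>" "\<forall>x. cmod (\<phi> x) \<le> B"
    "\<forall>x. norm x > R \<longrightarrow> \<phi> x = 0"
    "\<forall>x z. norm z \<le> 1 \<longrightarrow> norm x \<le> R \<or> norm (x + z) \<le> R \<longrightarrow> cmod (\<phi> (x + z) - \<phi> x) \<le> B * norm z"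
    by (rule test_function_bounds[OF assms]) (rule that)
  have [measurable]: "\<phi> \<in> borel_measurable borel" by (rule borel_measurable_continuous_onI) (rule B)
  let ?c = "cball (0::'a) R"
  have fin: "emeasure lborel ?c < \<infinity>" by (rule emeasure_lborel_cball_finite)
  have "(\<integral>\<^sup>+x. ennreal ((cmod (\<phi> x))\<^sup>2) \<partial>lborel) \<le> (\<integral>\<^sup>+x. ennreal (B\<^sup>2) * indicator ?c x \<partial>lborel)"
  proof (rule nn_integral_mono)
    fix x
    show "ennreal ((cmod (\<phi> x))\<^sup>2) \<le> ennreal (B\<^sup>2) * indicator ?c x"
      using B(4)[rule_format, of x] B(5)[rule_format, of x] by (cases "norm x \<le> R") (auto intro!: ennreal_leI power_mono)
  qed
  also have "\<dots> < \<infinity>" using fin by (simp add: nn_integral_cmult_indicator ennreal_mult_less_top)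
  finally have l2: "\<phi> \<in> l2 lborel" by (intro l2_finite) auto
  have diff: "(cmod (\<phi> (y + z) - \<phi> y))\<^sup>2 \<le> 4 * B\<^sup>2 * min 1 ((norm z)\<^sup>2) * (indicator ?c y + indicator ?c (y + z))" for y z
  proof (cases "norm y \<le> R \<or> norm (y + z) \<le> R")
    case True
    then have ind: "(1::real) \<le> indicator ?c y + indicator ?c (y + z)" by (auto simp: indicator_def)
    have "(cmod (\<phi> (y + z) - \<phi> y))\<^sup>2 \<le> (2 * B * min 1 (norm z))\<^sup>2"
    proof (rule power_mono)
      have "cmod (\<phi> (y + z) - \<phi> y) \<le> 2 * B"
        using norm_triangle_ineq4[of "\<phi> (y + z)" "\<phi> y"] B(4)[rule_format, of y] B(4)[rule_format, of "y + z"] by linarith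
      moreover have "cmod (\<phi> (y + z) - \<phi> y) \<le> 2 * B * norm z" if "norm z \<le> 1"
      proof -
        have "0 \<le> B * norm z" using B(1) by simp
        then show ?thesis using B(6)[rule_format, OF that True] by linarith
      qed
      ultimately show "cmod (\<phi> (y + z) - \<phi> y) \<le> 2 * B * min 1 (norm z)"
        unfolding min_def by (cases "norm z \<le> 1") simp_all
    qed simp
    also have "\<dots> = 4 * B\<^sup>2 * min 1 ((norm z)\<^sup>2)"
    proof -
      have "(min 1 (norm z))\<^sup>2 = min 1 ((norm z)\<^sup>2)"
      proof (cases "norm z \<le> 1")
        case True
        then have "(norm z)\<^sup>2 \<le> 1" by (simp add: power_le_one)
        then show ?thesis using True by (simp only: min_absorb2)
      next
        case False
        then have "1 \<le> (norm z)\<^sup>2" by (intro one_le_power) simp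
        then show ?thesis using False by (simp only: min_absorb1 not_le less_imp_le power_one)
      qed
      then show ?thesis by (simp only: power_mult_distrib) simp
    qed
    also have "\<dots> \<le> 4 * B\<^sup>2 * min 1 ((norm z)\<^sup>2) * (indicator ?c y + indicator ?c (y + z))"
      by (rule mult_left_mono[OF ind, of "4 * B\<^sup>2 * min 1 ((norm z)\<^sup>2)", unfolded mult_1_right]) simp
    finally show ?thesis .
  next
    case False
    then have "\<phi> y = 0" "\<phi> (y + z) = 0" using B(5) by auto
    then show ?thesis by simp
  qed
  have [measurable]: "(indicator (cball x r) :: 'a \<Rightarrow> ennreal) \<in> borel_measurable borel" for x r
    by (rule borel_measurable_indicator) (simp add: borel_closed)
  have inner: "(\<integral>\<^sup>+y. ennreal ((cmod (\<phi> (y + z) - \<phi> y))\<^sup>2) \<partial>lborel) \<le>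
      ennreal (4 * B\<^sup>2 * min 1 ((norm z)\<^sup>2)) * (2 * emeasure lborel ?c)" for z
  proof -
    have "(\<integral>\<^sup>+y. ennreal ((cmod (\<phi> (y + z) - \<phi> y))\<^sup>2) \<partial>lborel) \<le>
        (\<integral>\<^sup>+y. ennreal (4 * B\<^sup>2 * min 1 ((norm z)\<^sup>2)) * (indicator ?c y + indicator ?c (y + z)) \<partial>lborel)"
    proof (rule nn_integral_mono)
      fix y
      have "ennreal ((cmod (\<phi> (y + z) - \<phi> y))\<^sup>2) \<le>
          ennreal (4 * B\<^sup>2 * min 1 ((norm z)\<^sup>2) * (indicator ?c y + indicator ?c (y + z)))"
        by (rule ennreal_leI[OF diff])
      also have "\<dots> = ennreal (4 * B\<^sup>2 * min 1 ((norm z)\<^sup>2)) * ennreal (indicator ?c y + indicator ?c (y + z))"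
        by (rule ennreal_mult) simp_all
      also have "ennreal (indicator ?c y + indicator ?c (y + z)) = indicator ?c y + indicator ?c (y + z)"
        by (simp only: ennreal_plus indicator_pos_le ennreal_indicator)
      finally show "ennreal ((cmod (\<phi> (y + z) - \<phi> y))\<^sup>2) \<le>
          ennreal (4 * B\<^sup>2 * min 1 ((norm z)\<^sup>2)) * (indicator ?c y + indicator ?c (y + z))" .
    qed
    also have "\<dots> = (\<integral>\<^sup>+y. ennreal (4 * B\<^sup>2 * min 1 ((norm z)\<^sup>2)) * (indicator ?c y + indicator (cball (- z) R) y) \<partial>lborel)"
    proof -
      have "(indicator ?c (y + z) :: ennreal) = indicator (cball (- z) R) y" for y
      proof -
        have "dist (- z) y = norm (y + z)"
          unfolding dist_norm by (subst norm_minus_cancel[symmetric]) (simp add: add.commute)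
        then show ?thesis by (simp add: indicator_def)
      qed
      then show ?thesis by simp
    qed
    also have "\<dots> = ennreal (4 * B\<^sup>2 * min 1 ((norm z)\<^sup>2)) *
        (\<integral>\<^sup>+y. indicator ?c y + indicator (cball (- z) R) y \<partial>lborel)"
    proof (rule nn_integral_cmult)
      show "(\<lambda>y. indicator ?c y + indicator (cball (- z) R) y :: ennreal) \<in> borel_measurable lborel" by measurable
    qed
    also have "(\<integral>\<^sup>+y. indicator ?c y + indicator (cball (- z) R) y \<partial>lborel) =
        emeasure lborel ?c + emeasure lborel (cball (- z) R)"
      by (subst nn_integral_add) simp_all
    also have "emeasure lborel (cball (- z) R) = emeasure lborel ?c"
      using B(2) by (simp only: emeasure_cball)
    finally show ?thesis by (simp add: mult_2)
  qed
  have "(\<integral>\<^sup>+p. ennreal ((cmod (increment \<phi> p))\<^sup>2) \<partial>G) =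
      (\<integral>\<^sup>+z. ennreal (K z) * (\<integral>\<^sup>+y. ennreal ((cmod (\<phi> (y + z) - \<phi> y))\<^sup>2) \<partial>lborel) \<partial>lborel)"
    by (subst nn_integral_G(2)) (simp_all add: increment_def)
  also have "\<dots> \<le> (\<integral>\<^sup>+z. (ennreal (4 * B\<^sup>2) * (2 * emeasure lborel ?c)) * ennreal (min 1 ((norm z)\<^sup>2) * K z) \<partial>lborel)"
  proof (rule nn_integral_mono)
    fix z
    have "ennreal (K z) * (\<integral>\<^sup>+y. ennreal ((cmod (\<phi> (y + z) - \<phi> y))\<^sup>2) \<partial>lborel) \<le>
        ennreal (K z) * (ennreal (4 * B\<^sup>2 * min 1 ((norm z)\<^sup>2)) * (2 * emeasure lborel ?c))"
      by (rule mult_left_mono[OF inner]) simp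
    also have "\<dots> = (ennreal (4 * B\<^sup>2) * (2 * emeasure lborel ?c)) * ennreal (min 1 ((norm z)\<^sup>2) * K z)"
    proof -
      have e: "ennreal (4 * B\<^sup>2 * min 1 ((norm z)\<^sup>2)) = ennreal (4 * B\<^sup>2) * ennreal (min 1 ((norm z)\<^sup>2))"
        "ennreal (min 1 ((norm z)\<^sup>2) * K z) = ennreal (min 1 ((norm z)\<^sup>2)) * ennreal (K z)"
        by (intro ennreal_mult; simp)+
      show ?thesis unfolding e by (simp only: mult_ac)
    qed
    finally show "ennreal (K z) * (\<integral>\<^sup>+y. ennreal ((cmod (\<phi> (y + z) - \<phi> y))\<^sup>2) \<partial>lborel) \<le>
      (ennreal (4 * B\<^sup>2) * (2 * emeasure lborel ?c)) * ennreal (min 1 ((norm z)\<^sup>2) * K z)" .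
  qed
  also have "\<dots> = (ennreal (4 * B\<^sup>2) * (2 * emeasure lborel ?c)) * ennreal (\<integral>z. min 1 ((norm z)\<^sup>2) * K z \<partial>lborel)"
    by (subst nn_integral_cmult) (simp_all add: nn_integral_eq_integral[OF K_integrable])
  also have "\<dots> < \<infinity>" using fin by (simp add: ennreal_mult_less_top)
  finally have "increment \<phi> \<in> l2 G" by (intro l2_finite) simp_all
  then show ?thesis using l2 by (simp add: finite_energy_def)
qed

lemma test_function_sobolev_tilde:
  fixes \<phi> :: "'a \<Rightarrow> complex"
  assumes "\<phi> \<in> test_functions U" shows "\<phi> \<in> sobolev_tilde s U"
proof -
  obtain C where C: "C > 0" "\<And>u. u \<in> finite_energy \<Longrightarrow>
    u \<in> sobolev s \<and> sobolev_norm s u \<le> C * (l2_norm lborel u + energy_norm u)"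
    by (rule finite_energy_imp_sobolev) blast
  have "(\<lambda>x. 0) \<in> finite_energy" by (rule test_function_finite_energy[OF test_functions_zero])
  then have "sobolev_norm s (\<lambda>x::'a. 0) \<le> 0"
    using C(2)[of "\<lambda>x. 0"] by (simp add: energy_norm_def increment_def case_prod_unfold)
  then have "\<exists>\<psi>\<in>test_functions U. sobolev_norm s (\<lambda>x. \<phi> x - \<psi> x) < e" if "e > 0" for e
    using that assms by (intro bexI[of _ \<phi>]) auto
  then show ?thesis
    using C(2)[OF test_function_finite_energy[OF assms]] by (simp add: sobolev_tilde_def)
qed

end

section \<open>Weak solutions\<close>

context angular_density
begin

lemma finite_energy_add: "u \<in> finite_energy \<Longrightarrow> v \<in> finite_energy \<Longrightarrow> (\<lambda>x. u x + v x) \<in> finite_energy"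
  by (simp add: finite_energy_def increment_linear l2_add)

lemma finite_energy_diff: "u \<in> finite_energy \<Longrightarrow> v \<in> finite_energy \<Longrightarrow> (\<lambda>x. u x - v x) \<in> finite_energy"
  by (simp add: finite_energy_def increment_linear l2_diff)

lemma energy_form_inner:
  assumes "u \<in> finite_energy" "v \<in> finite_energy"
  shows "E u v = l2_inner G (increment u) (increment v) / 2"
  by (rule energy_form_eq_inner) (use assms finite_energyD(3) in auto)

lemma energy_form_add_left:
  assumes "u \<in> finite_energy" "v \<in> finite_energy" "w \<in> finite_energy"
  shows "E (\<lambda>x. u x + v x) w = E u w + E v w"
proof -
  note i = integrable_l2_prod(2)[OF finite_energyD(2) finite_energyD(2)]
  show ?thesis
    using i[OF assms(1,3)] i[OF assms(2,3)]
    by (simp add: energy_form_inner finite_energy_add assms increment_linear l2_inner_def distrib_right add_divide_distrib)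
qed

lemma energy_form_diff_right:
  assumes "u \<in> finite_energy" "v \<in> finite_energy" "w \<in> finite_energy"
  shows "E u (\<lambda>x. v x - w x) = E u v - E u w"
  using l2_inner_diff_right[OF finite_energyD(2)[OF assms(1)] finite_energyD(2)[OF assms(2)] finite_energyD(2)[OF assms(3)]]
  by (simp add: energy_form_inner finite_energy_diff assms increment_linear diff_divide_distrib)

lemma energy_form_diff_left:
  assumes "u \<in> finite_energy" "v \<in> finite_energy" "w \<in> finite_energy"
  shows "E (\<lambda>x. u x - v x) w = E u w - E v w"
  using energy_form_add_left[OF finite_energy_diff[OF assms(1,2)] assms(2,3)] by simp

lemma energy_form_bound:
  assumes "u \<in> finite_energy" "v \<in> finite_energy"
  shows "cmod (E u v) \<le> energy_norm u * energy_norm v / 2"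
  using l2_Cauchy_Schwarz[OF finite_energyD(2)[OF assms(1)] finite_energyD(2)[OF assms(2)]]
  by (simp add: energy_form_inner assms energy_norm_def norm_divide)

lemma energy_form_self:
  assumes "u \<in> finite_energy"
  shows "E u u = of_real ((energy_norm u)\<^sup>2 / 2)"
  by (simp add: energy_form_inner assms l2_inner_self energy_norm_def)

lemma energy_norm_minus_commute: "energy_norm (\<lambda>x. u x - v x) = energy_norm (\<lambda>x. v x - u x)"
  unfolding energy_norm_def increment_linear by (rule l2_norm_minus_commute)

lemma sobolev_iff_finite_energy: "u \<in> sobolev s \<longleftrightarrow> u \<in> finite_energy"
proof
  show "u \<in> finite_energy" if "u \<in> sobolev s"
    by (rule sobolev_imp_finite_energy) (use that in blast)
  show "u \<in> sobolev s" if "u \<in> finite_energy"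
    by (rule finite_energy_imp_sobolev) (use that in blast)
qed

lemma sobolev_tilde_finite_energy: "u \<in> sobolev_tilde s U \<Longrightarrow> u \<in> finite_energy"
  by (simp add: sobolev_tilde_def sobolev_iff_finite_energy)

text \<open>Membership in \<open>sobolev_tilde\<close> is used only through this lemma and its converse
  \<open>sobolev_tildeI\<close>, which replace the Sobolev norm by the two seminorms.\<close>
lemma sobolev_tilde_approx:
  assumes u: "u \<in> sobolev_tilde s U"
  obtains \<phi> where "\<And>k::nat. \<phi> k \<in> test_functions U"
    "(\<lambda>k. l2_norm lborel (\<lambda>x. \<phi> k x - u x)) \<longlonglongrightarrow> 0" "(\<lambda>k. energy_norm (\<lambda>x. \<phi> k x - u x)) \<longlonglongrightarrow> 0"
proof -
  obtain C where C: "C > 0" "\<And>u. u \<in> sobolev s \<Longrightarrow>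
    u \<in> finite_energy \<and> l2_norm lborel u \<le> sobolev_norm s u \<and> energy_norm u \<le> C * sobolev_norm s u"
    by (rule sobolev_imp_finite_energy) blast
  have "\<exists>\<psi>\<in>test_functions U. sobolev_norm s (\<lambda>x. u x - \<psi> x) < 1 / real (Suc k)" for k
    using u by (simp add: sobolev_tilde_def)
  then obtain \<phi> where \<phi>: "\<And>k. \<phi> k \<in> test_functions U" "\<And>k. sobolev_norm s (\<lambda>x. u x - \<phi> k x) < 1 / real (Suc k)"
    by metis
  have S: "(\<lambda>x. u x - \<phi> k x) \<in> sobolev s" for k
    unfolding sobolev_iff_finite_energy
    by (intro finite_energy_diff sobolev_tilde_finite_energy[OF u] test_function_finite_energy[OF \<phi>(1)])
  have lim: "(\<lambda>k. 1 / real (Suc k)) \<longlonglongrightarrow> 0" by (rule LIMSEQ_Suc) (rule lim_1_over_n)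
  have "l2_norm lborel (\<lambda>x. \<phi> k x - u x) \<le> 1 / real (Suc k)" for k
    using C(2)[OF S[of k]] \<phi>(2)[of k] by (subst l2_norm_minus_commute) linarith
  then have 1: "(\<lambda>k. l2_norm lborel (\<lambda>x. \<phi> k x - u x)) \<longlonglongrightarrow> 0"
    by (intro Lim_null_comparison[OF _ lim] always_eventually) auto
  have "energy_norm (\<lambda>x. \<phi> k x - u x) \<le> C * (1 / real (Suc k))" for k
    using C(2)[OF S[of k]] mult_left_mono[OF less_imp_le[OF \<phi>(2)[of k]], of C] C(1)
    by (subst energy_norm_minus_commute) linarith
  then have 2: "(\<lambda>k. energy_norm (\<lambda>x. \<phi> k x - u x)) \<longlonglongrightarrow> 0"
    by (intro Lim_null_comparison[OF _ tendsto_mult_right_zero[OF lim, of C]] always_eventually) auto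
  show ?thesis by (rule that[OF \<phi>(1) 1 2])
qed

lemma sobolev_tildeI:
  assumes u: "u \<in> finite_energy" and \<phi>: "\<And>k::nat. \<phi> k \<in> test_functions U"
    and lim: "(\<lambda>k. l2_norm lborel (\<lambda>x. \<phi> k x - u x)) \<longlonglongrightarrow> 0" "(\<lambda>k. energy_norm (\<lambda>x. \<phi> k x - u x)) \<longlonglongrightarrow> 0"
  shows "u \<in> sobolev_tilde s U"
proof -
  obtain C where C: "C > 0" "\<And>u. u \<in> finite_energy \<Longrightarrow>
    u \<in> sobolev s \<and> sobolev_norm s u \<le> C * (l2_norm lborel u + energy_norm u)"
    by (rule finite_energy_imp_sobolev) blast
  have "\<exists>\<psi>\<in>test_functions U. sobolev_norm s (\<lambda>x. u x - \<psi> x) < e" if e: "e > 0" for e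
  proof -
    have "(\<lambda>k. C * (l2_norm lborel (\<lambda>x. \<phi> k x - u x) + energy_norm (\<lambda>x. \<phi> k x - u x))) \<longlonglongrightarrow> C * (0 + 0)"
      by (intro tendsto_intros lim)
    then have "\<forall>\<^sub>F k in sequentially. C * (l2_norm lborel (\<lambda>x. \<phi> k x - u x) + energy_norm (\<lambda>x. \<phi> k x - u x)) < e"
      by (rule order_tendstoD(2)) (use e in simp)
    then obtain k where k: "C * (l2_norm lborel (\<lambda>x. \<phi> k x - u x) + energy_norm (\<lambda>x. \<phi> k x - u x)) < e"
      by (auto simp: eventually_sequentially)
    have "(\<lambda>x. u x - \<phi> k x) \<in> finite_energy"
      by (intro finite_energy_diff u test_function_finite_energy[OF \<phi>])
    from C(2)[OF this] have "sobolev_norm s (\<lambda>x. u x - \<phi> k x) < e"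
      using k by (simp add: l2_norm_minus_commute[of _ u] energy_norm_minus_commute[of u])
    then show ?thesis using \<phi> by blast
  qed
  then show ?thesis using u by (simp add: sobolev_tilde_def sobolev_iff_finite_energy)
qed

text \<open>Two points at distance larger than the diameter of \<open>U\<close> cannot both lie in \<open>U\<close>, so on such
  pairs the increment dominates the function itself, and the kernel gives them positive mass.\<close>
lemma poincare_test_functions:
  assumes "bounded U"
  obtains \<kappa> where "\<kappa> > 0" "\<forall>\<phi>\<in>test_functions U. \<kappa> * l2_norm lborel \<phi> \<le> energy_norm \<phi>"
proof -
  obtain R where R: "\<And>x. x \<in> U \<Longrightarrow> norm x \<le> R"
    using assms unfolding bounded_iff by blast
  define D where "D = 2 * max R 0 + 1"
  have D: "D > 0" by (simp add: D_def)
  define k where "k = (\<integral>\<^sup>+z. ennreal (K z) * indicator (- cball 0 D) z \<partial>lborel)"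
  have "k \<noteq> 0"
  proof
    assume "k = 0"
    then have ae: "AE z in lborel. ennreal (K z) * indicator (- cball 0 D) z = 0"
      unfolding k_def by (subst (asm) nn_integral_0_iff_AE) auto
    obtain \<theta> where \<theta>: "norm \<theta> = 1" "a \<theta> > 0"
      using nontrivial density_nonneg by (force simp: less_le)
    define V where "V = ((- {0}) \<inter> K -` {0<..}) \<inter> (- cball 0 D)"
    have V: "open V" unfolding V_def
      by (intro open_Int continuous_open_preimage[OF K_continuous]) auto
    have "K \<theta> > 0" using \<theta> by (simp add: kernel_def)
    then have "(D + 1) *\<^sub>R \<theta> \<in> V"
      using \<theta> D by (auto simp: V_def K_scale)
    moreover have "AE z in lborel. z \<notin> V"
      using ae by eventually_elim (auto simp: V_def indicator_def split: if_splits)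
    then have "V \<in> null_sets lborel" using V AE_iff_null_sets[of V lborel] by auto
    ultimately show False
      using open_not_negligible[of V] V by (auto simp: negligible_iff_null_sets intro: null_sets_completionI)
  qed
  \<comment> \<open>The minimum makes the constant a real number without knowing that \<open>k\<close> is finite.\<close>
  define c where "c = enn2real (min 1 k)"
  have "min 1 k \<noteq> top" by (auto simp: min_def)
  then have ck: "ennreal c \<le> k" by (simp add: c_def less_top)
  have c: "c > 0" using \<open>k \<noteq> 0\<close> \<open>min 1 k \<noteq> top\<close>
    by (auto simp: c_def enn2real_positive_iff less_top[symmetric] zero_less_iff_neq_zero min_def)
  have "sqrt c * l2_norm lborel \<phi> \<le> energy_norm \<phi>" if \<phi>: "\<phi> \<in> test_functions U" for \<phi>
  proof -
    have fe: "\<phi> \<in> finite_energy" by (rule test_function_finite_energy[OF \<phi>])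
    have [measurable]: "\<phi> \<in> borel_measurable borel" using fe by (rule finite_energyD)
    have "ennreal c * ennreal ((l2_norm lborel \<phi>)\<^sup>2) \<le> k * ennreal ((l2_norm lborel \<phi>)\<^sup>2)"
      by (intro mult_right_mono ck) simp
    also have "\<dots> = (\<integral>\<^sup>+z. (ennreal (K z) * indicator (- cball 0 D) z) * ennreal ((l2_norm lborel \<phi>)\<^sup>2) \<partial>lborel)"
      unfolding k_def by (rule nn_integral_multc[symmetric]) simp
    also have "\<dots> \<le> (\<integral>\<^sup>+z. ennreal (K z) * (\<integral>\<^sup>+y. ennreal ((cmod (\<phi> (y + z) - \<phi> y))\<^sup>2) \<partial>lborel) \<partial>lborel)"
    proof (rule nn_integral_mono)
      fix z
      show "ennreal (K z) * indicator (- cball 0 D) z * ennreal ((l2_norm lborel \<phi>)\<^sup>2)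
         \<le> ennreal (K z) * (\<integral>\<^sup>+y. ennreal ((cmod (\<phi> (y + z) - \<phi> y))\<^sup>2) \<partial>lborel)"
      proof (cases "norm z \<le> D")
        case False
        have "ennreal ((l2_norm lborel \<phi>)\<^sup>2) = (\<integral>\<^sup>+y. ennreal ((cmod (\<phi> y))\<^sup>2) \<partial>lborel)"
          by (rule nn_integral_l2[symmetric]) (rule finite_energyD(1)[OF fe])
        also have "\<dots> \<le> (\<integral>\<^sup>+y. ennreal ((cmod (\<phi> (y + z) - \<phi> y))\<^sup>2) \<partial>lborel)"
        proof (intro nn_integral_mono ennreal_leI)
          fix y
          have "\<phi> y = 0 \<or> \<phi> (y + z) = 0"
          proof (rule ccontr)
            assume "\<not> ?thesis"
            then have "y \<in> U" "y + z \<in> U" using test_function_outside[OF \<phi>] by blast+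
            then have "norm z \<le> 2 * R"
              using R[of y] R[of "y + z"] norm_triangle_ineq4[of "y + z" y] by simp
            then show False using False by (simp add: D_def)
          qed
          then show "(cmod (\<phi> y))\<^sup>2 \<le> (cmod (\<phi> (y + z) - \<phi> y))\<^sup>2" by auto
        qed
        finally show ?thesis using False by (simp add: mult_left_mono)
      qed simp
    qed
    also have "\<dots> = (\<integral>\<^sup>+p. ennreal ((cmod (increment \<phi> p))\<^sup>2) \<partial>G)"
      by (subst nn_integral_G(2)) (simp_all add: increment_def)
    also have "\<dots> = ennreal ((energy_norm \<phi>)\<^sup>2)"
      unfolding energy_norm_def by (rule nn_integral_l2[OF finite_energyD(2)[OF fe]])
    finally have "c * (l2_norm lborel \<phi>)\<^sup>2 \<le> (energy_norm \<phi>)\<^sup>2"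
      using c by (simp flip: ennreal_mult)
    then have "(sqrt c * l2_norm lborel \<phi>)\<^sup>2 \<le> (energy_norm \<phi>)\<^sup>2"
      using c by (simp add: power_mult_distrib)
    then show ?thesis by (rule power2_le_imp_le) simp
  qed
  then show ?thesis using that[of "sqrt c"] c by simp
qed

lemma energy_norm_tendsto:
  assumes "\<And>k. u k \<in> finite_energy" "v \<in> finite_energy" "(\<lambda>k. energy_norm (\<lambda>x. u k x - v x)) \<longlonglongrightarrow> 0"
  shows "(\<lambda>k. energy_norm (u k)) \<longlonglongrightarrow> energy_norm v"
  unfolding energy_norm_def
  by (rule l2_norm_tendsto) (use assms finite_energyD(2) in \<open>auto simp: energy_norm_def increment_linear\<close>)

lemma poincare:
  assumes "bounded U"
  obtains \<kappa> where "\<kappa> > 0" "\<forall>u\<in>sobolev_tilde s U. \<kappa> * l2_norm lborel u \<le> energy_norm u"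
proof -
  obtain \<kappa> where \<kappa>: "\<kappa> > 0" "\<forall>\<phi>\<in>test_functions U. \<kappa> * l2_norm lborel \<phi> \<le> energy_norm \<phi>"
    by (rule poincare_test_functions[OF assms])
  have "\<kappa> * l2_norm lborel u \<le> energy_norm u" if u: "u \<in> sobolev_tilde s U" for u
  proof -
    obtain \<phi> where \<phi>: "\<And>k::nat. \<phi> k \<in> test_functions U"
      "(\<lambda>k. l2_norm lborel (\<lambda>x. \<phi> k x - u x)) \<longlonglongrightarrow> 0" "(\<lambda>k. energy_norm (\<lambda>x. \<phi> k x - u x)) \<longlonglongrightarrow> 0"
      by (rule sobolev_tilde_approx[OF u]) blast
    have fe: "\<phi> k \<in> finite_energy" "u \<in> finite_energy" for k
      by (rule test_function_finite_energy[OF \<phi>(1)], rule sobolev_tilde_finite_energy[OF u])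
    have "(\<lambda>k. \<kappa> * l2_norm lborel (\<phi> k)) \<longlonglongrightarrow> \<kappa> * l2_norm lborel u"
      by (intro tendsto_intros l2_norm_tendsto[OF finite_energyD(1) finite_energyD(1) \<phi>(2)] fe)
    moreover have "(\<lambda>k. energy_norm (\<phi> k)) \<longlonglongrightarrow> energy_norm u"
      by (rule energy_norm_tendsto[OF fe(1,2) \<phi>(3)])
    ultimately show ?thesis
      by (rule LIMSEQ_le) (use \<kappa>(2) \<phi>(1) in blast)
  qed
  then show ?thesis using that \<kappa>(1) by blast
qed

text \<open>For each fixed shift the norm of the increment is continuous in \<open>L\<^sup>2\<close>, and Fatou's lemma is
  applied in the shift variable.\<close>
lemma energy_lower_semicontinuous:
  assumes v: "\<And>k. v k \<in> l2 lborel" "u \<in> l2 lborel" and lim: "(\<lambda>k. l2_norm lborel (\<lambda>x. v k x - u x)) \<longlonglongrightarrow> 0"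
    and bound: "\<And>k. k \<ge> N \<Longrightarrow> v k \<in> finite_energy \<and> energy_norm (v k) \<le> e" and e: "e \<ge> 0"
  shows "u \<in> finite_energy" "energy_norm u \<le> e"
proof -
  have [measurable]: "u \<in> borel_measurable borel" "v k \<in> borel_measurable borel" for k
    using v by (auto simp: l2_def)
  have nn: "(\<integral>\<^sup>+p. ennreal ((cmod (increment w p))\<^sup>2) \<partial>G) =
      (\<integral>\<^sup>+z. ennreal (K z) * ennreal ((l2_norm lborel (\<lambda>y. w (y + z) - w y))\<^sup>2) \<partial>lborel)"
    if w: "w \<in> l2 lborel" for w
  proof -
    have [measurable]: "w \<in> borel_measurable borel" using w by (auto simp: l2_def)
    have "(\<integral>\<^sup>+p. ennreal ((cmod (increment w p))\<^sup>2) \<partial>G) =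
      (\<integral>\<^sup>+z. ennreal (K z) * (\<integral>\<^sup>+y. ennreal ((cmod (w (y + z) - w y))\<^sup>2) \<partial>lborel) \<partial>lborel)"
      by (subst nn_integral_G(2)) (simp_all add: increment_def)
    also have "\<dots> = (\<integral>\<^sup>+z. ennreal (K z) * ennreal ((l2_norm lborel (\<lambda>y. w (y + z) - w y))\<^sup>2) \<partial>lborel)"
      by (subst nn_integral_l2[OF l2_diff[OF l2_translate(1)[OF w] w]]) (rule refl)
    finally show ?thesis .
  qed
  have meas: "(\<lambda>z. l2_norm lborel (\<lambda>y. w (y + z) - w y)) \<in> borel_measurable borel"
    if [measurable]: "w \<in> borel_measurable borel" for w :: "'a \<Rightarrow> complex"
    unfolding l2_norm_def by measurable
  have shift: "(\<lambda>k. l2_norm lborel (\<lambda>y. v k (y + z) - v k y)) \<longlonglongrightarrow> l2_norm lborel (\<lambda>y. u (y + z) - u y)" for z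
  proof (rule l2_norm_tendsto)
    show "(\<lambda>y. v k (y + z) - v k y) \<in> l2 lborel" "(\<lambda>y. u (y + z) - u y) \<in> l2 lborel" for k
      by (intro l2_diff l2_translate v)+
    show "(\<lambda>k. l2_norm lborel (\<lambda>y. v k (y + z) - v k y - (u (y + z) - u y))) \<longlonglongrightarrow> 0"
    proof (rule Lim_null_comparison[OF _ tendsto_mult_right_zero[OF lim, of 2]], intro always_eventually allI)
      fix k
      let ?d = "\<lambda>x. v k x - u x"
      have d: "?d \<in> l2 lborel" by (intro l2_diff v)
      have "(\<lambda>y. v k (y + z) - v k y - (u (y + z) - u y)) = (\<lambda>y. ?d (y + z) - ?d y)" by (simp add: algebra_simps)
      then show "norm (l2_norm lborel (\<lambda>y. v k (y + z) - v k y - (u (y + z) - u y))) \<le> 2 * l2_norm lborel ?d"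
        using l2_norm_triangle_sub[OF l2_translate(1)[OF d] d] l2_translate(2)[OF d] by simp
    qed
  qed
  have "(\<integral>\<^sup>+p. ennreal ((cmod (increment u p))\<^sup>2) \<partial>G) =
      (\<integral>\<^sup>+z. liminf (\<lambda>k. ennreal (K z * (l2_norm lborel (\<lambda>y. v k (y + z) - v k y))\<^sup>2)) \<partial>lborel)"
    unfolding nn[OF v(2)]
  proof (rule nn_integral_cong)
    fix z
    have "(\<lambda>k. ennreal (K z * (l2_norm lborel (\<lambda>y. v k (y + z) - v k y))\<^sup>2)) \<longlonglongrightarrow>
        ennreal (K z * (l2_norm lborel (\<lambda>y. u (y + z) - u y))\<^sup>2)"
      by (intro tendsto_ennrealI tendsto_intros shift)
    from lim_imp_Liminf[OF _ this]
    show "ennreal (K z) * ennreal ((l2_norm lborel (\<lambda>y. u (y + z) - u y))\<^sup>2) =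
        liminf (\<lambda>k. ennreal (K z * (l2_norm lborel (\<lambda>y. v k (y + z) - v k y))\<^sup>2))"
      by (simp add: ennreal_mult)
  qed
  also have "\<dots> \<le> liminf (\<lambda>k. \<integral>\<^sup>+z. ennreal (K z * (l2_norm lborel (\<lambda>y. v k (y + z) - v k y))\<^sup>2) \<partial>lborel)"
  proof (rule nn_integral_liminf)
    have [measurable]: "(\<lambda>z. l2_norm lborel (\<lambda>y. v k (y + z) - v k y)) \<in> borel_measurable borel" for k
      by (rule meas) simp
    show "(\<lambda>z. ennreal (K z * (l2_norm lborel (\<lambda>y. v k (y + z) - v k y))\<^sup>2)) \<in> borel_measurable lborel" for k
      by measurable
  qed
  also have "\<dots> \<le> limsup (\<lambda>k. \<integral>\<^sup>+z. ennreal (K z * (l2_norm lborel (\<lambda>y. v k (y + z) - v k y))\<^sup>2) \<partial>lborel)"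
    by (rule Liminf_le_Limsup) simp
  also have "\<dots> \<le> ennreal (e\<^sup>2)"
  proof (rule Limsup_bounded, rule eventually_sequentiallyI[of N])
    fix k assume k: "N \<le> k"
    have "(\<integral>\<^sup>+z. ennreal (K z * (l2_norm lborel (\<lambda>y. v k (y + z) - v k y))\<^sup>2) \<partial>lborel) =
        (\<integral>\<^sup>+p. ennreal ((cmod (increment (v k) p))\<^sup>2) \<partial>G)"
      unfolding nn[OF v(1)] by (simp add: ennreal_mult)
    also have "\<dots> = ennreal ((energy_norm (v k))\<^sup>2)"
      unfolding energy_norm_def using bound[OF k] by (intro nn_integral_l2 finite_energyD) simp
    also have "\<dots> \<le> ennreal (e\<^sup>2)"
      using bound[OF k] by (intro ennreal_leI power_mono) auto
    finally show "(\<integral>\<^sup>+z. ennreal (K z * (l2_norm lborel (\<lambda>y. v k (y + z) - v k y))\<^sup>2) \<partial>lborel) \<le> ennreal (e\<^sup>2)" .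
  qed
  finally have fin: "(\<integral>\<^sup>+p. ennreal ((cmod (increment u p))\<^sup>2) \<partial>G) \<le> ennreal (e\<^sup>2)" .
  have m: "increment u \<in> borel_measurable G" by simp
  show "u \<in> finite_energy" using v(2) l2_bounded(1)[OF m fin e] by (simp add: finite_energy_def)
  show "energy_norm u \<le> e" unfolding energy_norm_def by (rule l2_bounded(2)[OF m fin e])
qed

text \<open>Existence by the direct method: by the parallelogram law a sequence of test functions that
  minimises the energy of \<open>f + \<phi>\<close> is Cauchy, and by the Poincare inequality it converges.\<close>
lemma weak_solution_exists:
  assumes U: "bounded U" and f: "f \<in> finite_energy"
  shows "\<exists>u. weak_solution s U a f u"
proof -
  obtain \<kappa> where \<kappa>: "\<kappa> > 0" "\<forall>\<phi>\<in>test_functions U. \<kappa> * l2_norm lborel \<phi> \<le> energy_norm \<phi>"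
    by (rule poincare_test_functions[OF U])
  note tf = test_function_finite_energy
  define J where "J \<phi> = (energy_norm (\<lambda>x. f x + \<phi> x))\<^sup>2" for \<phi>
  define d where "d = Inf (J ` test_functions U)"
  have bdd: "bdd_below (J ` test_functions U)" by (rule bdd_belowI2[of _ 0]) (simp add: J_def)
  have d_le: "d \<le> J \<phi>" if "\<phi> \<in> test_functions U" for \<phi>
    unfolding d_def using that bdd by (intro cInf_lower) auto
  have "\<exists>\<phi>\<in>test_functions U. J \<phi> < d + 1 / real (Suc k)" for k
  proof -
    have ne: "J ` test_functions U \<noteq> {}" using test_functions_zero by blast
    have "Inf (J ` test_functions U) < d + 1 / real (Suc k)" by (simp add: d_def)
    then show ?thesis using cInf_lessD[OF ne] by blast
  qed
  then obtain \<phi> where \<phi>: "\<And>k. \<phi> k \<in> test_functions U" "\<And>k. J (\<phi> k) < d + 1 / real (Suc k)" by metis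
  have fe: "\<phi> k \<in> finite_energy" "(\<lambda>x. f x + \<phi> k x) \<in> finite_energy" for k
    using tf[OF \<phi>(1)] f by (auto intro: finite_energy_add)
  define p where "p k = increment (\<lambda>x. f x + \<phi> k x)" for k
  have p: "p k \<in> l2 G" for k unfolding p_def by (rule finite_energyD(2)[OF fe(2)])
  have pJ: "(l2_norm G (p k))\<^sup>2 = J (\<phi> k)" for k by (simp add: p_def J_def energy_norm_def)
  have parallelogram: "(energy_norm (\<lambda>x. \<phi> j x - \<phi> k x))\<^sup>2 \<le> 2 / real (Suc j) + 2 / real (Suc k)" for j k
  proof -
    let ?m = "\<lambda>x. (1/2) * (\<phi> j x + \<phi> k x)"
    have "increment (\<lambda>x. \<phi> j x - \<phi> k x) = (\<lambda>q. p j q + (-1) * p k q)"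
      by (auto simp: p_def increment_def)
    then have "(energy_norm (\<lambda>x. \<phi> j x - \<phi> k x))\<^sup>2 =
        (l2_norm G (p j))\<^sup>2 + 2 * Re (l2_inner G (p j) (\<lambda>q. (-1) * p k q)) + (l2_norm G (\<lambda>q. (-1) * p k q))\<^sup>2"
      unfolding energy_norm_def by (simp only: l2_norm_add_sq[OF p l2_scale[OF p]])
    also have "\<dots> = J (\<phi> j) - 2 * Re (l2_inner G (p j) (p k)) + J (\<phi> k)"
      using l2_norm_scale[of G "-1" "p k"] by (simp add: pJ[symmetric] l2_inner_def)
    finally have minus: "(energy_norm (\<lambda>x. \<phi> j x - \<phi> k x))\<^sup>2 = J (\<phi> j) - 2 * Re (l2_inner G (p j) (p k)) + J (\<phi> k)" .
    have "increment (\<lambda>x. f x + ?m x) = (\<lambda>q. (1/2) * (p j q + p k q))"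
      by (auto simp: p_def increment_def field_simps)
    then have "J ?m = (1/4) * ((l2_norm G (\<lambda>q. p j q + p k q))\<^sup>2)"
      unfolding J_def energy_norm_def by (simp only: l2_norm_scale power_mult_distrib) (simp add: power2_eq_square)
    also have "\<dots> = (1/4) * (J (\<phi> j) + 2 * Re (l2_inner G (p j) (p k)) + J (\<phi> k))"
      by (simp add: l2_norm_add_sq[OF p p] pJ)
    finally have "4 * J ?m = J (\<phi> j) + 2 * Re (l2_inner G (p j) (p k)) + J (\<phi> k)" by simp
    moreover have "d \<le> J ?m" by (intro d_le test_functions_scale test_functions_add \<phi>)
    ultimately show ?thesis using minus \<phi>(2)[of j] \<phi>(2)[of k] by simp
  qed
  have cauchy: "energy_norm (\<lambda>x. \<phi> j x - \<phi> k x) \<le> sqrt (4 / real (Suc N))" if "j \<ge> N" "k \<ge> N" for j k N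
  proof (rule real_le_rsqrt)
    have "2 / real (Suc j) \<le> 2 / real (Suc N)" "2 / real (Suc k) \<le> 2 / real (Suc N)"
      using that by (auto intro!: divide_left_mono)
    then show "(energy_norm (\<lambda>x. \<phi> j x - \<phi> k x))\<^sup>2 \<le> 4 / real (Suc N)"
      using parallelogram[of j k] by simp
  qed
  have lim: "(\<lambda>N. sqrt (4 / real (Suc N))) \<longlonglongrightarrow> 0"
  proof -
    have "(\<lambda>N. sqrt (4 * (1 / real (Suc N)))) \<longlonglongrightarrow> sqrt (4 * 0)"
      by (intro tendsto_intros LIMSEQ_Suc[OF lim_1_over_n])
    then show ?thesis by simp
  qed
  obtain w where w: "w \<in> l2 lborel" "(\<lambda>n. l2_norm lborel (\<lambda>x. \<phi> n x - w x)) \<longlonglongrightarrow> 0"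
  proof (rule l2_complete)
    show "\<phi> n \<in> l2 lborel" for n by (rule finite_energyD(1)[OF fe(1)])
    show "\<exists>N. \<forall>m\<ge>N. \<forall>n\<ge>N. l2_norm lborel (\<lambda>x. \<phi> m x - \<phi> n x) < e" if e: "e > 0" for e
    proof -
      have "\<forall>\<^sub>F N in sequentially. sqrt (4 / real (Suc N)) < \<kappa> * e"
        by (rule order_tendstoD(2)[OF lim]) (use \<kappa>(1) e in simp)
      then obtain N where N: "sqrt (4 / real (Suc N)) < \<kappa> * e" by (auto simp: eventually_sequentially)
      have "l2_norm lborel (\<lambda>x. \<phi> m x - \<phi> n x) < e" if "m \<ge> N" "n \<ge> N" for m n
      proof -
        have "\<kappa> * l2_norm lborel (\<lambda>x. \<phi> m x - \<phi> n x) \<le> energy_norm (\<lambda>x. \<phi> m x - \<phi> n x)"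
          using \<kappa>(2) test_functions_diff[OF \<phi>(1) \<phi>(1)] by blast
        also have "\<dots> < \<kappa> * e" using cauchy[OF that] N by linarith
        finally show ?thesis using \<kappa>(1) by simp
      qed
      then show ?thesis by blast
    qed
  qed blast
  have close: "(\<lambda>x. \<phi> m x - w x) \<in> finite_energy \<and> energy_norm (\<lambda>x. \<phi> m x - w x) \<le> sqrt (4 / real (Suc m))" for m
  proof -
    have 1: "(\<lambda>x. \<phi> m x - \<phi> k x) \<in> l2 lborel" "(\<lambda>x. \<phi> m x - w x) \<in> l2 lborel" for k
      by (intro l2_diff w finite_energyD(1)[OF fe(1)])+
    have 2: "(\<lambda>k. l2_norm lborel (\<lambda>x. (\<phi> m x - \<phi> k x) - (\<phi> m x - w x))) \<longlonglongrightarrow> 0"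
      using w(2) by (simp add: l2_norm_minus_commute[of lborel w])
    have 3: "(\<lambda>x. \<phi> m x - \<phi> k x) \<in> finite_energy \<and> energy_norm (\<lambda>x. \<phi> m x - \<phi> k x) \<le> sqrt (4 / real (Suc m))"
      if "k \<ge> m" for k
      using cauchy[of m m k] that finite_energy_diff[OF fe(1) fe(1)] by simp
    show ?thesis
      using energy_lower_semicontinuous[OF 1 2 3] by simp
  qed
  have wfe: "w \<in> finite_energy"
    using finite_energy_diff[OF fe(1)[of 0] conjunct1[OF close[of 0]]] by simp
  have elim: "(\<lambda>k. energy_norm (\<lambda>x. \<phi> k x - w x)) \<longlonglongrightarrow> 0"
    by (rule Lim_null_comparison[OF _ lim]) (use close in auto)
  have wt: "w \<in> sobolev_tilde s U" by (rule sobolev_tildeI[OF wfe \<phi>(1) w(2) elim])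
  define u where "u x = f x + w x" for x
  have ufe: "u \<in> finite_energy" unfolding u_def by (intro finite_energy_add f wfe)
  have test: "E u \<psi> = 0" if \<psi>: "\<psi> \<in> test_functions U" for \<psi>
  proof -
    have \<psi>fe: "\<psi> \<in> finite_energy" by (rule tf[OF \<psi>])
    define q where "q = increment \<psi>"
    have q: "q \<in> l2 G" unfolding q_def by (rule finite_energyD(2)[OF \<psi>fe])
    define \<beta> where "\<beta> = l2_inner G (increment u) q"
    have "(\<lambda>k. l2_inner G (p k) q - \<beta>) \<longlonglongrightarrow> 0"
    proof (rule Lim_null_comparison)
      show "(\<lambda>k. energy_norm (\<lambda>x. \<phi> k x - w x) * l2_norm G q) \<longlonglongrightarrow> 0"
        using tendsto_mult_left_zero[OF elim] .
      have "l2_inner G (p k) q - \<beta> = l2_inner G (increment (\<lambda>x. \<phi> k x - w x)) q" for k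
      proof -
        have "increment (\<lambda>x. \<phi> k x - w x) = (\<lambda>y. p k y - increment u y)"
          by (auto simp: p_def u_def increment_def)
        then show ?thesis
          using integrable_l2_prod(2)[OF p q] integrable_l2_prod(2)[OF finite_energyD(2)[OF ufe] q]
          by (simp add: \<beta>_def l2_inner_def left_diff_distrib)
      qed
      then show "\<forall>\<^sub>F k in sequentially. norm (l2_inner G (p k) q - \<beta>) \<le> energy_norm (\<lambda>x. \<phi> k x - w x) * l2_norm G q"
        using l2_Cauchy_Schwarz[OF finite_energyD(2)[OF conjunct1[OF close]] q]
        by (intro always_eventually) (simp add: energy_norm_def)
    qed
    then have \<beta>: "(\<lambda>k. l2_inner G (p k) q) \<longlonglongrightarrow> \<beta>" by (simp add: LIM_zero_iff)
    define M where "M = (l2_norm G q)\<^sup>2"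
    have key: "0 \<le> 2 * Re (cnj c * \<beta>) + (cmod c)\<^sup>2 * M" for c
    proof -
      have "0 \<le> 1 / real (Suc k) + (2 * Re (cnj c * l2_inner G (p k) q) + (cmod c)\<^sup>2 * M)" for k
      proof -
        have "d \<le> J (\<lambda>x. \<phi> k x + c * \<psi> x)" by (intro d_le test_functions_add test_functions_scale \<phi> \<psi>)
        also have "\<dots> = (l2_norm G (\<lambda>y. p k y + c * q y))\<^sup>2"
        proof -
          have "increment (\<lambda>x. f x + (\<phi> k x + c * \<psi> x)) = (\<lambda>y. p k y + c * q y)"
            by (auto simp: p_def q_def increment_def algebra_simps)
          then show ?thesis by (simp add: J_def energy_norm_def)
        qed
        also have "\<dots> = J (\<phi> k) + 2 * Re (l2_inner G (p k) (\<lambda>y. c * q y)) + (cmod c)\<^sup>2 * M"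
          by (simp add: l2_norm_add_sq[OF p l2_scale[OF q]] pJ l2_norm_scale power_mult_distrib M_def)
        also have "l2_inner G (p k) (\<lambda>y. c * q y) = cnj c * l2_inner G (p k) q"
          by (simp add: l2_inner_def mult.left_commute)
        finally show ?thesis using \<phi>(2)[of k] by simp
      qed
      moreover have "(\<lambda>k. 1 / real (Suc k) + (2 * Re (cnj c * l2_inner G (p k) q) + (cmod c)\<^sup>2 * M)) \<longlonglongrightarrow>
          0 + (2 * Re (cnj c * \<beta>) + (cmod c)\<^sup>2 * M)"
        by (intro tendsto_intros \<beta> LIMSEQ_Suc[OF lim_1_over_n])
      ultimately have "0 \<le> 0 + (2 * Re (cnj c * \<beta>) + (cmod c)\<^sup>2 * M)"
        by (intro LIMSEQ_le_const) auto
      then show ?thesis by simp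
    qed
    have M: "M \<ge> 0" by (simp add: M_def)
    define t where "t = 1 / (M + 1)"
    have t: "t > 0" "t * M \<le> 1" using M by (auto simp: t_def field_simps)
    \<comment> \<open>Moving against the gradient \<open>\<beta>\<close> would lower the energy to first order in \<open>t\<close>; the choice of
      \<open>t\<close> keeps the quadratic term below the linear one.\<close>
    define c where "c = of_real (- t) * \<beta>"
    have "Re (cnj c * \<beta>) = - t * (cmod \<beta>)\<^sup>2"
      unfolding cmod_power2 by (simp add: c_def power2_eq_square algebra_simps)
    moreover have "cmod c = t * cmod \<beta>" using t by (simp add: c_def norm_mult)
    ultimately have "0 \<le> 2 * (- t * (cmod \<beta>)\<^sup>2) + (t * cmod \<beta>)\<^sup>2 * M"
      using key[of c] by (simp only:)
    also have "\<dots> = t * (cmod \<beta>)\<^sup>2 * (t * M - 2)" by (simp add: power2_eq_square algebra_simps)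
    finally have "cmod \<beta> = 0"
      using t by (auto simp: zero_le_mult_iff mult_le_0_iff)
    then show ?thesis by (simp add: energy_form_inner[OF ufe \<psi>fe] \<beta>_def q_def)
  qed
  have "E u \<psi> = 0" if \<psi>: "\<psi> \<in> sobolev_tilde s U" for \<psi>
  proof -
    obtain \<eta> where \<eta>: "\<And>k::nat. \<eta> k \<in> test_functions U"
      "(\<lambda>k. l2_norm lborel (\<lambda>x. \<eta> k x - \<psi> x)) \<longlonglongrightarrow> 0" "(\<lambda>k. energy_norm (\<lambda>x. \<eta> k x - \<psi> x)) \<longlonglongrightarrow> 0"
      by (rule sobolev_tilde_approx[OF \<psi>]) blast
    have b: "cmod (E u \<psi>) \<le> energy_norm u * energy_norm (\<lambda>x. \<eta> k x - \<psi> x) / 2" for k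
    proof -
      have "E u (\<lambda>x. \<eta> k x - \<psi> x) = - E u \<psi>"
        using energy_form_diff_right[OF ufe tf[OF \<eta>(1)] sobolev_tilde_finite_energy[OF \<psi>], of k] test[OF \<eta>(1)[of k]]
        by simp
      then show ?thesis
        using energy_form_bound[OF ufe finite_energy_diff[OF tf[OF \<eta>(1)[of k]] sobolev_tilde_finite_energy[OF \<psi>]]]
        by simp
    qed
    have "(\<lambda>k. energy_norm u * energy_norm (\<lambda>x. \<eta> k x - \<psi> x) / 2) \<longlonglongrightarrow> energy_norm u * 0 / 2"
      by (intro tendsto_intros \<eta>) simp
    then have "cmod (E u \<psi>) \<le> energy_norm u * 0 / 2"
      by (rule LIMSEQ_le_const) (use b in blast)
    then show ?thesis by simp
  qed
  moreover have "(\<lambda>x. u x - f x) = w" by (simp add: u_def)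
  ultimately have "weak_solution s U a f u"
    using ufe wt by (simp add: weak_solution_def sobolev_iff_finite_energy)
  then show ?thesis by blast
qed

end

section \<open>Separated supports\<close>

lemma test_function_integrable:
  fixes \<phi> :: "'a::euclidean_space \<Rightarrow> complex"
  assumes "\<phi> \<in> test_functions U"
  shows "integrable lborel \<phi>"
proof -
  obtain B R where B: "B \<ge> 0" "R \<ge> 0" "continuous_on UNIV \<phi>" "\<forall>x. cmod (\<phi> x) \<le> B"
    "\<forall>x. norm x > R \<longrightarrow> \<phi> x = 0"
    by (rule test_function_bounds[OF assms]) (rule that)
  have [measurable]: "\<phi> \<in> borel_measurable borel" by (rule borel_measurable_continuous_onI) (rule B)
  show ?thesis
  proof (rule Bochner_Integration.integrable_bound)
    show "integrable lborel (\<lambda>x::'a. B * indicator (cball 0 R) x :: real)"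
      using emeasure_lborel_cball_finite[of "0::'a" R]
      by (intro integrable_mult_right integrable_real_indicator) (auto simp: less_top)
    have "cmod (\<phi> x) \<le> B * indicator (cball 0 R) x" for x
      using B(1,4,5) by (cases "norm x \<le> R") auto
    then show "AE x in lborel. norm (\<phi> x) \<le> norm (B * indicator (cball 0 R) x)"
      using B(1) by (intro AE_I2) (simp add: abs_mult)
  qed simp
qed

lemma test_function_L1_le_L2:
  fixes U :: "'a::euclidean_space set"
  assumes "bounded U"
  obtains V where "V \<ge> 0" "\<forall>\<phi>\<in>test_functions U. \<phi> \<in> l2 lborel \<longrightarrow> (L1_norm \<phi>) \<le> V * l2_norm lborel \<phi>"
proof -
  obtain R where R: "\<And>x. x \<in> U \<Longrightarrow> norm x \<le> R"
    using assms unfolding bounded_iff by blast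
  let ?i = "indicator (cball (0::'a) R) :: 'a \<Rightarrow> complex"
  have "integrable lborel (indicator (cball (0::'a) R) :: 'a \<Rightarrow> real)"
    using emeasure_lborel_cball_finite[of "0::'a" R] by (intro integrable_real_indicator) (auto simp: less_top)
  also have "indicator (cball (0::'a) R) = (\<lambda>x. (cmod (?i x))\<^sup>2)" by (auto simp: indicator_def fun_eq_iff)
  finally have i: "?i \<in> l2 lborel"
    by (simp add: l2_def borel_measurable_indicator borel_closed)
  have "L1_norm \<phi> \<le> l2_norm lborel ?i * l2_norm lborel \<phi>"
    if "\<phi> \<in> test_functions U" "\<phi> \<in> l2 lborel" for \<phi>
  proof -
    have "cmod (\<phi> x) = cmod (?i x) * cmod (\<phi> x)" for x
      using test_function_outside[OF that(1), of x] R[of x] by (auto simp: indicator_def)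
    then have "L1_norm \<phi> = (\<integral>x. cmod (?i x) * cmod (\<phi> x) \<partial>lborel)" by (intro Bochner_Integration.integral_cong) auto
    also have "\<dots> \<le> l2_norm lborel ?i * l2_norm lborel \<phi>" by (rule l2_Cauchy_Schwarz_abs[OF i that(2)])
    finally show ?thesis .
  qed
  then show ?thesis using that[of "l2_norm lborel ?i"] by simp
qed

lemma integral_lborel_prod:
  fixes f :: "'a::euclidean_space \<Rightarrow> real" and g :: "'b::euclidean_space \<Rightarrow> real"
  assumes "integrable lborel f" "integrable lborel g"
  shows "(\<integral>(x, y). f x * g y \<partial>(lborel \<Otimes>\<^sub>M lborel)) = integral\<^sup>L lborel f * integral\<^sup>L lborel g"
  by (subst lborel_pair.integral_fst'[OF integrable_lborel_prod[OF assms], symmetric]) simp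

lemma l2_inner_commute: "l2_inner M u v = cnj (l2_inner M v u)"
  by (simp add: l2_inner_def mult.commute flip: Bochner_Integration.integral_cnj)

context angular_density
begin

lemma K_bounded_away:
  assumes "\<delta> > 0"
  obtains C where "C \<ge> 0" "\<forall>z. \<delta> \<le> norm z \<longrightarrow> K z \<le> C"
proof -
  obtain A where A: "A > 0" "\<And>z. K z \<le> A * norm z powr (- (real DIM('a) + 2 * s))"
    by (rule K_bound) blast
  have "K z \<le> A * \<delta> powr (- (real DIM('a) + 2 * s))" if "\<delta> \<le> norm z" for z
  proof -
    have "norm z powr (- (real DIM('a) + 2 * s)) \<le> \<delta> powr (- (real DIM('a) + 2 * s))"
      using that assms s_pos by (intro powr_mono2') auto
    then show ?thesis using A(2)[of z] mult_left_mono[of _ _ A] A(1) by (meson less_imp_le order_trans)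
  qed
  then show ?thesis using that[of "A * \<delta> powr (- (real DIM('a) + 2 * s))"] A(1) by simp
qed

text \<open>What remains of the energy density when \<open>p\<close> and \<open>q\<close> have disjoint supports, up to the sign.\<close>
definition cross_density :: "('a \<Rightarrow> complex) \<Rightarrow> ('a \<Rightarrow> complex) \<Rightarrow> 'a \<times> 'a \<Rightarrow> complex" where
  "cross_density p q = (\<lambda>(x, y). (p x * cnj (q y) + p y * cnj (q x)) / 2 * of_real (K (x - y)))"

text \<open>If the supports are disjoint, only the cross terms survive in the energy, and there the
  kernel is bounded.\<close>
lemma energy_form_separated:
  assumes p: "integrable lborel p" and q: "integrable lborel q"
    and disj: "\<And>x. p x = 0 \<or> q x = 0"
    and C: "C \<ge> 0" "\<And>x y. p x \<noteq> 0 \<Longrightarrow> q y \<noteq> 0 \<Longrightarrow> K (x - y) \<le> C"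
  shows "integrable (lborel \<Otimes>\<^sub>M lborel) (cross_density p q)"
    "E p q = - (\<integral>z. cross_density p q z \<partial>(lborel \<Otimes>\<^sub>M lborel))"
    "cmod (E p q) \<le> C * L1_norm p * L1_norm q"
proof -
  have [measurable]: "p \<in> borel_measurable borel" "q \<in> borel_measurable borel"
    using p q by (auto dest: borel_measurable_integrable)
  define H where "H = (\<lambda>(x, y). C / 2 * (cmod (p x) * cmod (q y)) + C / 2 * (cmod (q x) * cmod (p y)))"
  have prod: "integrable (lborel \<Otimes>\<^sub>M lborel) (\<lambda>(x, y). cmod (p x) * cmod (q y))"
    "integrable (lborel \<Otimes>\<^sub>M lborel) (\<lambda>(x, y). cmod (q x) * cmod (p y))"
    by (intro integrable_lborel_prod integrable_norm p q)+
  have H_int: "integrable (lborel \<Otimes>\<^sub>M lborel) H"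
    unfolding H_def case_prod_unfold
    by (intro Bochner_Integration.integrable_add integrable_mult_right prod[unfolded case_prod_unfold])
  have bound: "cmod (cross_density p q z) \<le> H z" for z
  proof -
    obtain x y where z: "z = (x, y)" by (cases z)
    have 1: "cmod (p x) * cmod (q y) * K (x - y) \<le> C * (cmod (p x) * cmod (q y))"
      using mult_left_mono[OF C(2)[of x y], of "cmod (p x) * cmod (q y)"] C(1)
      by (cases "p x = 0 \<or> q y = 0") (auto simp: mult_ac)
    have 2: "cmod (p y) * cmod (q x) * K (x - y) \<le> C * (cmod (q x) * cmod (p y))"
      using mult_left_mono[OF C(2)[of y x], of "cmod (p y) * cmod (q x)"] C(1) K_even[of "x - y"]
      by (cases "p y = 0 \<or> q x = 0") (auto simp: mult_ac)
    have "cmod (cross_density p q z) = cmod (p x * cnj (q y) + p y * cnj (q x)) / 2 * K (x - y)"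
      by (simp add: z cross_density_def norm_mult norm_divide)
    also have "\<dots> \<le> (cmod (p x) * cmod (q y) + cmod (p y) * cmod (q x)) / 2 * K (x - y)"
      using norm_triangle_ineq[of "p x * cnj (q y)" "p y * cnj (q x)"]
      by (intro mult_right_mono) (auto simp: norm_mult)
    also have "\<dots> \<le> H z" using 1 2 by (simp add: z H_def field_simps)
    finally show ?thesis .
  qed
  have [measurable]: "cross_density p q \<in> borel_measurable (lborel \<Otimes>\<^sub>M lborel)"
    unfolding cross_density_def by measurable
  show int: "integrable (lborel \<Otimes>\<^sub>M lborel) (cross_density p q)"
    by (rule Bochner_Integration.integrable_bound[OF H_int])
       (use bound in \<open>auto intro!: AE_I2 intro: order_trans[OF _ abs_ge_self]\<close>)
  have pointwise: "(case z of (x, y) \<Rightarrow> (p x - p y) * cnj (q x - q y) * of_real (K (x - y))) = - 2 * cross_density p q z" for z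
  proof -
    obtain x y where z: "z = (x, y)" by (cases z)
    have "(p x - p y) * cnj (q x - q y) = - (p x * cnj (q y) + p y * cnj (q x))"
      using disj[of x] disj[of y] by (auto simp: algebra_simps)
    then show ?thesis by (simp only: z cross_density_def prod.case) (simp add: distrib_right left_diff_distrib)
  qed
  have "(\<lambda>(x, y). (p x - p y) * cnj (q x - q y) * of_real (K (x - y))) = (\<lambda>z. - 2 * cross_density p q z)"
    by (rule ext) (rule pointwise)
  then have "E p q = 1 / 2 * (\<integral>z. - 2 * cross_density p q z \<partial>(lborel \<Otimes>\<^sub>M lborel))"
    unfolding energy_form_def by (simp only:)
  then show eq: "E p q = - (\<integral>z. cross_density p q z \<partial>(lborel \<Otimes>\<^sub>M lborel))"
    by simp
  have "cmod (E p q) \<le> (\<integral>z. H z \<partial>(lborel \<Otimes>\<^sub>M lborel))"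
    unfolding eq norm_minus_cancel by (rule order_trans[OF integral_norm_bound integral_mono[OF integrable_norm[OF int] H_int bound]])
  also have "\<dots> = C / 2 * (\<integral>(x, y). cmod (p x) * cmod (q y) \<partial>(lborel \<Otimes>\<^sub>M lborel)) +
      C / 2 * (\<integral>(x, y). cmod (q x) * cmod (p y) \<partial>(lborel \<Otimes>\<^sub>M lborel))"
    unfolding H_def case_prod_unfold
    by (subst Bochner_Integration.integral_add)
       (simp_all add: prod[unfolded case_prod_unfold] integrable_mult_right)
  also have "\<dots> = C * L1_norm p * L1_norm q"
    unfolding integral_lborel_prod[OF integrable_norm[OF p] integrable_norm[OF q]]
      integral_lborel_prod[OF integrable_norm[OF q] integrable_norm[OF p]] by simp
  finally show "cmod (E p q) \<le> C * L1_norm p * L1_norm q" .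
qed

text \<open>The solution differs from its exterior datum by a function supported in \<open>\<Omega>\<close>, on which the
  datum acts through the bounded part of the kernel only.\<close>
lemma exterior_remainder_bound:
  assumes \<Omega>: "bounded \<Omega>" and \<delta>: "\<delta> > 0" "\<And>x y. x \<in> \<Omega> \<Longrightarrow> y \<in> B \<Longrightarrow> \<delta> \<le> dist x y"
  obtains C where "C \<ge> 0" "\<forall>f\<in>test_functions B. \<forall>g\<in>test_functions B. \<forall>u. weak_solution s \<Omega> a f u \<longrightarrow>
    cmod (E u g - E f g) \<le>
      C * L1_norm f * L1_norm g"
proof -
  obtain C0 where C0: "C0 \<ge> 0" "\<forall>z. \<delta> \<le> norm z \<longrightarrow> K z \<le> C0" by (rule K_bounded_away[OF \<delta>(1)])
  obtain V where V: "V \<ge> 0" "\<forall>\<phi>\<in>test_functions \<Omega>. \<phi> \<in> l2 lborel \<longrightarrow> (L1_norm \<phi>) \<le> V * l2_norm lborel \<phi>"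
    by (rule test_function_L1_le_L2[OF \<Omega>])
  obtain \<kappa> where \<kappa>: "\<kappa> > 0" "\<forall>u\<in>sobolev_tilde s \<Omega>. \<kappa> * l2_norm lborel u \<le> energy_norm u"
    by (rule poincare[OF \<Omega>])
  note tf = test_function_finite_energy
  have far: "cmod (E w g) \<le> C0 * V * l2_norm lborel w * L1_norm g"
    if w: "w \<in> sobolev_tilde s \<Omega>" and g: "g \<in> test_functions B" for w g
  proof -
    obtain \<phi> where \<phi>: "\<And>k::nat. \<phi> k \<in> test_functions \<Omega>"
      "(\<lambda>k. l2_norm lborel (\<lambda>x. \<phi> k x - w x)) \<longlonglongrightarrow> 0" "(\<lambda>k. energy_norm (\<lambda>x. \<phi> k x - w x)) \<longlonglongrightarrow> 0"
      by (rule sobolev_tilde_approx[OF w]) blast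
    have wfe: "w \<in> finite_energy" by (rule sobolev_tilde_finite_energy[OF w])
    have b: "cmod (E (\<phi> k) g) \<le> C0 * V * l2_norm lborel (\<phi> k) * L1_norm g" for k
    proof -
      have sep: "\<delta> \<le> norm (x - y)" if "\<phi> k x \<noteq> 0" "g y \<noteq> 0" for x y
        using \<delta>(2)[of x y] test_function_outside[OF \<phi>(1), of x k] test_function_outside[OF g, of y] that
        by (auto simp: dist_norm)
      have "cmod (E (\<phi> k) g) \<le> C0 * (L1_norm (\<phi> k)) * L1_norm g"
      proof (rule energy_form_separated(3))
        show "\<phi> k x = 0 \<or> g x = 0" for x using sep[of x x] \<delta>(1) by auto
        show "K (x - y) \<le> C0" if "\<phi> k x \<noteq> 0" "g y \<noteq> 0" for x y using C0(2) sep[OF that] by blast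
      qed (use C0 test_function_integrable \<phi>(1) g in auto)
      also have "\<dots> \<le> C0 * (V * l2_norm lborel (\<phi> k)) * L1_norm g"
        using V(2) \<phi>(1)[of k] finite_energyD(1)[OF tf[OF \<phi>(1)[of k]]] C0(1)
        by (intro mult_right_mono mult_left_mono integral_nonneg_AE) auto
      finally show ?thesis by (simp add: mult.assoc)
    qed
    have "(\<lambda>k. E (\<phi> k) g - E w g) \<longlonglongrightarrow> 0"
    proof (rule Lim_null_comparison[OF _ tendsto_mult_left_zero[OF \<phi>(3), of "energy_norm g / 2"]], intro always_eventually allI)
      fix k
      show "norm (E (\<phi> k) g - E w g) \<le> energy_norm (\<lambda>x. \<phi> k x - w x) * (energy_norm g / 2)"
        using energy_form_bound[OF finite_energy_diff[OF tf[OF \<phi>(1)] wfe] tf[OF g], of k]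
          energy_form_diff_left[OF tf[OF \<phi>(1)] wfe tf[OF g], of k] by simp
    qed
    then have "(\<lambda>k. E (\<phi> k) g) \<longlonglongrightarrow> E w g" by (simp add: LIM_zero_iff)
    then have l1: "(\<lambda>k. cmod (E (\<phi> k) g)) \<longlonglongrightarrow> cmod (E w g)" by (rule tendsto_norm)
    have l2: "(\<lambda>k. C0 * V * l2_norm lborel (\<phi> k) * L1_norm g) \<longlonglongrightarrow>
        C0 * V * l2_norm lborel w * L1_norm g"
      by (intro tendsto_intros l2_norm_tendsto[OF finite_energyD(1)[OF tf[OF \<phi>(1)]] finite_energyD(1)[OF wfe] \<phi>(2)])
    show ?thesis by (rule LIMSEQ_le[OF l1 l2]) (use b in blast)
  qed
  define D where "D = C0 * V"
  have D: "D \<ge> 0" using C0(1) V(1) by (simp add: D_def)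
  define C where "C = D * (2 * D / \<kappa>\<^sup>2)"
  have "cmod (E u g - E f g) \<le> C * L1_norm f * L1_norm g"
    if f: "f \<in> test_functions B" and g: "g \<in> test_functions B" and u: "weak_solution s \<Omega> a f u" for f g u
  proof -
    define w where "w x = u x - f x" for x
    have w: "w \<in> sobolev_tilde s \<Omega>" using u by (simp add: weak_solution_def w_def[abs_def])
    have ffe: "f \<in> finite_energy" and gfe: "g \<in> finite_energy" and wfe: "w \<in> finite_energy"
      by (rule tf[OF f], rule tf[OF g], rule sobolev_tilde_finite_energy[OF w])
    have ufe: "u \<in> finite_energy" using u by (simp add: weak_solution_def sobolev_iff_finite_energy)
    define nf where "nf = (L1_norm f)"
    have nf: "nf \<ge> 0" unfolding nf_def by (rule integral_nonneg_AE) simp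
    have split: "E w v = E u v - E f v" if "v \<in> finite_energy" for v
      unfolding w_def by (rule energy_form_diff_left[OF ufe ffe that])
    have "E w w = - E f w"
      using split[OF wfe] u w by (simp add: weak_solution_def)
    then have "(energy_norm w)\<^sup>2 / 2 = cmod (E f w)"
      using energy_form_self[OF wfe] by (metis norm_minus_cancel norm_of_real abs_of_nonneg divide_nonneg_nonneg zero_le_numeral zero_le_power2)
    also have "\<dots> = cmod (E w f)"
      by (simp add: energy_form_inner ffe wfe norm_divide l2_inner_commute[of G "increment f"])
    also have "\<dots> \<le> D * l2_norm lborel w * nf" unfolding D_def nf_def by (rule far[OF w f])
    finally have e: "(energy_norm w)\<^sup>2 \<le> 2 * D * nf * l2_norm lborel w" by (simp add: mult_ac)
    have pw: "\<kappa> * l2_norm lborel w \<le> energy_norm w" using \<kappa>(2) w by blast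
    have "\<kappa>\<^sup>2 * l2_norm lborel w \<le> 2 * D * nf"
    proof (cases "l2_norm lborel w = 0")
      case True then show ?thesis using D nf by simp
    next
      case False
      then have pos: "l2_norm lborel w > 0" using l2_norm_nonneg[of lborel w] by linarith
      have "(\<kappa> * l2_norm lborel w)\<^sup>2 \<le> (energy_norm w)\<^sup>2"
        using pw \<kappa>(1) by (intro power_mono) auto
      with e have "(\<kappa>\<^sup>2 * l2_norm lborel w) * l2_norm lborel w \<le> (2 * D * nf) * l2_norm lborel w"
        by (simp add: power_mult_distrib power2_eq_square mult_ac)
      then show ?thesis using pos by (rule mult_right_le_imp_le)
    qed
    then have wb: "l2_norm lborel w \<le> 2 * D / \<kappa>\<^sup>2 * nf" using \<kappa>(1) by (simp add: field_simps)
    have "cmod (E u g - E f g) = cmod (E w g)" using split[OF gfe] by simp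
    also have "\<dots> \<le> D * l2_norm lborel w * L1_norm g" unfolding D_def by (rule far[OF w g])
    also have "\<dots> \<le> D * (2 * D / \<kappa>\<^sup>2 * nf) * L1_norm g"
      by (intro mult_right_mono mult_left_mono wb D integral_nonneg_AE) simp
    finally show ?thesis by (simp add: C_def nf_def mult.assoc)
  qed
  moreover have "C \<ge> 0" using D by (simp add: C_def)
  ultimately show ?thesis using that by blast
qed

lemma exterior_solution_weak:
  assumes "bounded \<Omega>" "f \<in> finite_energy"
  shows "weak_solution s \<Omega> a f (exterior_solution s \<Omega> a f)"
  unfolding exterior_solution_def by (rule someI_ex[OF weak_solution_exists[OF assms]])

end

section \<open>Recovering the density\<close>

lemma DN_map_test_functions:
  assumes "angular_density s a" "f \<in> test_functions W1" "g \<in> test_functions W2"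
  shows "DN_map s \<Omega> W1 W2 a f g = energy_form s a (exterior_solution s \<Omega> a f) g"
  using angular_density.test_function_sobolev_tilde[OF assms(1,2)]
    angular_density.test_function_sobolev_tilde[OF assms(1,3)]
  by (simp add: DN_map_def)

text \<open>If \<open>a \<theta> > b \<theta>\<close>, then at \<open>t \<theta>\<close> the first kernel exceeds the second by a multiple of
  \<open>t powr (- n - 2 s)\<close>. Bumps near \<open>x0 + t \<theta>\<close> and \<open>x0\<close> detect this excess, and for small \<open>t\<close> it beats
  the constant of \<open>exterior_remainder_bound\<close>. Exchanging the densities gives the reverse inequality.\<close>
lemma density_le_of_DN_map_eq:
  fixes a b :: "'a::euclidean_space \<Rightarrow> real"
  assumes ang: "angular_density s a" "angular_density s b"
    and \<Omega>: "bounded \<Omega>" and W: "open W1" "open W2" "x0 \<in> W1 \<inter> W2" "W1 \<subseteq> - closure \<Omega>"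
    and DN: "\<And>f g. f \<in> test_functions W1 \<Longrightarrow> g \<in> test_functions W2 \<Longrightarrow>
      DN_map s \<Omega> W1 W2 a f g = DN_map s \<Omega> W1 W2 b f g"
    and \<theta>: "norm \<theta> = 1"
  shows "a \<theta> \<le> b \<theta>"
proof (rule ccontr)
  interpret A: angular_density s a by (rule ang)
  interpret B: angular_density s b by (rule ang)
  assume "\<not> a \<theta> \<le> b \<theta>"
  define \<eta> where "\<eta> = a \<theta> - b \<theta>"
  have \<eta>: "\<eta> > 0" using \<open>\<not> a \<theta> \<le> b \<theta>\<close> by (simp add: \<eta>_def)
  have "open (W1 \<inter> W2)" using W by (intro open_Int)
  then obtain r where r: "r > 0" "ball x0 r \<subseteq> W1 \<inter> W2" using W(3) open_contains_ball by blast
  define \<rho> where "\<rho> = r / 2"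
  define N where "N = ball x0 \<rho>"
  have \<rho>: "\<rho> > 0" using r by (simp add: \<rho>_def)
  have N: "N \<subseteq> W1" "N \<subseteq> W2" using r by (auto simp: N_def \<rho>_def)
  have far: "\<rho> \<le> dist x y" if "x \<in> \<Omega>" "y \<in> N" for x y
  proof -
    have "x \<notin> ball x0 r" using that(1) r(2) W(4) closure_subset[of \<Omega>] by blast
    then show ?thesis
      using that(2) dist_triangle[of x0 x y] by (auto simp: N_def \<rho>_def dist_commute)
  qed
  obtain Ca where Ca: "Ca \<ge> 0" "\<forall>f\<in>test_functions N. \<forall>g\<in>test_functions N. \<forall>u. weak_solution s \<Omega> a f u \<longrightarrow>
    cmod (energy_form s a u g - energy_form s a f g) \<le>
      Ca * L1_norm f * L1_norm g"
    by (rule A.exterior_remainder_bound[OF \<Omega> \<rho> far])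
  obtain Cb where Cb: "Cb \<ge> 0" "\<forall>f\<in>test_functions N. \<forall>g\<in>test_functions N. \<forall>u. weak_solution s \<Omega> b f u \<longrightarrow>
    cmod (energy_form s b u g - energy_form s b f g) \<le>
      Cb * L1_norm f * L1_norm g"
    by (rule B.exterior_remainder_bound[OF \<Omega> \<rho> far])
  define C where "C = Ca + Cb"
  have C: "C \<ge> 0" using Ca(1) Cb(1) by (simp add: C_def)
  have key: "cmod (energy_form s a f g - energy_form s b f g) \<le>
      C * L1_norm f * L1_norm g"
    if f: "f \<in> test_functions N" and g: "g \<in> test_functions N" for f g
  proof -
    define u v where "u = exterior_solution s \<Omega> a f" and "v = exterior_solution s \<Omega> b f"
    have "weak_solution s \<Omega> a f u" "weak_solution s \<Omega> b f v"
      unfolding u_def v_def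
      by (intro A.exterior_solution_weak B.exterior_solution_weak \<Omega>
            A.test_function_finite_energy[OF f] B.test_function_finite_energy[OF f])+
    then have 1: "cmod (energy_form s a u g - energy_form s a f g) \<le> Ca * L1_norm f * L1_norm g"
      "cmod (energy_form s b v g - energy_form s b f g) \<le> Cb * L1_norm f * L1_norm g"
      using Ca(2) Cb(2) f g by blast+
    have fW: "f \<in> test_functions W1" and gW: "g \<in> test_functions W2"
      using f g test_functions_mono[OF N(1)] test_functions_mono[OF N(2)] by auto
    have "energy_form s a u g = energy_form s b v g"
      using DN[OF fW gW] unfolding DN_map_test_functions[OF ang(1) fW gW] DN_map_test_functions[OF ang(2) fW gW]
      by (simp add: u_def v_def)
    then have "energy_form s a f g - energy_form s b f g =
        (energy_form s b v g - energy_form s b f g) - (energy_form s a u g - energy_form s a f g)" by simp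
    then have "cmod (energy_form s a f g - energy_form s b f g) \<le>
        cmod (energy_form s b v g - energy_form s b f g) + cmod (energy_form s a u g - energy_form s a f g)"
      using norm_triangle_ineq4 by metis
    then show ?thesis using 1 by (simp add: C_def distrib_right)
  qed
  define p where "p = real DIM('a) + 2 * s"
  have "1 \<le> real DIM('a)" using DIM_positive[where 'a='a] by linarith
  then have p: "p \<ge> 1" unfolding p_def using A.s_pos by linarith
  \<comment> \<open>As \<open>t \<le> 1 \<le> p\<close>, the last bound gives \<open>t powr p \<le> \<eta> / (4 (C + 1))\<close> and so \<open>m > C\<close> below;
    \<open>\<rho> / 2\<close> leaves room for the bumps inside \<open>N\<close>.\<close>
  define t where "t = min (min 1 (\<rho> / 2)) (\<eta> / (4 * (C + 1)))"
  have t: "t > 0" "t \<le> 1" "t \<le> \<rho> / 2" "t \<le> \<eta> / (4 * (C + 1))" using \<rho> \<eta> C unfolding t_def by (simp, simp, linarith, linarith)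
  \<comment> \<open>Half the excess of the first kernel at \<open>t \<theta>\<close>; by continuity at least \<open>m\<close> of it survives near by.\<close>
  define m where "m = \<eta> / 2 * t powr (- p)"
  have mC: "m > C"
  proof -
    have "t powr p \<le> t powr 1" using t p by (intro powr_mono') auto
    also have "\<dots> \<le> \<eta> / (4 * (C + 1))" using t by simp
    finally have "t powr p * (4 * (C + 1)) \<le> \<eta>" using C by (simp add: pos_le_divide_eq)
    moreover have "t powr p > 0" using t by simp
    ultimately have "2 * (C + 1) \<le> m" using t by (simp add: m_def powr_minus field_simps)
    then show ?thesis using C by simp
  qed
  have Kt: "kernel s a (t *\<^sub>R \<theta>) - kernel s b (t *\<^sub>R \<theta>) = 2 * m"
    using A.K_scale[OF t(1), of \<theta>] B.K_scale[OF t(1), of \<theta>] \<theta>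
    by (simp add: kernel_def m_def \<eta>_def p_def algebra_simps)
  have m0: "m > 0" using mC C by simp
  have "continuous_on (- {0}) (\<lambda>z. kernel s a z - kernel s b z)"
    by (intro continuous_intros A.K_continuous B.K_continuous)
  moreover have "t *\<^sub>R \<theta> \<in> - {0}" using t \<theta> by auto
  ultimately have "isCont (\<lambda>z. kernel s a z - kernel s b z) (t *\<^sub>R \<theta>)"
    by (simp add: continuous_on_eq_continuous_at open_Compl)
  then have "\<forall>\<^sub>F z in at (t *\<^sub>R \<theta>). kernel s a z - kernel s b z > m"
    using Kt m0 by (intro order_tendstoD(1)[of _ "2 * m"]) (auto simp: isCont_def)
  then obtain e where e: "e > 0" "\<And>z. z \<noteq> t *\<^sub>R \<theta> \<Longrightarrow> dist z (t *\<^sub>R \<theta>) < e \<Longrightarrow> kernel s a z - kernel s b z > m"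
    by (auto simp: eventually_at)
  \<comment> \<open>Differences of points of the two bumps stay within \<open>2 \<epsilon>\<close> of \<open>t \<theta>\<close>: close enough for the bound
    by \<open>m\<close>, and at least \<open>t / 2\<close> away from the singularity.\<close>
  define \<epsilon> where "\<epsilon> = min (e / 2) (t / 4)"
  have \<epsilon>: "\<epsilon> > 0" "2 * \<epsilon> \<le> e" "4 * \<epsilon> \<le> t" using e(1) t(1) by (auto simp: \<epsilon>_def)
  define f where "f x = complex_of_real (bump (x0 + t *\<^sub>R \<theta>) \<epsilon> 0 x)" for x
  define g where "g x = complex_of_real (bump x0 \<epsilon> 0 x)" for x
  have fN: "f \<in> test_functions N"
    unfolding f_def[abs_def]
  proof (rule bump_test_function[OF \<epsilon>(1)], rule subsetI)
    fix x assume "x \<in> cball (x0 + t *\<^sub>R \<theta>) \<epsilon>"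
    then have "dist (x0 + t *\<^sub>R \<theta>) x \<le> \<epsilon>" by simp
    moreover have "dist x0 (x0 + t *\<^sub>R \<theta>) = t" using t \<theta> by (simp add: dist_norm)
    ultimately have "dist x0 x \<le> t + \<epsilon>" using dist_triangle[of x0 x "x0 + t *\<^sub>R \<theta>"] by simp
    then show "x \<in> N" using \<epsilon> t \<rho> by (simp add: N_def)
  qed
  have gN: "g \<in> test_functions N"
    unfolding g_def[abs_def] by (rule bump_test_function[OF \<epsilon>(1)]) (use \<epsilon> t \<rho> in \<open>auto simp: N_def\<close>)
  have supp: "f x \<noteq> 0 \<Longrightarrow> dist (x0 + t *\<^sub>R \<theta>) x < \<epsilon>" "g x \<noteq> 0 \<Longrightarrow> dist x0 x < \<epsilon>" for x
    using bump_pos_iff[OF \<epsilon>(1), of "x0 + t *\<^sub>R \<theta>" 0 x] bump_pos_iff[OF \<epsilon>(1), of x0 0 x]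
      bump_nonneg[of "x0 + t *\<^sub>R \<theta>" \<epsilon> 0 x] bump_nonneg[of x0 \<epsilon> 0 x]
    by (auto simp: f_def g_def less_le)
  have near: "dist (x - y) (t *\<^sub>R \<theta>) < 2 * \<epsilon>" if "f x \<noteq> 0" "g y \<noteq> 0" for x y
  proof -
    have "x - y - t *\<^sub>R \<theta> = (x - (x0 + t *\<^sub>R \<theta>)) - (y - x0)" by (simp add: algebra_simps)
    then have "norm (x - y - t *\<^sub>R \<theta>) \<le> norm (x - (x0 + t *\<^sub>R \<theta>)) + norm (y - x0)"
      using norm_triangle_ineq4 by metis
    then show ?thesis using supp(1)[OF that(1)] supp(2)[OF that(2)]
      by (simp add: dist_norm norm_minus_commute)
  qed
  have sep: "t / 2 \<le> norm (x - y)" if "f x \<noteq> 0" "g y \<noteq> 0" for x y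
  proof -
    have "t = norm (t *\<^sub>R \<theta>)" using t \<theta> by simp
    also have "\<dots> \<le> norm (x - y) + dist (x - y) (t *\<^sub>R \<theta>)"
      using norm_triangle_sub[of "t *\<^sub>R \<theta>" "x - y"] by (simp add: dist_norm norm_minus_commute)
    finally show ?thesis using near[OF that] \<epsilon> by linarith
  qed
  have disj: "f x = 0 \<or> g x = 0" for x using sep[of x x] t by auto
  have large: "m \<le> kernel s a (x - y) - kernel s b (x - y)" if "f x \<noteq> 0" "g y \<noteq> 0" for x y
    using near[OF that] \<epsilon>(2) e(2)[of "x - y"] Kt m0 by (cases "x - y = t *\<^sub>R \<theta>") force+
  have f1: "integrable lborel f" and g1: "integrable lborel g"
    by (rule test_function_integrable[OF fN], rule test_function_integrable[OF gN])
  have t2: "t / 2 > 0" using t by simp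
  obtain Da where Da: "Da \<ge> 0" "\<forall>z. t / 2 \<le> norm z \<longrightarrow> kernel s a z \<le> Da" by (rule A.K_bounded_away[OF t2])
  obtain Db where Db: "Db \<ge> 0" "\<forall>z. t / 2 \<le> norm z \<longrightarrow> kernel s b z \<le> Db" by (rule B.K_bounded_away[OF t2])
  have Da': "kernel s a (x - y) \<le> Da" if "f x \<noteq> 0" "g y \<noteq> 0" for x y using Da(2) sep[OF that] by blast
  have Db': "kernel s b (x - y) \<le> Db" if "f x \<noteq> 0" "g y \<noteq> 0" for x y using Db(2) sep[OF that] by blast
  note Ea = A.energy_form_separated[OF f1 g1 disj Da(1) Da'] and Eb = B.energy_form_separated[OF f1 g1 disj Db(1) Db']
  define F where "F = (L1_norm f)"
  define H where "H = (L1_norm g)"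
  let ?M = "lborel \<Otimes>\<^sub>M lborel :: ('a \<times> 'a) measure"
  have prod: "integrable ?M (\<lambda>(x, y). cmod (f x) * cmod (g y))" "integrable ?M (\<lambda>(x, y). cmod (g x) * cmod (f y))"
    by (intro integrable_lborel_prod integrable_norm f1 g1)+
  let ?h = "\<lambda>z. m / 2 * (case z of (x, y) \<Rightarrow> cmod (f x) * cmod (g y)) + m / 2 * (case z of (x, y) \<Rightarrow> cmod (g x) * cmod (f y))"
  have "m * F * H = (\<integral>z. ?h z \<partial>?M)"
    using prod integral_lborel_prod[OF integrable_norm[OF f1] integrable_norm[OF g1]]
      integral_lborel_prod[OF integrable_norm[OF g1] integrable_norm[OF f1]]
    by (subst Bochner_Integration.integral_add) (simp_all add: F_def H_def)
  also have "\<dots> \<le> (\<integral>z. Re (A.cross_density f g z - B.cross_density f g z) \<partial>?M)"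
  proof (rule integral_mono)
    show "integrable ?M ?h" using prod by (intro Bochner_Integration.integrable_add integrable_mult_right)
    show "integrable ?M (\<lambda>z. Re (A.cross_density f g z - B.cross_density f g z))"
      by (intro integrable_Re Bochner_Integration.integrable_diff Ea(1) Eb(1))
    fix z :: "'a \<times> 'a"
    obtain x y where z: "z = (x, y)" by (cases z)
    define fr gr where "fr x = bump (x0 + t *\<^sub>R \<theta>) \<epsilon> 0 x" and "gr x = bump x0 \<epsilon> 0 x" for x
    have fg: "f x = of_real (fr x)" "g x = of_real (gr x)" "fr x \<ge> 0" "gr x \<ge> 0" for x
      by (simp_all add: f_def g_def fr_def gr_def bump_nonneg)
    define k where "k = kernel s a (x - y) - kernel s b (x - y)"
    have k': "k = kernel s a (y - x) - kernel s b (y - x)"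
      using A.K_even[of "x - y"] B.K_even[of "x - y"] by (simp add: k_def)
    have 1: "m * (fr x * gr y) \<le> k * (fr x * gr y)"
    proof (cases "fr x = 0 \<or> gr y = 0")
      case False
      then have "m \<le> k" using large[of x y] by (simp add: k_def fg(1,2))
      then show ?thesis using fg(3,4) by (intro mult_right_mono mult_nonneg_nonneg)
    qed auto
    have 2: "m * (fr y * gr x) \<le> k * (fr y * gr x)"
    proof (cases "fr y = 0 \<or> gr x = 0")
      case False
      then have "m \<le> k" using large[of y x] by (simp add: k' fg(1,2))
      then show ?thesis using fg(3,4) by (intro mult_right_mono mult_nonneg_nonneg)
    qed auto
    have "Re (A.cross_density f g z - B.cross_density f g z) = (fr x * gr y + fr y * gr x) / 2 * k"
      by (simp add: z A.cross_density_def B.cross_density_def fg(1,2) k_def field_simps)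
    moreover have "?h z = (m * (fr x * gr y) + m * (fr y * gr x)) / 2"
      using fg(3,4) by (simp add: z fg(1,2) mult_ac)
    ultimately show "?h z \<le> Re (A.cross_density f g z - B.cross_density f g z)"
      using 1 2 by (simp add: algebra_simps)
  qed
  also have "\<dots> = Re (energy_form s b f g - energy_form s a f g)"
    using Ea(1) Eb(1) by (subst integral_Re) (auto simp: Ea(2) Eb(2))
  also have "\<dots> \<le> cmod (energy_form s b f g - energy_form s a f g)" by (rule complex_Re_le_cmod)
  also have "\<dots> \<le> C * F * H" using key[OF fN gN] by (simp add: norm_minus_commute F_def H_def)
  finally have le: "m * (F * H) \<le> C * (F * H)" by (simp add: mult.assoc)
  have pos: "(L1_norm (\<lambda>x. complex_of_real (bump c \<epsilon> 0 x))) > 0"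
    if i: "integrable lborel (\<lambda>x. complex_of_real (bump c \<epsilon> 0 x))" for c :: 'a
  proof -
    have "(L1_norm (\<lambda>x. complex_of_real (bump c \<epsilon> 0 x))) \<noteq> 0"
    proof
      assume "(L1_norm (\<lambda>x. complex_of_real (bump c \<epsilon> 0 x))) = 0"
      then have "AE x in lborel. cmod (complex_of_real (bump c \<epsilon> 0 x)) = 0"
        by (subst (asm) integral_nonneg_eq_0_iff_AE[OF integrable_norm[OF i]]) auto
      then have "AE x in lborel. x \<notin> ball c \<epsilon>"
        by eventually_elim (use bump_pos_iff[OF \<epsilon>(1), of c 0] in force)
      then have "ball c \<epsilon> \<in> null_sets lborel" using AE_iff_null_sets[of "ball c \<epsilon>" lborel] by auto
      then show False
        using open_not_negligible[of "ball c \<epsilon>"] \<epsilon>(1) by (auto simp: negligible_iff_null_sets intro: null_sets_completionI)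
    qed
    moreover have "(L1_norm (\<lambda>x. complex_of_real (bump c \<epsilon> 0 x))) \<ge> 0" by (rule integral_nonneg_AE) simp
    ultimately show ?thesis by linarith
  qed
  have "F > 0" "H > 0" unfolding F_def H_def using pos f1 g1 by (auto simp: f_def[abs_def] g_def[abs_def])
  then have "F * H > 0" by simp
  then have "m \<le> C" by (rule mult_right_le_imp_le[OF le])
  then show False using mC by simp
qed

text \<open>Ellipticity rules out the zero density, because the symbol of that density vanishes.\<close>
lemma smooth_elliptic_density_angular:
  fixes a :: "'a::euclidean_space \<Rightarrow> real"
  assumes s: "0 < s" "s < 1" and a: "smooth_elliptic_density s a"
  shows "angular_density s a"
proof
  show "0 < s" "s < 1" by fact+
  show "a (- \<theta>) = a \<theta>" "0 \<le> a \<theta>" if "\<theta> \<in> sphere 0 1" for \<theta>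
    using a that by (auto simp: smooth_elliptic_density_def)
  obtain U b where U: "sphere 0 1 \<subseteq> U" "smooth_on U b" "\<forall>\<theta>\<in>sphere 0 1. a \<theta> = b \<theta>"
    using a by (auto simp: smooth_elliptic_density_def smooth_on_unit_sphere_def)
  have "continuous_on U b" using U(2) unfolding smooth_on_def by (metis Ck_on.simps(1))
  then have "continuous_on (sphere 0 1) b" using U(1) continuous_on_subset by blast
  then show "continuous_on (sphere 0 1) a" using U(3) continuous_on_cong by (metis (mono_tags, lifting))
  show "\<exists>\<theta>\<in>sphere 0 1. a \<theta> \<noteq> 0"
  proof (rule ccontr)
    assume "\<not> ?thesis"
    then have zero: "a \<theta> = 0" if "\<theta> \<in> sphere 0 1" for \<theta> using that by blast
    have sp: "space (surface_measure :: 'a measure) = sphere 0 1"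
      unfolding surface_measure_def sets_eq_imp_space_eq[OF sets_scale_measure] by (simp add: space_restrict_space)
    have "(\<integral>\<theta>. \<bar>\<xi> \<bullet> \<theta>\<bar> powr (2 * s) * a \<theta> \<partial>surface_measure) = (\<integral>\<theta>. 0 \<partial>(surface_measure :: 'a measure))" for \<xi> :: 'a
      by (rule Bochner_Integration.integral_cong[OF refl]) (unfold sp, simp add: zero)
    then have "symbol s a \<xi> = 0" for \<xi> by (simp add: symbol_def)
    moreover obtain l where "0 < l" "\<And>\<xi>. l * norm \<xi> powr (2 * s) \<le> symbol s a \<xi>"
      using a unfolding smooth_elliptic_density_def elliptic_def by blast
    moreover obtain \<xi> :: 'a where "norm \<xi> = 1" using vector_choose_size[of 1] by auto
    ultimately have "l * norm \<xi> powr (2 * s) \<le> 0" by metis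
    then show False using \<open>0 < l\<close> \<open>norm \<xi> = 1\<close> by simp
  qed
qed

theorem theorem1p1:
  fixes s :: real
    and \<Omega> W1 W2 :: "(real ^ 'n) set"
    and a1 a2 :: "real ^ 'n \<Rightarrow> real"
  assumes "0 < s" and "s < 1"
    and "CARD('n) \<ge> 2"
    and "bounded \<Omega>" and "open \<Omega>"
    and "open W1" and "W1 \<noteq> {}" and "compactly_contained W1 (- closure \<Omega>)"
    and "open W2" and "W2 \<noteq> {}" and "compactly_contained W2 (- closure \<Omega>)"
    and "W1 \<inter> W2 \<noteq> {}"
    and "smooth_elliptic_density s a1"
    and "smooth_elliptic_density s a2"
    and "\<forall>f\<in>sobolev_tilde s W1. DN_map s \<Omega> W1 W2 a1 f = DN_map s \<Omega> W1 W2 a2 f"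
  shows "\<forall>\<theta>\<in>sphere 0 1. a1 \<theta> = a2 \<theta>"
proof
  fix \<theta> :: "real ^ 'n" assume "\<theta> \<in> sphere 0 1"
  then have \<theta>: "norm \<theta> = 1" by simp
  have A: "angular_density s a1" "angular_density s a2"
    using assms by (auto intro: smooth_elliptic_density_angular)
  obtain x0 where x0: "x0 \<in> W1 \<inter> W2" using assms by blast
  have sub: "W1 \<subseteq> - closure \<Omega>"
    using \<open>compactly_contained W1 (- closure \<Omega>)\<close> closure_subset[of W1]
    unfolding compactly_contained_def by blast
  have DN: "DN_map s \<Omega> W1 W2 a1 f g = DN_map s \<Omega> W1 W2 a2 f g" if "f \<in> test_functions W1" for f g
    using angular_density.test_function_sobolev_tilde[OF A(1) that]
      \<open>\<forall>f\<in>sobolev_tilde s W1. DN_map s \<Omega> W1 W2 a1 f = DN_map s \<Omega> W1 W2 a2 f\<close> by metis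
  note le = density_le_of_DN_map_eq[OF _ _ \<open>bounded \<Omega>\<close> \<open>open W1\<close> \<open>open W2\<close> x0 sub _ \<theta>]
  show "a1 \<theta> = a2 \<theta>"
  proof (rule antisym)
    show "a1 \<theta> \<le> a2 \<theta>" by (rule le[OF A]) (rule DN)
    show "a2 \<theta> \<le> a1 \<theta>" by (rule le[OF A(2,1)]) (rule DN[symmetric])
  qed
qed

end
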